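(* Let $a\neq b$ be complex numbers, let $Q$ be a fixed complex polynomial with $Q(a)=Q(b)=0$, and let $P$ vary in $\mathcal P_d$. Then for each irreducible non-composition component $A$ of the affine Center Set $CS\subset\mathcal P_d$ we have $$\bar A\subset \overline{CS}\cap ND\subset\overline{MS}\cap ND .$$ Consequently, $\dim A\le \dim(\overline{MS}\cap ND)+1$.
   Context: $\mathcal P$ is the space of all complex polynomials $P$ with $P(a)=P(b)=0$, and $\mathcal P_d\subset \mathcal P$ is the subspace of polynomials of degree at most $d$. The Abel equation $y'=p(x)y^3+q(x)y^2$ has a center on $[a,b]$ if every solution with sufficiently small initial value $y(a)$, analytically continued along the segment from $a$ to $b$, satisfies $y(a)=y(b)$. $CS$ is the set of $P\in\mathcal P_d$ such that the equation with $p=P'$, $q=Q'$ has a center on $[a,b]$; it is an affine algebraic set (given by vanishing of all Taylor coefficients $v_k$, $k\ge2$, of the map $y(a)\mapsto y(b)=y(a)+\sum_{k\ge2}v_k\,y(a)^k$). $MS$ is the set of $P\in\mathcal P_d$ with $\int_a^bP^k(x)q(x)\,dx=0$ for all $k\ge0$. Polynomials $P,Q$ satisfy the Composition Condition on $[a,b]$ if there are polynomials $\tilde P,\tilde Q,W$ with $W(a)=W(b)$, $P=\tilde P(W)$, $Q=\tilde Q(W)$. A non-composition component of $CS$ is an irreducible component not contained in the set of $P\in\mathcal P_d$ satisfying the Composition Condition with $Q$. $P\mathcal P_d$ is the projective space compactifying $\mathcal P_d$: classes of pairs $(S,\nu)\neq(0,0)$, $S\in\mathcal P_d$, $\nu\in\mathbb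 C$, up to common scaling, with $P\in\mathcal P_d$ identified with the class of $(P,1)$; the infinite hyperplane is $\{\nu=0\}$. For an algebraic set $Y\subset\mathcal P_d$, $\bar Y$ denotes the intersection of (the projective closure of) $Y$ with the infinite hyperplane. A polynomial $P\in\mathcal P$ is definite if for every $Q_1\in\mathcal P$, vanishing of $\int_a^bP^k(x)Q_1'(x)\,dx$ for all $k\ge0$ implies that $P$ and $Q_1$ satisfy the Composition Condition on $[a,b]$; $ND$ denotes the set of non-definite polynomials (invariant under nonzero scaling), viewed at infinity as the set of the classes of $(S,0)$ with $S\in\mathcal P_d$ non-definite. The empty set has dimension $-1$. *)

theory Defs
  imports "HOL-Complex_Analysis.Complex_Analysis"
begin

section \<open>Irreducible components and Krull dimension of a topological space\<close>

definition irreducible_in :: "'a topology \<Rightarrow> 'a set \<Rightarrow> bool" where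
  "irreducible_in X S \<longleftrightarrow> S \<subseteq> topspace X \<and> S \<noteq> {} \<and>
     (\<forall>C D. closedin X C \<and> closedin X D \<and> S \<subseteq> C \<union> D \<longrightarrow> S \<subseteq> C \<or> S \<subseteq> D)"

definition irreducible_components :: "'a topology \<Rightarrow> 'a set set" where
  "irreducible_components X =
     {S. irreducible_in X S \<and> (\<forall>T. irreducible_in X T \<and> S \<subseteq> T \<longrightarrow> T = S)}"

text \<open>The dimension is the supremum of the lengths of strict chains of irreducible closed
  subsets. It takes values in \<open>ereal\<close>, since the empty space has dimension \<open>-1\<close> and the
  supremum is infinite if the lengths are unbounded.\<close>

definition krull_dim :: "'a topology \<Rightarrow> ereal" where
  "krull_dim X = Sup (insert (- 1) {ereal (real n) | n. \<exists>Z :: nat \<Rightarrow> 'a set.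
     (\<forall>i\<le>n. closedin X (Z i) \<and> irreducible_in X (Z i)) \<and> (\<forall>i<n. Z i \<subset> Z (Suc i))})"


section \<open>The spaces of polynomials and their Zariski topologies\<close>

inductive_set polynomial_functions :: "('v \<Rightarrow> complex) set \<Rightarrow> ('v \<Rightarrow> complex) set"
  for G :: "('v \<Rightarrow> complex) set" where
  coordinate: "g \<in> G \<Longrightarrow> g \<in> polynomial_functions G"
| const: "(\<lambda>_. c) \<in> polynomial_functions G"
| add: "f \<in> polynomial_functions G \<Longrightarrow> g \<in> polynomial_functions G \<Longrightarrow>
     (\<lambda>v. f v + g v) \<in> polynomial_functions G"
| mult: "f \<in> polynomial_functions G \<Longrightarrow> g \<in> polynomial_functions G \<Longrightarrow>
     (\<lambda>v. f v * g v) \<in> polynomial_functions G"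

definition polys_vanishing :: "complex \<Rightarrow> complex \<Rightarrow> complex poly set" where
  "polys_vanishing a b = {P. poly P a = 0 \<and> poly P b = 0}"

definition polys_vanishing_deg :: "complex \<Rightarrow> complex \<Rightarrow> nat \<Rightarrow> complex poly set" where
  "polys_vanishing_deg a b d = {P \<in> polys_vanishing a b. degree P \<le> d}"

text \<open>The regular functions on the affine space of polynomials of degree at most \<open>d\<close> vanishing
  at \<open>a\<close> and \<open>b\<close> are the polynomials in the coefficients (those beyond \<open>d\<close> vanish).\<close>

definition affine_regular :: "(complex poly \<Rightarrow> complex) set" where
  "affine_regular = polynomial_functions (range (\<lambda>i P. coeff P i))"

definition zariski_affine :: "complex \<Rightarrow> complex \<Rightarrow> nat \<Rightarrow> complex poly topology" where
  "zariski_affine a b d = topology (\<lambda>U. \<exists>F \<subseteq> affine_regular.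
     U = {P \<in> polys_vanishing_deg a b d. \<exists>f\<in>F. f P \<noteq> 0})"

text \<open>Points of the projective space are represented as classes of pairs \<open>(S, \<nu>)\<close> under
  multiplication by nonzero scalars.\<close>

type_synonym proj = "(complex poly \<times> complex) set"

definition proj_point :: "complex poly \<times> complex \<Rightarrow> proj" where
  "proj_point v = {(smult c (fst v), c * snd v) | c. c \<noteq> 0}"

definition proj_cone :: "complex \<Rightarrow> complex \<Rightarrow> nat \<Rightarrow> (complex poly \<times> complex) set" where
  "proj_cone a b d = polys_vanishing_deg a b d \<times> UNIV - {(0, 0)}"

definition homogeneous_functions :: "(complex poly \<times> complex \<Rightarrow> complex) set" where
  "homogeneous_functions =
     {f \<in> polynomial_functions (insert snd (range (\<lambda>i v. coeff (fst v) i))).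
        \<exists>n. \<forall>c S \<nu>. f (smult c S, c * \<nu>) = c ^ n * f (S, \<nu>)}"

definition zariski_proj :: "complex \<Rightarrow> complex \<Rightarrow> nat \<Rightarrow> proj topology" where
  "zariski_proj a b d = topology (\<lambda>U. \<exists>F \<subseteq> homogeneous_functions.
     U = proj_point ` {v \<in> proj_cone a b d. \<exists>f\<in>F. f v \<noteq> 0})"

definition infinite_hyperplane :: "complex \<Rightarrow> complex \<Rightarrow> nat \<Rightarrow> proj set" where
  "infinite_hyperplane a b d = {proj_point (S, 0) | S. (S, 0) \<in> proj_cone a b d}"

definition at_infinity_part :: "complex \<Rightarrow> complex \<Rightarrow> nat \<Rightarrow> complex poly set \<Rightarrow> proj set" where
  "at_infinity_part a b d Y =
     (zariski_proj a b d closure_of ((\<lambda>P. proj_point (P, 1)) ` Y)) \<inter> infinite_hyperplane a b d"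


section \<open>Centers, moments and composition\<close>

definition abel_solution_on ::
  "complex poly \<Rightarrow> complex poly \<Rightarrow> complex set \<Rightarrow> (complex \<Rightarrow> complex) \<Rightarrow> bool" where
  "abel_solution_on p q U y \<longleftrightarrow>
     (\<forall>x\<in>U. (y has_field_derivative poly p x * y x ^ 3 + poly q x * y x ^ 2) (at x))"

text \<open>For \<open>a \<noteq> b\<close> the segment is an embedded arc, so the analytic continuation of a local solution
  along it is a single holomorphic solution on an open neighbourhood of the segment; for small
  initial values such a continuation exists.\<close>

definition has_center ::
  "complex \<Rightarrow> complex \<Rightarrow> complex poly \<Rightarrow> complex poly \<Rightarrow> bool" where
  "has_center a b p q \<longleftrightarrow> (\<exists>\<epsilon>>0. \<forall>U y.
     open U \<and> closed_segment a b \<subseteq> U \<and> abel_solution_on p q U y \<and> cmod (y a) < \<epsilon> \<longrightarrow> y a = y b)"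

definition center_set ::
  "complex \<Rightarrow> complex \<Rightarrow> nat \<Rightarrow> complex poly \<Rightarrow> complex poly set" where
  "center_set a b d Q = {P \<in> polys_vanishing_deg a b d. has_center a b (pderiv P) (pderiv Q)}"

definition moments_vanish ::
  "complex \<Rightarrow> complex \<Rightarrow> complex poly \<Rightarrow> complex poly \<Rightarrow> bool" where
  "moments_vanish a b P Q \<longleftrightarrow>
     (\<forall>k. contour_integral (linepath a b) (\<lambda>x. poly P x ^ k * poly (pderiv Q) x) = 0)"

definition moment_set ::
  "complex \<Rightarrow> complex \<Rightarrow> nat \<Rightarrow> complex poly \<Rightarrow> complex poly set" where
  "moment_set a b d Q = {P \<in> polys_vanishing_deg a b d. moments_vanish a b P Q}"

definition composition_condition ::
  "complex \<Rightarrow> complex \<Rightarrow> complex poly \<Rightarrow> complex poly \<Rightarrow> bool" where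
  "composition_condition a b P Q \<longleftrightarrow>
     (\<exists>P' Q' W. poly W a = poly W b \<and> P = pcompose P' W \<and> Q = pcompose Q' W)"

definition composition_set ::
  "complex \<Rightarrow> complex \<Rightarrow> nat \<Rightarrow> complex poly \<Rightarrow> complex poly set" where
  "composition_set a b d Q = {P \<in> polys_vanishing_deg a b d. composition_condition a b P Q}"

definition non_composition_components ::
  "complex \<Rightarrow> complex \<Rightarrow> nat \<Rightarrow> complex poly \<Rightarrow> complex poly set set" where
  "non_composition_components a b d Q =
     {A \<in> irreducible_components (subtopology (zariski_affine a b d) (center_set a b d Q)).
        \<not> A \<subseteq> composition_set a b d Q}"

definition definite_poly :: "complex \<Rightarrow> complex \<Rightarrow> complex poly \<Rightarrow> bool" where
  "definite_poly a b P \<longleftrightarrow> P \<in> polys_vanishing a b \<and>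
     (\<forall>Q\<in>polys_vanishing a b. moments_vanish a b P Q \<longrightarrow> composition_condition a b P Q)"

definition non_definite_set :: "complex \<Rightarrow> complex \<Rightarrow> complex poly set" where
  "non_definite_set a b = {P \<in> polys_vanishing a b. \<not> definite_poly a b P}"

definition non_definite_at_infinity :: "complex \<Rightarrow> complex \<Rightarrow> nat \<Rightarrow> proj set" where
  "non_definite_at_infinity a b d =
     {proj_point (S, 0) | S. (S, 0) \<in> proj_cone a b d \<and> S \<in> non_definite_set a b}"


section \<open>The two families of sets are topologies\<close>

lemma istopology_nonvanishing:
  fixes R :: "('v \<Rightarrow> complex) set" and V :: "'v set" and h :: "'v \<Rightarrow> 'w"
  assumes mult: "\<And>f g. f \<in> R \<Longrightarrow> g \<in> R \<Longrightarrow> (\<lambda>v. f v * g v) \<in> R"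
    and cong: "\<And>f v w. f \<in> R \<Longrightarrow> h v = h w \<Longrightarrow> f v = 0 \<longleftrightarrow> f w = 0"
  shows "istopology (\<lambda>U. \<exists>F\<subseteq>R. U = h ` {v \<in> V. \<exists>f\<in>F. f v \<noteq> 0})"
proof -
  define N where "N F = h ` {v \<in> V. \<exists>f\<in>F. f v \<noteq> 0}" for F :: "('v \<Rightarrow> complex) set"
  have mem: "x \<in> N F \<longleftrightarrow> (\<exists>v f. x = h v \<and> v \<in> V \<and> f \<in> F \<and> f v \<noteq> 0)" for x F
    unfolding N_def by blast
  have int: "\<exists>H\<subseteq>R. N F \<inter> N G = N H" if F: "F \<subseteq> R" and G: "G \<subseteq> R" for F G
  proof (intro exI conjI)
    let ?H = "{\<lambda>v. f v * g v | f g. f \<in> F \<and> g \<in> G}"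
    show "?H \<subseteq> R"
    proof
      fix k assume "k \<in> ?H"
      then obtain f g where "k = (\<lambda>v. f v * g v)" "f \<in> F" "g \<in> G"
        by (elim CollectE conjE exE)
      then show "k \<in> R"
        using mult[of f g] subsetD[OF F] subsetD[OF G] by simp
    qed
    show "N F \<inter> N G = N ?H"
    proof (rule set_eqI, rule iffI)
      fix x assume "x \<in> N F \<inter> N G"
      then obtain v f w g where x: "x = h v" "v \<in> V" "f \<in> F" "f v \<noteq> 0"
        "x = h w" "g \<in> G" "g w \<noteq> 0"
        unfolding Int_iff mem by (elim conjE exE)
      have "h v = h w"
        using x(1,5) by (rule trans[OF sym])
      from cong[OF subsetD[OF G x(6)] this] x(4,7) have "f v * g v \<noteq> 0"
        by simp
      moreover have "(\<lambda>v. f v * g v) \<in> ?H"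
        using x(3,6) by blast
      ultimately show "x \<in> N ?H"
        unfolding mem using x(1,2)
        by (intro exI[of _ v] exI[of _ "\<lambda>v. f v * g v"] conjI)
    next
      fix x assume "x \<in> N ?H"
      then obtain v k where x: "x = h v" "v \<in> V" "k \<in> ?H" "k v \<noteq> 0"
        unfolding mem by (elim conjE exE)
      from x(3) obtain f g where k: "k = (\<lambda>v. f v * g v)" "f \<in> F" "g \<in> G"
        by (elim CollectE conjE exE)
      have "f v \<noteq> 0" "g v \<noteq> 0"
        using x(4) unfolding k(1) by simp_all
      then show "x \<in> N F \<inter> N G"
        unfolding Int_iff mem using x(1,2) k(2,3) by blast
    qed
  qed
  have union: "\<exists>H\<subseteq>R. \<Union>K = N H" if K: "\<forall>U\<in>K. \<exists>F\<subseteq>R. U = N F" for K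
  proof -
    from bchoice[OF K] obtain F where F: "\<forall>U\<in>K. F U \<subseteq> R \<and> U = N (F U)"
      by (elim exE)
    show ?thesis
    proof (intro exI conjI)
      show "(\<Union>U\<in>K. F U) \<subseteq> R"
        by (intro UN_least bspec[OF F, THEN conjunct1])
      have "\<Union>K = (\<Union>U\<in>K. U)"
        by simp
      also have "\<dots> = (\<Union>U\<in>K. N (F U))"
        by (intro SUP_cong refl bspec[OF F, THEN conjunct2])
      also have "\<dots> = N (\<Union>U\<in>K. F U)"
        by (rule set_eqI) (simp only: mem UN_iff, blast)
      finally show "\<Union>K = N (\<Union>U\<in>K. F U)" .
    qed
  qed
  have "istopology (\<lambda>U. \<exists>F\<subseteq>R. U = N F)"
    unfolding istopology_def
  proof (intro conjI allI impI)
    fix S T assume "\<exists>F\<subseteq>R. S = N F" "\<exists>F\<subseteq>R. T = N F"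
    then obtain F G where "F \<subseteq> R" "S = N F" "G \<subseteq> R" "T = N G"
      by (elim exE conjE)
    then show "\<exists>F\<subseteq>R. S \<inter> T = N F"
      by (simp only: int)
  qed (rule union)
  then show ?thesis
    unfolding N_def .
qed

lemma closed_iff_vanishing:
  fixes h :: "'v \<Rightarrow> 'w"
  assumes cong: "\<And>f v w. f \<in> R \<Longrightarrow> h v = h w \<Longrightarrow> f v = (0 :: complex) \<longleftrightarrow> f w = 0"
  shows "C \<subseteq> h ` V \<and> (\<exists>F\<subseteq>R. h ` V - C = h ` {v \<in> V. \<exists>f\<in>F. f v \<noteq> 0}) \<longleftrightarrow>
    (\<exists>F\<subseteq>R. C = h ` {v \<in> V. \<forall>f\<in>F. f v = 0})"
proof -
  have compl: "C \<subseteq> W \<and> W - C = A \<longleftrightarrow> C = B"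
    if "A \<union> B = W" "A \<inter> B = {}" for W A B :: "'w set"
    using that by auto
  have key: "C \<subseteq> h ` V \<and> h ` V - C = h ` {v \<in> V. \<exists>f\<in>F. f v \<noteq> 0} \<longleftrightarrow>
      C = h ` {v \<in> V. \<forall>f\<in>F. f v = 0}" if F: "F \<subseteq> R" for F
  proof -
    let ?N = "h ` {v \<in> V. \<exists>f\<in>F. f v \<noteq> 0}"
    let ?Z = "h ` {v \<in> V. \<forall>f\<in>F. f v = 0}"
    have un: "?N \<union> ?Z = h ` V"
      by blast
    have "?N \<inter> ?Z = {}"
    proof (rule equals0I)
      fix x assume "x \<in> ?N \<inter> ?Z"
      then obtain v w f where "x = h v" "x = h w" "f \<in> F" "f v \<noteq> 0" "f w = 0"
        by blast
      then show False
        using cong[of f v w] subsetD[OF F, of f] by simp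
    qed
    with un show ?thesis
      by (rule compl)
  qed
  show ?thesis
  proof
    assume "C \<subseteq> h ` V \<and> (\<exists>F\<subseteq>R. h ` V - C = h ` {v \<in> V. \<exists>f\<in>F. f v \<noteq> 0})"
    then obtain F where "F \<subseteq> R" "C \<subseteq> h ` V \<and> h ` V - C = h ` {v \<in> V. \<exists>f\<in>F. f v \<noteq> 0}"
      by (elim conjE exE) simp
    then show "\<exists>F\<subseteq>R. C = h ` {v \<in> V. \<forall>f\<in>F. f v = 0}"
      using key by (intro exI[of _ F]) simp
  next
    assume "\<exists>F\<subseteq>R. C = h ` {v \<in> V. \<forall>f\<in>F. f v = 0}"
    then obtain F where F: "F \<subseteq> R" "C = h ` {v \<in> V. \<forall>f\<in>F. f v = 0}"
      by (elim conjE exE)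
    from key[OF F(1), THEN iffD2, OF F(2)] F(1)
    show "C \<subseteq> h ` V \<and> (\<exists>F\<subseteq>R. h ` V - C = h ` {v \<in> V. \<exists>f\<in>F. f v \<noteq> 0})"
      by (intro conjI exI[of _ F]) simp_all
  qed
qed

lemma openin_zariski_affine:
  "openin (zariski_affine a b d) U \<longleftrightarrow> (\<exists>F \<subseteq> affine_regular.
     U = {P \<in> polys_vanishing_deg a b d. \<exists>f\<in>F. f P \<noteq> 0})"
proof -
  have "istopology (\<lambda>U. \<exists>F \<subseteq> affine_regular.
      U = id ` {P \<in> polys_vanishing_deg a b d. \<exists>f\<in>F. f P \<noteq> 0})"
    unfolding affine_regular_def
    by (rule istopology_nonvanishing) (simp_all add: polynomial_functions.mult)
  from topology_inverse'[OF this] show ?thesis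
    unfolding zariski_affine_def image_id id_apply by (rule fun_cong)
qed

lemma topspace_zariski_affine [simp]:
  "topspace (zariski_affine a b d) = polys_vanishing_deg a b d"
proof (rule antisym)
  show "topspace (zariski_affine a b d) \<subseteq> polys_vanishing_deg a b d"
    using openin_topspace[of "zariski_affine a b d"] unfolding openin_zariski_affine by fast
  have "openin (zariski_affine a b d) (polys_vanishing_deg a b d)"
    unfolding openin_zariski_affine
    by (rule exI[of _ "{\<lambda>_. 1}"])
       (auto simp: affine_regular_def intro: polynomial_functions.const)
  then show "polys_vanishing_deg a b d \<subseteq> topspace (zariski_affine a b d)"
    by (rule openin_subset)
qed

lemma closedin_zariski_affine:
  "closedin (zariski_affine a b d) C \<longleftrightarrow>
     (\<exists>F \<subseteq> affine_regular. C = {P \<in> polys_vanishing_deg a b d. \<forall>f\<in>F. f P = 0})"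
  unfolding closedin_def topspace_zariski_affine openin_zariski_affine
  using closed_iff_vanishing[of affine_regular id C "polys_vanishing_deg a b d"]
  unfolding image_id id_apply by simp

lemma homogeneous_proj_point_cong:
  assumes "f \<in> homogeneous_functions" "proj_point v = proj_point w"
  shows "f v = 0 \<longleftrightarrow> f w = 0"
proof -
  have "w \<in> proj_point w"
    unfolding proj_point_def by (auto intro!: exI[of _ 1] simp: prod_eq_iff)
  then have "w \<in> proj_point v"
    by (simp only: assms(2))
  then obtain c where c: "w = (smult c (fst v), c * snd v)" "c \<noteq> 0"
    unfolding proj_point_def by (elim CollectE exE conjE)
  obtain n where "\<forall>c S \<nu>. f (smult c S, c * \<nu>) = c ^ n * f (S, \<nu>)"
    using assms(1) unfolding homogeneous_functions_def by (elim CollectE exE conjE)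
  then have "f (smult c (fst v), c * snd v) = c ^ n * f (fst v, snd v)"
    by (elim allE)
  then show ?thesis
    using c by (simp only: prod.collapse) simp
qed

lemma homogeneous_mult:
  assumes "f \<in> homogeneous_functions" "g \<in> homogeneous_functions"
  shows "(\<lambda>v. f v * g v) \<in> homogeneous_functions"
proof -
  obtain m where m: "\<forall>c S \<nu>. f (smult c S, c * \<nu>) = c ^ m * f (S, \<nu>)"
    using assms(1) unfolding homogeneous_functions_def by (elim CollectE exE conjE)
  obtain n where n: "\<forall>c S \<nu>. g (smult c S, c * \<nu>) = c ^ n * g (S, \<nu>)"
    using assms(2) unfolding homogeneous_functions_def by (elim CollectE exE conjE)
  have "\<forall>c S \<nu>. f (smult c S, c * \<nu>) * g (smult c S, c * \<nu>) =
      c ^ (m + n) * (f (S, \<nu>) * g (S, \<nu>))"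
    by (simp only: m n power_add mult.assoc mult.left_commute simp_thms)
  moreover have "(\<lambda>v. f v * g v) \<in>
      polynomial_functions (insert snd (range (\<lambda>i v. coeff (fst v) i)))"
    using assms unfolding homogeneous_functions_def
    by (intro polynomial_functions.mult) (elim CollectE conjE, assumption)+
  ultimately show ?thesis
    unfolding homogeneous_functions_def by (intro CollectI conjI exI[of _ "m + n"])
qed

lemma openin_zariski_proj:
  "openin (zariski_proj a b d) U \<longleftrightarrow> (\<exists>F \<subseteq> homogeneous_functions.
     U = proj_point ` {v \<in> proj_cone a b d. \<exists>f\<in>F. f v \<noteq> 0})"
proof -
  have "istopology (\<lambda>U. \<exists>F \<subseteq> homogeneous_functions.
      U = proj_point ` {v \<in> proj_cone a b d. \<exists>f\<in>F. f v \<noteq> 0})"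
    by (rule istopology_nonvanishing[OF homogeneous_mult homogeneous_proj_point_cong])
  from topology_inverse'[OF this] show ?thesis
    unfolding zariski_proj_def by (rule fun_cong)
qed

lemma topspace_zariski_proj [simp]:
  "topspace (zariski_proj a b d) = proj_point ` proj_cone a b d"
proof (rule antisym)
  obtain F where "F \<subseteq> homogeneous_functions" and top: "topspace (zariski_proj a b d) =
      proj_point ` {v \<in> proj_cone a b d. \<exists>f\<in>F. f v \<noteq> 0}"
    using openin_topspace[of "zariski_proj a b d"] unfolding openin_zariski_proj
    by (elim exE conjE)
  show "topspace (zariski_proj a b d) \<subseteq> proj_point ` proj_cone a b d"
    unfolding top by (intro image_mono) (rule Collect_subset)
  have "(\<lambda>_. 1) \<in> homogeneous_functions"
    unfolding homogeneous_functions_def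
    by (intro CollectI conjI polynomial_functions.const exI[of _ 0]) simp
  then have "openin (zariski_proj a b d) (proj_point ` proj_cone a b d)"
    unfolding openin_zariski_proj by (intro exI[of _ "{\<lambda>_. 1}"]) auto
  then show "proj_point ` proj_cone a b d \<subseteq> topspace (zariski_proj a b d)"
    by (rule openin_subset)
qed

lemma closedin_zariski_proj:
  "closedin (zariski_proj a b d) C \<longleftrightarrow>
     (\<exists>F \<subseteq> homogeneous_functions. C = proj_point ` {v \<in> proj_cone a b d. \<forall>f\<in>F. f v = 0})"
  unfolding closedin_def topspace_zariski_proj openin_zariski_proj
  by (rule closed_iff_vanishing) (rule homogeneous_proj_point_cong)

end

theory Submission
  imports Defs "HOL-Computational_Algebra.Fundamental_Theorem_Algebra"
begin

text \<open>Expanding a first integral of \<open>y' = P' y^3 + Q' y^2\<close> that equals \<open>y^-2\<close> at \<open>a\<close> in powers of \<open>y\<close>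
  gives polynomial equations for the center set. Every second one, of degree \<open>n\<close> in \<open>P\<close>, has a nonzero
  multiple of the moment \<open>\<integral> P^n Q'\<close> as its leading form, so points of the center set at infinity
  have vanishing moments.

  Let \<open>S\<close> be a definite point at infinity of a component \<open>A\<close>. The polynomials with vanishing moments
  against \<open>S\<close> all lie in \<open>\<complex>[W]\<close> for one right factor \<open>W\<close> of \<open>S\<close> with \<open>W(a) = W(b)\<close>; in particular
  \<open>Q\<close> does. The homogenized center equations vanish on \<open>\<complex>[W]\<close>, so they are linear combinations
  \<open>\<Sum>e. M e * l e\<close> of the linear forms \<open>l e\<close> cutting out \<open>\<complex>[W]\<close>. At \<open>(S, 0)\<close> this linear system is
  injective: a kernel vector \<open>R\<close> has \<open>\<integral> S^k R Q' = 0\<close> for all \<open>k\<close>, whence \<open>R \<in> \<complex>[W]\<close>. Elimination yields a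
  form \<open>D\<close> with \<open>D(S, 0) \<noteq> 0\<close> such that the center set outside \<open>D = 0\<close> consists of elements of
  \<open>\<complex>[W]\<close>. As \<open>A\<close> is irreducible and not contained in the composition set, \<open>D\<close> vanishes on \<open>A\<close>, hence
  at \<open>(S, 0)\<close>, a contradiction.

  For the dimension, suppose that \<open>A\<close> contains a chain of length \<open>k + 1\<close> but its part at infinity has
  no chain of length \<open>k\<close>. Then \<open>k\<close> linear forms have no common zero on the part at infinity, and by the
  Nullstellensatz the regular functions of degree at most \<open>m\<close> on \<open>A\<close> span a space of dimension
  \<open>O(m^k)\<close>. The chain provides \<open>k + 1\<close> regular functions whose monomials are linearly independent
  on \<open>A\<close>, so the dimension is at least of order \<open>m^(k+1)\<close>.\<close>

section \<open>Forms and polynomial functions on the space of pairs\<close>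

text \<open>Only necessary conditions for a center are used; that the \<open>center_form\<close>
  equations cut out the center set is never claimed. Closures are handled by algebra alone: by
  \<open>closure_affine_iff\<close>, a point lies in the closure of \<open>Y\<close> exactly when
  every homogeneous function vanishing on \<open>Y\<close> vanishes there. The obstacle at a
  definite point is that injectivity is known at \<open>(S, 0)\<close> only, while \<open>A\<close>
  comes near that point merely in the Zariski sense. A single form that is nonzero at
  \<open>(S, 0)\<close> spreads injectivity to a Zariski neighbourhood, which an irreducible set
  meeting it cannot escape. The forms \<open>l e\<close> are coordinates on all polynomials of
  degree at most \<open>d\<close>, without conditions at \<open>a\<close> and \<open>b\<close>.
  Therefore the linear system carries one more row, which records equality of the end values. In the
  dimension bound, chains at infinity consist of sets that are closed in the whole projective space.
  They remain chains inside any set containing the part of \<open>A\<close> at infinity, closed or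
  not.\<close>

definition gens :: "nat \<Rightarrow> (complex poly \<times> complex \<Rightarrow> complex) set" where
  "gens d = insert snd ((\<lambda>i v. coeff (fst v) i) ` {..d})"

abbreviation PF :: "nat \<Rightarrow> (complex poly \<times> complex \<Rightarrow> complex) set" where
  "PF d \<equiv> polynomial_functions (gens d)"

definition scale :: "complex \<Rightarrow> complex poly \<times> complex \<Rightarrow> complex poly \<times> complex" where
  "scale t v = (smult t (fst v), t * snd v)"

text \<open>Mediates between \<open>homogeneous_functions\<close>, which may use every coefficient,
  and the finite set \<open>gens d\<close>. On polynomials of degree at most \<open>d\<close> it is
  the identity, so composing with it loses nothing there and makes the basis theorem and the
  Nullstellensatz applicable.\<close>

definition cut :: "nat \<Rightarrow> complex poly \<times> complex \<Rightarrow> complex poly \<times> complex" where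
  "cut d v = (poly_cutoff (Suc d) (fst v), snd v)"

text \<open>Homogeneity is recorded by construction instead of by a scaling law, so that induction
  can produce monomial expansions (\<open>form_monomials\<close>) and difference quotients
  (\<open>form_difference\<close>). The rule \<open>zero\<close> is separate because
  \<open>const\<close> supplies the zero function in degree 0 only.\<close>

inductive form :: "nat \<Rightarrow> nat \<Rightarrow> (complex poly \<times> complex \<Rightarrow> complex) \<Rightarrow> bool" for d where
  const: "form d 0 (\<lambda>_. c)"
| gen: "g \<in> gens d \<Longrightarrow> form d 1 g"
| zero: "form d m (\<lambda>_. 0)"
| add: "form d m f \<Longrightarrow> form d m g \<Longrightarrow> form d m (\<lambda>v. f v + g v)"
| mult: "form d m f \<Longrightarrow> form d n g \<Longrightarrow> form d (m + n) (\<lambda>v. f v * g v)"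

lemma finite_gens [simp]: "finite (gens d)"
  by (simp add: gens_def)

lemma snd_in_gens [simp]: "snd \<in> gens d"
  by (simp add: gens_def)

lemma coeff_in_gens: "i \<le> d \<Longrightarrow> (\<lambda>v. coeff (fst v) i) \<in> gens d"
  by (auto simp: gens_def)

lemma gens_scale: "g \<in> gens d \<Longrightarrow> g (scale t v) = t * g v"
  by (auto simp: gens_def scale_def)

lemma form_scale: "form d m f \<Longrightarrow> f (scale t v) = t ^ m * f v"
  by (induction rule: form.induct) (auto simp: gens_scale algebra_simps power_add)

lemma form_PF: "form d m f \<Longrightarrow> f \<in> PF d"
  by (induction rule: form.induct) (auto intro: polynomial_functions.intros)

lemma PF_mono: "f \<in> polynomial_functions G \<Longrightarrow> G \<subseteq> H \<Longrightarrow> f \<in> polynomial_functions H"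
  by (induction rule: polynomial_functions.induct) (auto intro: polynomial_functions.intros)

lemma form_homogeneous:
  assumes "form d m f" shows "f \<in> homogeneous_functions"
proof -
  have "f \<in> polynomial_functions (insert snd (range (\<lambda>i v. coeff (fst v) i)))"
    by (rule PF_mono[OF form_PF[OF assms]]) (auto simp: gens_def)
  moreover have "\<forall>c S \<nu>. f (smult c S, c * \<nu>) = c ^ m * f (S, \<nu>)"
    using form_scale[OF assms, of _ "(_, _)"] by (simp add: scale_def)
  ultimately show ?thesis
    unfolding homogeneous_functions_def by blast
qed

lemma form_smult: "form d m f \<Longrightarrow> form d m (\<lambda>v. c * f v)"
  using form.mult[OF form.const[of d c]] by fastforce

lemma form_sum: "(\<And>i. i \<in> I \<Longrightarrow> form d m (f i)) \<Longrightarrow> form d m (\<lambda>v. \<Sum>i\<in>I. f i v)"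
  by (induction I rule: infinite_finite_induct) (auto intro: form.zero form.add)

lemma form_power: "form d m f \<Longrightarrow> form d (k * m) (\<lambda>v. f v ^ k)"
  by (induction k) (auto intro: form.const form.mult)

lemma form_prod:
  "(\<And>i. i \<in> I \<Longrightarrow> form d (m i) (f i)) \<Longrightarrow> form d (\<Sum>i\<in>I. m i) (\<lambda>v. \<Prod>i\<in>I. f i v)"
  by (induction I rule: infinite_finite_induct) (auto intro: form.const form.mult)

lemma PF_sum:
  "(\<And>i. i \<in> I \<Longrightarrow> f i \<in> polynomial_functions G) \<Longrightarrow> (\<lambda>v. \<Sum>i\<in>I. f i v) \<in> polynomial_functions G"
  by (induction I rule: infinite_finite_induct) (auto intro: polynomial_functions.intros)

text \<open>Turns limits and derivatives at a point at infinity into statements about one polynomial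
  in \<open>t\<close>, settled by counting roots or comparing coefficients.\<close>

lemma PF_line:
  assumes "f \<in> PF d"
  shows "\<exists>h. \<forall>t. f (fst v + smult t (fst w), snd v + t * snd w) = poly h t"
  using assms
proof (induction rule: polynomial_functions.induct)
  case (coordinate g)
  then consider "g = snd" | i where "g = (\<lambda>v. coeff (fst v) i)"
    by (auto simp: gens_def)
  then show ?case
  proof cases
    case 1
    then show ?thesis by (intro exI[of _ "[:snd v, snd w:]"]) simp
  next
    case 2
    then show ?thesis by (intro exI[of _ "[:coeff (fst v) i, coeff (fst w) i:]"]) simp
  qed
next
  case (const c)
  show ?case by (intro exI[of _ "[:c:]"]) simp
next
  case (add f g)
  then obtain h k where "\<forall>t. f (fst v + smult t (fst w), snd v + t * snd w) = poly h t"
    "\<forall>t. g (fst v + smult t (fst w), snd v + t * snd w) = poly k t" by auto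
  then show ?case by (intro exI[of _ "h + k"]) simp
next
  case (mult f g)
  then obtain h k where "\<forall>t. f (fst v + smult t (fst w), snd v + t * snd w) = poly h t"
    "\<forall>t. g (fst v + smult t (fst w), snd v + t * snd w) = poly k t" by auto
  then show ?case by (intro exI[of _ "h * k"]) simp
qed

lemma cut_id: "degree (fst v) \<le> d \<Longrightarrow> cut d v = v"
  by (auto simp: cut_def prod_eq_iff poly_eq_iff coeff_poly_cutoff coeff_eq_0)

lemma PF_cut:
  assumes "f \<in> polynomial_functions (insert snd (range (\<lambda>i v. coeff (fst v) i)))"
  shows "(\<lambda>v. f (cut d v)) \<in> PF d"
  using assms
proof (induction rule: polynomial_functions.induct)
  case (coordinate g)
  then consider "g = snd" | i where "g = (\<lambda>v. coeff (fst v) i)"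
    by auto
  then show ?case
  proof cases
    case 1
    then show ?thesis
      using polynomial_functions.coordinate[of snd "gens d"] by (simp add: cut_def)
  next
    case 2
    show ?thesis
    proof (cases "i \<le> d")
      case True
      then have "(\<lambda>v. g (cut d v)) = (\<lambda>v. coeff (fst v) i)"
        by (simp add: 2 cut_def coeff_poly_cutoff fun_eq_iff)
      then show ?thesis
        using coeff_in_gens[OF True] by (simp add: polynomial_functions.coordinate)
    next
      case False
      then have "(\<lambda>v. g (cut d v)) = (\<lambda>v. 0)"
        by (simp add: 2 cut_def coeff_poly_cutoff fun_eq_iff)
      then show ?thesis
        by (simp add: polynomial_functions.const)
    qed
  qed
qed (auto intro: polynomial_functions.intros)

text \<open>Multiplying by a power of \<open>x\<close> turns the values of \<open>f\<close> in the chart \<open>x = 1\<close> into a form.\<close>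

lemma PF_homogenize:
  assumes "f \<in> PF d" and x: "x \<in> gens d"
  shows "\<exists>N0. \<forall>N\<ge>N0. \<exists>g. form d N g \<and> (\<forall>v. x v \<noteq> 0 \<longrightarrow> g v = x v ^ N * f (scale (1 / x v) v))"
  using assms(1)
proof (induction rule: polynomial_functions.induct)
  case (coordinate g)
  have "\<exists>h. form d N h \<and> (\<forall>v. x v \<noteq> 0 \<longrightarrow> h v = x v ^ N * g (scale (1 / x v) v))" if "N \<ge> 1" for N
  proof (intro exI conjI allI impI)
    have "form d ((N - 1) * 1 + 1) (\<lambda>v. x v ^ (N - 1) * g v)"
      by (intro form.mult form_power form.gen x coordinate)
    then show "form d N (\<lambda>v. x v ^ (N - 1) * g v)" using that by simp
    fix v assume "x v \<noteq> 0"
    moreover have "x v ^ N = x v ^ (N - 1) * x v"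
      using that by (metis power_minus_mult zero_less_one less_le_trans)
    ultimately show "x v ^ (N - 1) * g v = x v ^ N * g (scale (1 / x v) v)"
      by (simp add: gens_scale[OF coordinate])
  qed
  then show ?case by blast
next
  case (const c)
  have "form d N (\<lambda>v. c * x v ^ N)" for N
    using form_smult[OF form_power[OF form.gen[OF x], of N]] by simp
  then show ?case
    by (intro exI[of _ 0] allI impI) (rule exI[of _ "\<lambda>v. c * x v ^ _"], auto)
next
  case (add f g)
  then obtain M N where
    M: "\<forall>n\<ge>M. \<exists>h. form d n h \<and> (\<forall>v. x v \<noteq> 0 \<longrightarrow> h v = x v ^ n * f (scale (1 / x v) v))" and
    N: "\<forall>n\<ge>N. \<exists>h. form d n h \<and> (\<forall>v. x v \<noteq> 0 \<longrightarrow> h v = x v ^ n * g (scale (1 / x v) v))"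
    by blast
  show ?case
  proof (intro exI[of _ "max M N"] allI impI)
    fix n assume "n \<ge> max M N"
    then have "n \<ge> M" "n \<ge> N" by simp_all
    from M[rule_format, OF this(1)] N[rule_format, OF this(2)]
    obtain h k where "form d n h" "form d n k"
      "\<forall>v. x v \<noteq> 0 \<longrightarrow> h v = x v ^ n * f (scale (1 / x v) v)"
      "\<forall>v. x v \<noteq> 0 \<longrightarrow> k v = x v ^ n * g (scale (1 / x v) v)" by blast
    then show "\<exists>h. form d n h \<and>
        (\<forall>v. x v \<noteq> 0 \<longrightarrow> h v = x v ^ n * (f (scale (1 / x v) v) + g (scale (1 / x v) v)))"
      by (intro exI[of _ "\<lambda>v. h v + k v"]) (auto intro: form.add simp: algebra_simps)
  qed
next
  case (mult f g)
  then obtain M N where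
    M: "\<forall>n\<ge>M. \<exists>h. form d n h \<and> (\<forall>v. x v \<noteq> 0 \<longrightarrow> h v = x v ^ n * f (scale (1 / x v) v))" and
    N: "\<forall>n\<ge>N. \<exists>h. form d n h \<and> (\<forall>v. x v \<noteq> 0 \<longrightarrow> h v = x v ^ n * g (scale (1 / x v) v))"
    by blast
  show ?case
  proof (intro exI[of _ "M + N"] allI impI)
    fix n assume n: "n \<ge> M + N"
    then have "n - M \<ge> N" by simp
    from M[rule_format, OF order_refl] N[rule_format, OF this] obtain h k where hk: "form d M h" "form d (n - M) k"
      "\<forall>v. x v \<noteq> 0 \<longrightarrow> h v = x v ^ M * f (scale (1 / x v) v)"
      "\<forall>v. x v \<noteq> 0 \<longrightarrow> k v = x v ^ (n - M) * g (scale (1 / x v) v)" by blast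
    have "form d n (\<lambda>v. h v * k v)"
      using form.mult[OF hk(1,2)] n by simp
    moreover have "x v ^ n = x v ^ M * x v ^ (n - M)" for v
      using n by (simp flip: power_add)
    ultimately show "\<exists>h. form d n h \<and>
        (\<forall>v. x v \<noteq> 0 \<longrightarrow> h v = x v ^ n * (f (scale (1 / x v) v) * g (scale (1 / x v) v)))"
      using hk(3,4) by (intro exI[of _ "\<lambda>v. h v * k v"]) (auto simp: algebra_simps)
  qed
qed

section \<open>Linear dependence of functions\<close>

text \<open>Meant for finite \<open>T\<close>, each function serving as its own index; over an
  infinite \<open>T\<close> the sum is 0 by convention.\<close>

definition lspan :: "('v \<Rightarrow> complex) set \<Rightarrow> ('v \<Rightarrow> complex) set" where
  "lspan T = {f. \<exists>c. f = (\<lambda>v. \<Sum>t\<in>T. c t * t v)}"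

lemma lspan_zero: "(\<lambda>_. 0) \<in> lspan T"
  unfolding lspan_def by (auto intro!: exI[of _ "\<lambda>_. 0"])

lemma lspan_add: "f \<in> lspan T \<Longrightarrow> g \<in> lspan T \<Longrightarrow> (\<lambda>v. f v + g v) \<in> lspan T"
  unfolding lspan_def
proof (clarify, goal_cases)
  case (1 c e)
  show ?case
    by (rule exI[of _ "\<lambda>t. c t + e t"]) (simp add: algebra_simps sum.distrib)
qed

lemma lspan_smult: "f \<in> lspan T \<Longrightarrow> (\<lambda>v. k * f v) \<in> lspan T"
  unfolding lspan_def
proof (clarify, goal_cases)
  case (1 c)
  show ?case
    by (rule exI[of _ "\<lambda>t. k * c t"]) (simp add: algebra_simps sum_distrib_left)
qed

lemma lspan_sum: "(\<And>i. i \<in> I \<Longrightarrow> f i \<in> lspan T) \<Longrightarrow> (\<lambda>v. \<Sum>i\<in>I. f i v) \<in> lspan T"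
  by (induction I rule: infinite_finite_induct) (auto intro: lspan_zero lspan_add)

lemma lspan_base: "finite T \<Longrightarrow> t \<in> T \<Longrightarrow> t \<in> lspan T"
  unfolding lspan_def
  by (auto intro!: exI[of _ "\<lambda>s. if s = t then 1 else 0"] simp: if_distrib[of "\<lambda>c. c * _"] cong: if_cong)

lemma lspan_induct [consumes 1, case_names zero add smult base]:
  assumes "f \<in> lspan T" "Q (\<lambda>_. 0)"
    and "\<And>f g. Q f \<Longrightarrow> Q g \<Longrightarrow> Q (\<lambda>v. f v + g v)"
    and "\<And>c f. Q f \<Longrightarrow> Q (\<lambda>v. c * f v)" and "\<And>t. t \<in> T \<Longrightarrow> Q t"
  shows "Q f"
proof -
  obtain c where f: "f = (\<lambda>v. \<Sum>t\<in>T. c t * t v)"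
    using assms(1) unfolding lspan_def by blast
  have "Q (\<lambda>v. \<Sum>t\<in>S. c t * t v)" if "S \<subseteq> T" for S
    using that
  proof (induction S rule: infinite_finite_induct)
    case (insert t S)
    then show ?case using assms(3)[OF assms(4)[OF assms(5)[of t], of "c t"] insert.IH] by auto
  qed (use assms(2) in auto)
  then show ?thesis using f by blast
qed

lemma lspan_subset:
  assumes "f \<in> lspan T" "\<And>t. t \<in> T \<Longrightarrow> t \<in> lspan T'" shows "f \<in> lspan T'"
  using assms(1) by (induction rule: lspan_induct) (auto intro: lspan_zero lspan_add lspan_smult assms(2))

lemma lspan_mult:
  assumes "f \<in> lspan S" "g \<in> lspan T"
    and "\<And>s t. s \<in> S \<Longrightarrow> t \<in> T \<Longrightarrow> (\<lambda>v. s v * t v) \<in> lspan U"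
  shows "(\<lambda>v. f v * g v) \<in> lspan U"
proof -
  have right: "(\<lambda>v. s v * g v) \<in> lspan U" if s: "s \<in> S" for s
    using assms(2)
  proof (induction rule: lspan_induct)
    case (add g h)
    then show ?case using lspan_add[OF add] by (simp add: algebra_simps)
  next
    case (smult c g)
    then show ?case using lspan_smult[OF smult, of c] by (simp add: algebra_simps)
  qed (auto intro: lspan_zero assms(3) s)
  from assms(1) show ?thesis
  proof (induction rule: lspan_induct)
    case (add f h)
    then show ?case using lspan_add[OF add] by (simp add: algebra_simps)
  next
    case (smult c f)
    then show ?case using lspan_smult[OF smult, of c] by (simp add: algebra_simps)
  qed (auto intro: lspan_zero right)
qed

text \<open>Elimination, one equation \<open>t\<close> at a time: if some unknown \<open>p\<close>
  has a nonzero coefficient in it, the equation is solved for \<open>p\<close> and both disappear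
  from the system.\<close>

lemma underdetermined_system:
  fixes c :: "'s \<Rightarrow> 't \<Rightarrow> complex"
  assumes "finite T" "finite S" "card T < card S"
  shows "\<exists>a. (\<exists>s\<in>S. a s \<noteq> 0) \<and> (\<forall>t\<in>T. (\<Sum>s\<in>S. a s * c s t) = 0)"
  using assms
proof (induction T arbitrary: S c rule: finite_induct)
  case empty
  then have "S \<noteq> {}" by auto
  then show ?case by (intro exI[of _ "\<lambda>_. 1"]) auto
next
  case (insert t T)
  show ?case
  proof (cases "\<forall>s\<in>S. c s t = 0")
    case True
    have "card T < card S" using insert by simp
    from insert.IH[OF insert.prems(1) this, of c] obtain a
      where a: "\<exists>s\<in>S. a s \<noteq> 0" "\<forall>t\<in>T. (\<Sum>s\<in>S. a s * c s t) = 0" by blast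
    have "(\<Sum>s\<in>S. a s * c s t) = 0" using True by simp
    with a show ?thesis by blast
  next
    case False
    then obtain p where p: "p \<in> S" "c p t \<noteq> 0" by blast
    define c' where "c' s u = c s u - c s t / c p t * c p u" for s u
    have "card T < card (S - {p})" using insert p by simp
    from insert.IH[OF finite_Diff[OF insert.prems(1)] this, of c'] obtain a where
      a: "\<exists>s\<in>S - {p}. a s \<noteq> 0" "\<forall>u\<in>T. (\<Sum>s\<in>S - {p}. a s * c' s u) = 0" by blast
    \<comment> \<open>The value at \<open>p\<close> is the one forced by the equation
      \<open>t\<close>; the other values solve the reduced system.\<close>
    define b where "b s = (if s = p then - (\<Sum>s\<in>S - {p}. a s * c s t) / c p t else a s)" for s
    have sum: "(\<Sum>s\<in>S. b s * c s u) = (\<Sum>s\<in>S - {p}. a s * c' s u)" for u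
    proof -
      have "(\<Sum>s\<in>S. b s * c s u) = b p * c p u + (\<Sum>s\<in>S - {p}. b s * c s u)"
        using p(1) insert.prems(1) by (rule sum.remove[rotated])
      also have "(\<Sum>s\<in>S - {p}. b s * c s u) = (\<Sum>s\<in>S - {p}. a s * c s u)"
        by (rule sum.cong) (auto simp: b_def)
      also have "b p * c p u = - (\<Sum>s\<in>S - {p}. a s * (c s t / c p t * c p u))"
        using p(2) by (simp add: b_def sum_distrib_left sum_distrib_right sum_divide_distrib mult_ac)
      finally show ?thesis
        by (simp add: c'_def algebra_simps sum_subtractf)
    qed
    have "(\<Sum>s\<in>S. b s * c s u) = 0" if "u \<in> insert t T" for u
    proof (cases "u = t")
      case True
      have "c' s t = 0" for s using p by (simp add: c'_def)
      then show ?thesis unfolding sum True by simp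
    next
      case False
      then show ?thesis using a(2) that unfolding sum by simp
    qed
    moreover have "\<exists>s\<in>S. b s \<noteq> 0" using a(1) by (auto simp: b_def)
    ultimately show ?thesis by blast
  qed
qed

text \<open>Serves twice: for the inverses in the Nullstellensatz, with \<open>A = UNIV\<close>, and
  for the monomials in the functions of a chain. The family is indexed, so repeated members count as
  dependent, and agreement with the span is asked on \<open>A\<close> only.\<close>

lemma family_dependent:
  assumes "finite T" "finite S" "card T < card S"
    and "\<And>s. s \<in> S \<Longrightarrow> \<exists>h\<in>lspan T. \<forall>v\<in>A. g s v = h v"
  shows "\<exists>a. (\<exists>s\<in>S. a s \<noteq> 0) \<and> (\<forall>v\<in>A. (\<Sum>s\<in>S. a s * g s v) = 0)"
proof -
  have "\<forall>s\<in>S. \<exists>c. \<forall>v\<in>A. g s v = (\<Sum>t\<in>T. c t * t v)"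
    using assms(4) unfolding lspan_def by fastforce
  then obtain c where c: "\<forall>s\<in>S. \<forall>v\<in>A. g s v = (\<Sum>t\<in>T. c s t * t v)"
    by metis
  obtain a where a: "\<exists>s\<in>S. a s \<noteq> 0" "\<forall>t\<in>T. (\<Sum>s\<in>S. a s * c s t) = 0"
    using underdetermined_system[OF assms(1-3)] by blast
  have "(\<Sum>s\<in>S. a s * g s v) = 0" if "v \<in> A" for v
  proof -
    have "(\<Sum>s\<in>S. a s * g s v) = (\<Sum>s\<in>S. \<Sum>t\<in>T. a s * c s t * t v)"
      using c that by (intro sum.cong) (auto simp: sum_distrib_left mult.assoc)
    also have "\<dots> = (\<Sum>t\<in>T. (\<Sum>s\<in>S. a s * c s t) * t v)"
      by (subst sum.swap) (simp add: sum_distrib_right)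
    also have "\<dots> = 0" using a(2) by simp
    finally show ?thesis .
  qed
  with a(1) show ?thesis by blast
qed

definition monomials :: "('v \<Rightarrow> complex) set \<Rightarrow> nat \<Rightarrow> ('v \<Rightarrow> complex) set" where
  "monomials G m = (\<lambda>e v. \<Prod>x\<in>G. x v ^ e x) ` {e \<in> G \<rightarrow>\<^sub>E {..m}. sum e G = m}"

lemma finite_monomials [simp]: "finite G \<Longrightarrow> finite (monomials G m)"
  unfolding monomials_def by (intro finite_imageI finite_subset[OF _ finite_PiE[of G "\<lambda>_. {..m}"]]) auto

lemma monomialsI:
  assumes "finite G" shows "(\<lambda>v. \<Prod>x\<in>G. x v ^ e x) \<in> monomials G (sum e G)"
proof -
  have "(\<lambda>v. \<Prod>x\<in>G. x v ^ e x) = (\<lambda>v. \<Prod>x\<in>G. x v ^ restrict e G x)"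
    by (intro ext prod.cong) auto
  moreover have "restrict e G \<in> {e' \<in> G \<rightarrow>\<^sub>E {..sum e G}. sum e' G = sum e G}"
    using assms by (auto intro: member_le_sum)
  ultimately show ?thesis unfolding monomials_def by (rule image_eqI[where x = "restrict e G"])
qed

lemma form_monomials:
  assumes "form d m f" shows "f \<in> lspan (monomials (gens d) m)"
  using assms
proof (induction rule: form.induct)
  case (const c)
  have "(\<lambda>v. 1) \<in> monomials (gens d) 0"
    using monomialsI[OF finite_gens[of d], of "\<lambda>_. 0"] by simp
  from lspan_smult[OF lspan_base[OF finite_monomials[OF finite_gens] this], of c] show ?case by simp
next
  case (gen g)
  have "(\<lambda>v. \<Prod>x\<in>gens d. x v ^ (if x = g then 1 else 0)) = g"
    using gen by (simp add: if_distrib[of "\<lambda>e. _ ^ e"] cong: if_cong)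
  then have "g \<in> monomials (gens d) 1"
    using monomialsI[OF finite_gens[of d], of "\<lambda>x. if x = g then 1 else 0"] gen by simp
  then show ?case by (rule lspan_base[OF finite_monomials[OF finite_gens]])
next
  case (mult m f n g)
  show ?case
  proof (rule lspan_mult[OF mult.IH], rule lspan_base)
    fix s t assume st: "s \<in> monomials (gens d) m" "t \<in> monomials (gens d) n"
    obtain e where e: "s = (\<lambda>v. \<Prod>x\<in>gens d. x v ^ e x)" "sum e (gens d) = m"
      using st(1) unfolding monomials_def by auto
    obtain e' where e': "t = (\<lambda>v. \<Prod>x\<in>gens d. x v ^ e' x)" "sum e' (gens d) = n"
      using st(2) unfolding monomials_def by auto
    show "(\<lambda>v. s v * t v) \<in> monomials (gens d) (m + n)"
      using monomialsI[OF finite_gens[of d], of "\<lambda>x. e x + e' x"]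
      by (simp add: e(1) e'(1) power_add prod.distrib sum.distrib e(2) e'(2))
  qed simp
qed (auto intro: lspan_zero lspan_add)

section \<open>The Hilbert basis theorem\<close>

definition ideal_of :: "('v \<Rightarrow> complex) set \<Rightarrow> ('v \<Rightarrow> complex) set \<Rightarrow> bool" where
  "ideal_of R I \<longleftrightarrow> I \<subseteq> R \<and> (\<lambda>_. 0) \<in> I \<and> (\<forall>f\<in>I. \<forall>g\<in>I. (\<lambda>v. f v + g v) \<in> I) \<and>
     (\<forall>r\<in>R. \<forall>f\<in>I. (\<lambda>v. r v * f v) \<in> I)"

definition noetherian :: "('v \<Rightarrow> complex) set \<Rightarrow> bool" where
  "noetherian R \<longleftrightarrow> (\<forall>I :: nat \<Rightarrow> ('v \<Rightarrow> complex) set.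
     (\<forall>n. ideal_of R (I n)) \<and> (\<forall>n. I n \<subseteq> I (Suc n)) \<longrightarrow> (\<exists>N. \<forall>n\<ge>N. I n = I N))"

lemma ideal_ofD:
  assumes "ideal_of R I"
  shows "I \<subseteq> R" "(\<lambda>_. 0) \<in> I" "f \<in> I \<Longrightarrow> g \<in> I \<Longrightarrow> (\<lambda>v. f v + g v) \<in> I"
    "r \<in> R \<Longrightarrow> f \<in> I \<Longrightarrow> (\<lambda>v. r v * f v) \<in> I"
  using assms unfolding ideal_of_def by auto

lemma ideal_of_sum:
  "ideal_of R I \<Longrightarrow> (\<And>j. j \<in> J \<Longrightarrow> f j \<in> I) \<Longrightarrow> (\<lambda>v. \<Sum>j\<in>J. f j v) \<in> I"
  by (induction J rule: infinite_finite_induct) (auto intro: ideal_ofD)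

lemma ideal_of_smult:
  assumes "ideal_of (polynomial_functions G) I" "f \<in> I" shows "(\<lambda>v. c * f v) \<in> I"
  by (rule ideal_ofD(4)[OF assms(1) polynomial_functions.const assms(2)])

lemma ideal_of_diff:
  assumes I: "ideal_of (polynomial_functions G) I" "f \<in> I" "g \<in> I"
  shows "(\<lambda>v. f v - g v) \<in> I"
  using ideal_ofD(3)[OF I(1,2) ideal_of_smult[OF I(1,3), of "-1"]] by simp

text \<open>The functions in \<open>G\<close> and \<open>x\<close> may satisfy relations, so a
  degree in \<open>x\<close> is not well defined. What is recorded is that some expression in powers
  of \<open>x\<close> below the \<open>n\<close>-th exists.\<close>

definition low_degree ::
  "('v \<Rightarrow> complex) set \<Rightarrow> ('v \<Rightarrow> complex) \<Rightarrow> nat \<Rightarrow> ('v \<Rightarrow> complex) set" where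
  "low_degree G x n = {f. \<exists>r. (\<forall>i. r i \<in> polynomial_functions G) \<and> f = (\<lambda>v. \<Sum>i<n. r i v * x v ^ i)}"

context
  fixes G :: "('v \<Rightarrow> complex) set" and x :: "'v \<Rightarrow> complex"
begin

private lemma low_zero: "(\<lambda>_. 0) \<in> low_degree G x n"
  unfolding low_degree_def
  by (auto intro!: exI[of _ "\<lambda>_ _. 0"] polynomial_functions.const)

private lemma low_add:
  assumes "f \<in> low_degree G x n" "g \<in> low_degree G x n" shows "(\<lambda>v. f v + g v) \<in> low_degree G x n"
proof -
  obtain r s where "\<forall>i. r i \<in> polynomial_functions G" "f = (\<lambda>v. \<Sum>i<n. r i v * x v ^ i)"
    "\<forall>i. s i \<in> polynomial_functions G" "g = (\<lambda>v. \<Sum>i<n. s i v * x v ^ i)"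
    using assms unfolding low_degree_def by blast
  then show ?thesis
    unfolding low_degree_def
    by (intro CollectI exI[of _ "\<lambda>i v. r i v + s i v"])
      (auto intro: polynomial_functions.add simp: sum.distrib algebra_simps)
qed

private lemma low_scale:
  assumes "f \<in> low_degree G x n" "q \<in> polynomial_functions G" shows "(\<lambda>v. q v * f v) \<in> low_degree G x n"
proof -
  obtain r where "\<forall>i. r i \<in> polynomial_functions G" "f = (\<lambda>v. \<Sum>i<n. r i v * x v ^ i)"
    using assms unfolding low_degree_def by blast
  then show ?thesis
    using assms(2) unfolding low_degree_def
    by (intro CollectI exI[of _ "\<lambda>i v. q v * r i v"])
      (auto intro: polynomial_functions.mult simp: sum_distrib_left algebra_simps)
qed

private lemma low_shift:
  assumes "f \<in> low_degree G x n" shows "(\<lambda>v. x v * f v) \<in> low_degree G x (Suc n)"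
proof -
  obtain r where r: "\<forall>i. r i \<in> polynomial_functions G" "f = (\<lambda>v. \<Sum>i<n. r i v * x v ^ i)"
    using assms unfolding low_degree_def by blast
  have "(\<lambda>v. x v * f v) = (\<lambda>v. \<Sum>i<Suc n. (case i of 0 \<Rightarrow> \<lambda>_. 0 | Suc j \<Rightarrow> r j) v * x v ^ i)"
    unfolding r(2) sum.lessThan_Suc_shift by (simp add: sum_distrib_left algebra_simps)
  moreover have "\<forall>i. (case i of 0 \<Rightarrow> \<lambda>_. 0 | Suc j \<Rightarrow> r j) \<in> polynomial_functions G"
    using r(1) by (auto split: nat.split intro: polynomial_functions.const)
  ultimately show ?thesis
    unfolding low_degree_def by blast
qed

private lemma low_Suc:
  "f \<in> low_degree G x (Suc n) \<longleftrightarrow> (\<exists>r\<in>(polynomial_functions G). \<exists>g\<in>low_degree G x n. f = (\<lambda>v. r v * x v ^ n + g v))"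
proof
  assume "f \<in> low_degree G x (Suc n)"
  then obtain r where "\<forall>i. r i \<in> polynomial_functions G" "f = (\<lambda>v. \<Sum>i<Suc n. r i v * x v ^ i)"
    unfolding low_degree_def by blast
  then show "\<exists>r\<in>(polynomial_functions G). \<exists>g\<in>low_degree G x n. f = (\<lambda>v. r v * x v ^ n + g v)"
    by (intro bexI[of _ "r n"] bexI[of _ "\<lambda>v. \<Sum>i<n. r i v * x v ^ i"])
      (auto simp: low_degree_def)
next
  assume "\<exists>r\<in>(polynomial_functions G). \<exists>g\<in>low_degree G x n. f = (\<lambda>v. r v * x v ^ n + g v)"
  then obtain r s where "r \<in> polynomial_functions G" "\<forall>i. s i \<in> polynomial_functions G"
    "f = (\<lambda>v. r v * x v ^ n + (\<Sum>i<n. s i v * x v ^ i))"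
    unfolding low_degree_def by blast
  then show "f \<in> low_degree G x (Suc n)"
    unfolding low_degree_def
    by (intro CollectI exI[of _ "\<lambda>i. if i = n then r else s i"]) auto
qed

private lemma low_mono: "m \<le> n \<Longrightarrow> low_degree G x m \<subseteq> low_degree G x n"
proof (induction n rule: dec_induct)
  case (step n)
  have "f \<in> low_degree G x (Suc n)" if "f \<in> low_degree G x n" for f
    unfolding low_Suc
    by (rule bexI[of _ "\<lambda>_. 0"], rule bexI[of _ f])
      (use that in \<open>auto intro: polynomial_functions.const\<close>)
  then show ?case using step.IH by blast
qed simp

private lemma low_const: "(\<lambda>_. c) \<in> low_degree G x 1"
proof -
  have "\<exists>r\<in>polynomial_functions G. \<exists>g\<in>low_degree G x 0. (\<lambda>_. c) = (\<lambda>v. r v * x v ^ 0 + g v)"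
    using low_zero[of 0] by (intro bexI[of _ "\<lambda>_. c"] bexI[of _ "\<lambda>_. 0"]) (auto intro: polynomial_functions.const)
  then show ?thesis using low_Suc[of "\<lambda>_. c" 0] by simp
qed

private lemma low_exhaust: "f \<in> polynomial_functions (insert x G) \<Longrightarrow> \<exists>n. f \<in> low_degree G x n"
proof (induction rule: polynomial_functions.induct)
  case (coordinate g)
  show ?case
  proof (cases "g = x")
    case True
    then show ?thesis using low_shift[OF low_const[of 1]] by auto
  next
    case False
    then show ?thesis
      using low_scale[OF low_const[of 1], of g] coordinate
      by (auto intro: polynomial_functions.coordinate)
  qed
next
  case (add f g)
  then obtain m n where "f \<in> low_degree G x m" "g \<in> low_degree G x n" by blast
  then have "f \<in> low_degree G x (max m n)" "g \<in> low_degree G x (max m n)"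
    using low_mono max.cobounded1 max.cobounded2 by blast+
  then show ?case using low_add by blast
next
  case (mult f g)
  then obtain m n where f: "f \<in> low_degree G x m" and g: "g \<in> low_degree G x n" by blast
  from f have "\<exists>k. (\<lambda>v. f v * g v) \<in> low_degree G x k"
  proof (induction m arbitrary: f)
    case 0
    then show ?case using low_zero by (auto simp: low_degree_def)
  next
    case (Suc m)
    then obtain r h where rh: "r \<in> polynomial_functions G" "h \<in> low_degree G x m" "f = (\<lambda>v. r v * x v ^ m + h v)"
      unfolding low_Suc by blast
    obtain k where k: "(\<lambda>v. h v * g v) \<in> low_degree G x k" using Suc.IH[OF rh(2)] by blast
    have pow: "(\<lambda>v. x v ^ i * g v) \<in> low_degree G x (i + n)" for i
      by (induction i) (use g in \<open>auto dest!: low_shift simp: mult.assoc\<close>)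
    have "(\<lambda>v. r v * (x v ^ m * g v)) \<in> low_degree G x (m + n)"
      by (rule low_scale[OF pow rh(1)])
    then have "(\<lambda>v. r v * (x v ^ m * g v)) \<in> low_degree G x (max k (m + n))"
      "(\<lambda>v. h v * g v) \<in> low_degree G x (max k (m + n))"
      using low_mono k max.cobounded1 max.cobounded2 by blast+
    from low_add[OF this] show ?case
      unfolding rh(3) by (auto simp: algebra_simps)
  qed
  then show ?case .
qed (use low_const in blast)

text \<open>Hilbert's argument: ideals are compared through the ideals of their leading
  coefficients. Once these agree, a member of the larger ideal is reduced, degree by degree, by
  members of the smaller one.\<close>

lemma noetherian_insert:
  assumes "noetherian (polynomial_functions G)"
  shows "noetherian (polynomial_functions (insert x G))"
  unfolding noetherian_def
proof (intro allI impI, elim conjE)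
  let ?S = "polynomial_functions (insert x G)"
  fix I :: "nat \<Rightarrow> ('v \<Rightarrow> complex) set"
  assume id: "\<forall>n. ideal_of ?S (I n)" and inc: "\<forall>n. I n \<subseteq> I (Suc n)"
  have mono: "I m \<subseteq> I n" if "m \<le> n" for m n
    using lift_Suc_mono_le[of I, OF inc[rule_format] that] .
  have RS: "polynomial_functions G \<subseteq> ?S" by (auto intro: PF_mono)
  have xS: "x \<in> ?S" by (auto intro: polynomial_functions.coordinate)
  \<comment> \<open>\<open>L i n\<close> collects every coefficient of \<open>x^i\<close> exhibited
    by some expression, with a rest of lower degree, of a member of \<open>I n\<close>. It grows in
    \<open>i\<close>, by multiplication with \<open>x\<close>, and in \<open>n\<close>.\<close>
  define L where "L i n = {r \<in> polynomial_functions G. \<exists>g\<in>low_degree G x i. (\<lambda>v. r v * x v ^ i + g v) \<in> I n}" for i n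
  have L_ideal: "ideal_of (polynomial_functions G) (L i n)" for i n
    unfolding ideal_of_def
  proof (intro conjI ballI)
    show "L i n \<subseteq> polynomial_functions G" by (auto simp: L_def)
    show "(\<lambda>_. 0) \<in> L i n"
      using ideal_ofD(2)[OF id[rule_format, of n]]
      by (auto simp: L_def intro!: bexI[of _ "\<lambda>_. 0"] low_zero polynomial_functions.const)
  next
    fix r s assume "r \<in> L i n" "s \<in> L i n"
    then obtain g h where "r \<in> polynomial_functions G" "s \<in> polynomial_functions G" "g \<in> low_degree G x i" "h \<in> low_degree G x i"
      "(\<lambda>v. r v * x v ^ i + g v) \<in> I n" "(\<lambda>v. s v * x v ^ i + h v) \<in> I n"
      unfolding L_def by blast
    then show "(\<lambda>v. r v + s v) \<in> L i n"
      using ideal_ofD(3)[OF id[rule_format, of n], of "\<lambda>v. r v * x v ^ i + g v" "\<lambda>v. s v * x v ^ i + h v"]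
      unfolding L_def
      by (intro CollectI conjI polynomial_functions.add bexI[OF _ low_add[of g i h]])
        (auto simp: algebra_simps)
  next
    fix q r assume "q \<in> polynomial_functions G" "r \<in> L i n"
    moreover from this obtain g where "r \<in> polynomial_functions G" "g \<in> low_degree G x i" "(\<lambda>v. r v * x v ^ i + g v) \<in> I n"
      unfolding L_def by blast
    ultimately show "(\<lambda>v. q v * r v) \<in> L i n"
      using ideal_ofD(4)[OF id[rule_format, of n], of q "\<lambda>v. r v * x v ^ i + g v"] RS
      unfolding L_def
      by (intro CollectI conjI polynomial_functions.mult bexI[OF _ low_scale[of g i q]])
        (auto simp: algebra_simps)
  qed
  have L_right: "L i m \<subseteq> L i n" if "m \<le> n" for i m n
    using mono[OF that] unfolding L_def by blast
  have "L i n \<subseteq> L (Suc i) n" for i n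
  proof
    fix r assume "r \<in> L i n"
    then obtain g where "r \<in> polynomial_functions G" "g \<in> low_degree G x i" "(\<lambda>v. r v * x v ^ i + g v) \<in> I n"
      unfolding L_def by blast
    then show "r \<in> L (Suc i) n"
      using ideal_ofD(4)[OF id[rule_format, of n] xS, of "\<lambda>v. r v * x v ^ i + g v"]
      unfolding L_def
      by (intro CollectI conjI bexI[OF _ low_shift[of g i]]) (auto simp: algebra_simps)
  qed
  then have L_left: "L i n \<subseteq> L j n" if "i \<le> j" for i j n
    using that lift_Suc_mono_le[of "\<lambda>i. L i n"] by blast
  have stab: "\<exists>N. \<forall>n\<ge>N. K n = K N"
    if "\<And>n. ideal_of (polynomial_functions G) (K n)" "\<And>n. K n \<subseteq> K (Suc n)" for K
    using assms that unfolding noetherian_def by blast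
  have "L n n \<subseteq> L (Suc n) (Suc n)" for n
    using L_left[of n "Suc n" n] L_right[of n "Suc n" "Suc n"] by simp
  with stab[of "\<lambda>n. L n n"] L_ideal obtain N0 where N0: "\<forall>n\<ge>N0. L n n = L N0 N0" by blast
  have "\<forall>i. \<exists>N. \<forall>n\<ge>N. L i n = L i N"
    using stab L_ideal L_right by (metis le_SucI order_refl)
  then obtain N where N: "\<And>i n. n \<ge> N i \<Longrightarrow> L i n = L i (N i)" by metis
  \<comment> \<open>Degrees above \<open>N0\<close> are settled together by the diagonal sequence
    \<open>L n n\<close>; the finitely many degrees up to \<open>N0\<close> stabilize
    separately.\<close>
  define M where "M = Max (insert N0 (N ` {..N0}))"
  have M: "N0 \<le> M" "\<And>i. i \<le> N0 \<Longrightarrow> N i \<le> M"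
    unfolding M_def by (rule Max_ge; simp)+
  have L_stab: "L i n = L i M" if n: "n \<ge> M" for i n
  proof (cases "i \<le> N0")
    case True
    then have "N i \<le> M" by (rule M)
    then show ?thesis using N[of i n] N[of i M] n by simp
  next
    case False
    have *: "L i k = L N0 N0" if "k \<ge> N0" for k
    proof
      have "L i k \<subseteq> L (max i k) (max i k)"
        using L_left[of i "max i k" k] L_right[of k "max i k" "max i k"] by simp
      also have "\<dots> = L N0 N0" by (rule N0[rule_format]) (use False in simp)
      finally show "L i k \<subseteq> L N0 N0" .
      show "L N0 N0 \<subseteq> L i k"
        using L_left[of N0 i k] L_right[of N0 k N0] False that by auto
    qed
    show ?thesis using *[of n] *[of M] n M(1) by simp
  qed
  have "f \<in> I M" if "n \<ge> M" "f \<in> low_degree G x i" "f \<in> I n" for f i n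
    using that(2,3)
  proof (induction i arbitrary: f)
    case 0
    then have "f = (\<lambda>_. 0)" by (auto simp: low_degree_def)
    then show ?case using ideal_ofD(2)[OF id[rule_format, of M]] by simp
  next
    case (Suc i)
    then obtain r g where rg: "r \<in> polynomial_functions G" "g \<in> low_degree G x i" "f = (\<lambda>v. r v * x v ^ i + g v)"
      unfolding low_Suc by blast
    then have "r \<in> L i n" using Suc.prems unfolding L_def by blast
    then have "r \<in> L i M" using L_stab[OF that(1)] by blast
    then obtain g' where g': "g' \<in> low_degree G x i" "(\<lambda>v. r v * x v ^ i + g' v) \<in> I M"
      unfolding L_def by blast
    then have "(\<lambda>v. r v * x v ^ i + g' v) \<in> I n" using mono[OF that(1)] by blast
    from ideal_of_diff[OF id[rule_format, of n] Suc.prems(2) this]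
    have "(\<lambda>v. g v + (-1) * g' v) \<in> I n" unfolding rg(3) by simp
    moreover have "(\<lambda>v. g v + (-1) * g' v) \<in> low_degree G x i"
      by (intro low_add rg low_scale g' polynomial_functions.const)
    ultimately have "(\<lambda>v. g v + (-1) * g' v) \<in> I M" using Suc.IH by blast
    from ideal_ofD(3)[OF id[rule_format, of M] this g'(2)]
    show ?case unfolding rg(3) by (simp add: algebra_simps)
  qed
  then have "I n = I M" if "n \<ge> M" for n
    using low_exhaust ideal_ofD(1)[OF id[rule_format, of n]] mono[OF that] that by blast
  then show "\<exists>N. \<forall>n\<ge>N. I n = I N" by blast
qed

end

lemma noetherian_polynomial_functions:
  fixes G :: "('v \<Rightarrow> complex) set"
  assumes "finite G" shows "noetherian (polynomial_functions G)"
  using assms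
proof (induction G rule: finite_induct)
  case empty
  have const: "\<exists>c. f = (\<lambda>_. c)" if "f \<in> polynomial_functions {}" for f :: "'v \<Rightarrow> complex"
    using that by (induction rule: polynomial_functions.induct) auto
  show ?case
    unfolding noetherian_def
  proof (intro allI impI, elim conjE)
    fix I :: "nat \<Rightarrow> ('v \<Rightarrow> complex) set"
    assume id: "\<forall>n. ideal_of (polynomial_functions {}) (I n)" and inc: "\<forall>n. I n \<subseteq> I (Suc n)"
    have mono: "I m \<subseteq> I n" if "m \<le> n" for m n
      using lift_Suc_mono_le[of I, OF inc[rule_format] that] .
    note D = ideal_ofD[OF id[rule_format]]
    show "\<exists>N. \<forall>n\<ge>N. I n = I N"
    proof (cases "\<exists>N c. c \<noteq> 0 \<and> (\<lambda>_. c) \<in> I N")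
      case True
      then obtain N c where c: "c \<noteq> 0" "(\<lambda>_. c) \<in> I N" by blast
      have "f \<in> I N" if f: "f \<in> I n" for f n
      proof -
        obtain e where "f = (\<lambda>_. e)" using const D(1)[of n] f by blast
        then show ?thesis
          using ideal_of_smult[OF id[rule_format, of N] c(2), of "e / c"] c(1) by simp
      qed
      then show ?thesis using mono by blast
    next
      case False
      have "I n = {\<lambda>_. 0}" for n
        using False const D(1)[of n] D(2)[of n] by blast
      then show ?thesis by simp
    qed
  qed
qed (rule noetherian_insert)

section \<open>The Nullstellensatz\<close>

lemma polynomial_functions_lspan:
  assumes G: "finite G" and "f \<in> polynomial_functions G"
  shows "\<exists>m. f \<in> lspan (\<Union>k\<le>m. monomials G k)"
  using assms(2)
proof (induction rule: polynomial_functions.induct)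
  case (coordinate g)
  have "(\<lambda>v. \<Prod>x\<in>G. x v ^ (if x = g then 1 else 0)) = g"
    using coordinate G by (simp add: if_distrib[of "\<lambda>e. _ ^ e"] cong: if_cong)
  then have "g \<in> monomials G 1"
    using monomialsI[OF G, of "\<lambda>x. if x = g then 1 else 0"] coordinate G by simp
  then show ?case
    using G by (intro exI[of _ 1] lspan_base) auto
next
  case (const c)
  have "(\<lambda>v. 1) \<in> lspan (\<Union>k\<le>0. monomials G k)"
    using monomialsI[OF G, of "\<lambda>_. 0"] G by (intro lspan_base) auto
  from lspan_smult[OF this, of c] show ?case by (intro exI[of _ 0]) simp
next
  case (add f g)
  then obtain m n where mn: "f \<in> lspan (\<Union>k\<le>m. monomials G k)" "g \<in> lspan (\<Union>k\<le>n. monomials G k)"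
    by blast
  have "f \<in> lspan (\<Union>k\<le>max m n. monomials G k)"
    by (rule lspan_subset[OF mn(1)]) (rule lspan_base, use G in force, force)
  moreover have "g \<in> lspan (\<Union>k\<le>max m n. monomials G k)"
    by (rule lspan_subset[OF mn(2)]) (rule lspan_base, use G in force, force)
  ultimately show ?case using lspan_add by blast
next
  case (mult f g)
  then obtain m n where mn: "f \<in> lspan (\<Union>k\<le>m. monomials G k)" "g \<in> lspan (\<Union>k\<le>n. monomials G k)"
    by blast
  have "(\<lambda>v. f v * g v) \<in> lspan (\<Union>k\<le>m + n. monomials G k)"
  proof (rule lspan_mult[OF mn], rule lspan_base)
    fix s t assume "s \<in> (\<Union>k\<le>m. monomials G k)" "t \<in> (\<Union>k\<le>n. monomials G k)"
    then obtain e e' where "s = (\<lambda>v. \<Prod>x\<in>G. x v ^ e x)" "sum e G \<le> m"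
      "t = (\<lambda>v. \<Prod>x\<in>G. x v ^ e' x)" "sum e' G \<le> n"
      unfolding monomials_def by auto
    then show "(\<lambda>v. s v * t v) \<in> (\<Union>k\<le>m + n. monomials G k)"
      using monomialsI[OF G, of "\<lambda>x. e x + e' x"]
      by (intro UN_I[of "sum e G + sum e' G"]) (auto simp: power_add prod.distrib sum.distrib)
  qed (use G in auto)
  then show ?case by blast
qed

text \<open>The last conclusion says that the quotient by \<open>M\<close> is a field: by
  maximality, adjoining \<open>f\<close> to \<open>M\<close> must produce 1.\<close>

lemma exists_maximal_ideal:
  assumes J: "ideal_of (polynomial_functions G) J" "(\<lambda>_. 1) \<notin> J"
  obtains M where "ideal_of (polynomial_functions G) M" "J \<subseteq> M" "(\<lambda>_. 1) \<notin> M"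
    "\<And>f. f \<in> polynomial_functions G \<Longrightarrow> f \<notin> M \<Longrightarrow>
       \<exists>h\<in>polynomial_functions G. (\<lambda>v. 1 - f v * h v) \<in> M"
proof -
  let ?R = "polynomial_functions G"
  define \<I> where "\<I> = {I. ideal_of ?R I \<and> J \<subseteq> I \<and> (\<lambda>_. 1) \<notin> I}"
  have "\<exists>M\<in>\<I>. \<forall>X\<in>\<I>. M \<subseteq> X \<longrightarrow> X = M"
  proof (rule subset_Zorn_nonempty)
    show "\<I> \<noteq> {}" using J unfolding \<I>_def by blast
    fix C assume C: "C \<noteq> {}" "subset.chain \<I> C"
    have dir: "\<exists>I\<in>C. f \<in> I \<and> g \<in> I" if "f \<in> \<Union>C" "g \<in> \<Union>C" for f g
      using that C(2) unfolding subset.chain_def by blast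
    have sub: "C \<subseteq> \<I>" using C(2) unfolding subset.chain_def by blast
    have "ideal_of ?R (\<Union>C)"
      unfolding ideal_of_def
    proof (intro conjI ballI)
      show "\<Union>C \<subseteq> ?R" using sub unfolding \<I>_def ideal_of_def by blast
      show "(\<lambda>_. 0) \<in> \<Union>C" using sub C(1) unfolding \<I>_def ideal_of_def by blast
      fix f g assume "f \<in> \<Union>C" "g \<in> \<Union>C"
      from dir[OF this] show "(\<lambda>v. f v + g v) \<in> \<Union>C"
        using sub unfolding \<I>_def ideal_of_def by blast
    next
      fix r f assume "r \<in> ?R" "f \<in> \<Union>C"
      then show "(\<lambda>v. r v * f v) \<in> \<Union>C"
        using sub unfolding \<I>_def ideal_of_def by blast
    qed
    then show "\<Union>C \<in> \<I>" using sub C(1) unfolding \<I>_def by blast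
  qed
  then obtain M where "M \<in> \<I>" and max: "\<And>X. X \<in> \<I> \<Longrightarrow> M \<subseteq> X \<Longrightarrow> X = M"
    by blast
  then have M: "ideal_of ?R M" "J \<subseteq> M" "(\<lambda>_. 1) \<notin> M"
    unfolding \<I>_def by simp_all
  have "\<exists>h\<in>?R. (\<lambda>v. 1 - f v * h v) \<in> M" if f: "f \<in> ?R" "f \<notin> M" for f
  proof -
    define X where "X = {\<lambda>v. m v + f v * h v | m h. m \<in> M \<and> h \<in> ?R}"
    have X: "ideal_of ?R X"
      unfolding ideal_of_def
    proof (intro conjI ballI)
      show "X \<subseteq> ?R"
        using ideal_ofD(1)[OF M(1)] f(1)
        by (auto simp: X_def intro!: polynomial_functions.add polynomial_functions.mult)
      show "(\<lambda>_. 0) \<in> X"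
        unfolding X_def using ideal_ofD(2)[OF M(1)]
        by (intro CollectI exI[of _ "\<lambda>_. 0"]) (auto intro: polynomial_functions.const)
    next
      fix p q assume "p \<in> X" "q \<in> X"
      then obtain m h n k where "p = (\<lambda>v. m v + f v * h v)" "q = (\<lambda>v. n v + f v * k v)"
        "m \<in> M" "n \<in> M" "h \<in> ?R" "k \<in> ?R" unfolding X_def by blast
      then show "(\<lambda>v. p v + q v) \<in> X"
        unfolding X_def using ideal_ofD(3)[OF M(1)]
        by (intro CollectI exI[of _ "\<lambda>v. m v + n v"] exI[of _ "\<lambda>v. h v + k v"])
          (auto intro: polynomial_functions.add simp: algebra_simps)
    next
      fix r p assume r: "r \<in> ?R" and "p \<in> X"
      then obtain m h where "p = (\<lambda>v. m v + f v * h v)" "m \<in> M" "h \<in> ?R"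
        unfolding X_def by blast
      then show "(\<lambda>v. r v * p v) \<in> X"
        unfolding X_def using ideal_ofD(4)[OF M(1) r] r
        by (intro CollectI exI[of _ "\<lambda>v. r v * m v"] exI[of _ "\<lambda>v. r v * h v"])
          (auto intro: polynomial_functions.mult simp: algebra_simps)
    qed
    have "M \<subseteq> X"
    proof
      fix m assume "m \<in> M"
      then show "m \<in> X" unfolding X_def
        by (intro CollectI exI[of _ m] exI[of _ "\<lambda>_. 0"]) (auto intro: polynomial_functions.const)
    qed
    moreover have "f \<in> X"
      unfolding X_def using ideal_ofD(2)[OF M(1)]
      by (intro CollectI exI[of _ "\<lambda>_. 0"] exI[of _ "\<lambda>_. 1"]) (auto intro: polynomial_functions.const)
    ultimately have "X \<notin> \<I>" using max f(2) by blast
    then have "(\<lambda>_. 1) \<in> X" using X \<open>M \<subseteq> X\<close> M(2) unfolding \<I>_def by blast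
    then obtain m h where mh: "(\<lambda>_. 1) = (\<lambda>v. m v + f v * h v)" "m \<in> M" "h \<in> ?R"
      unfolding X_def by blast
    then have "(\<lambda>v. 1 - f v * h v) = m" by (auto simp: fun_eq_iff) (metis add_diff_cancel_right')
    then show ?thesis using mh by blast
  qed
  with M show ?thesis using that by blast
qed

text \<open>If no \<open>x - c\<close> lay in the maximal ideal, then uncountably many inverses \<open>h c\<close> of \<open>x - c\<close>
  would live in a space of countable dimension; a linear relation between them puts a nonzero
  polynomial in \<open>x\<close> into the ideal.\<close>

theorem nullstellensatz:
  fixes G :: "('v \<Rightarrow> complex) set"
  assumes G: "finite G" and real: "\<And>c. \<exists>v. \<forall>g\<in>G. g v = c g"
    and J: "ideal_of (polynomial_functions G) J" "(\<lambda>_. 1) \<notin> J"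
  shows "\<exists>v. \<forall>f\<in>J. f v = 0"
proof -
  let ?R = "polynomial_functions G"
  obtain M where M: "ideal_of ?R M" "J \<subseteq> M" "(\<lambda>_. 1) \<notin> M"
    and inv: "\<And>f. f \<in> ?R \<Longrightarrow> f \<notin> M \<Longrightarrow> \<exists>h\<in>?R. (\<lambda>v. 1 - f v * h v) \<in> M"
    using exists_maximal_ideal[OF J] by blast
  note [intro] = polynomial_functions.intros
  have comp: "(\<lambda>v. poly p (x v)) \<in> ?R" if "x \<in> ?R" for x p
    by (induction p) (use that in auto)
  have "\<exists>c. (\<lambda>v. x v - c) \<in> M" if "x \<in> G" for x
  proof (rule ccontr)
    assume "\<not> ?thesis"
    then have no: "(\<lambda>v. x v - c) \<notin> M" for c by blast
    have x: "x \<in> ?R" using that by blast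
    have xc: "(\<lambda>v. x v - c) \<in> ?R" for c
      using comp[OF x, of "[:-c, 1:]"] by simp
    obtain h where h: "\<And>c. h c \<in> ?R" "\<And>c. (\<lambda>v. 1 - (x v - c) * h c v) \<in> M"
      using inv[OF xc no] by metis
    define B where "B m = {c. h c \<in> lspan (\<Union>k\<le>m. monomials G k)}" for m
    have "(\<Union>m. B m) = UNIV"
      using polynomial_functions_lspan[OF G h(1)] unfolding B_def by blast
    moreover have "uncountable (UNIV :: complex set)" by (rule uncountable_UNIV_complex)
    ultimately obtain m where "infinite (B m)"
      by (metis countable_UN countable_finite countableI_type)
    then obtain C where C: "finite C" "C \<subseteq> B m" "card C = Suc (card (\<Union>k\<le>m. monomials G k))"
      by (meson infinite_arbitrarily_large)
    obtain a c0 where a: "c0 \<in> C" "a c0 \<noteq> 0" "\<And>v. (\<Sum>c\<in>C. a c * h c v) = 0"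
      using family_dependent[of "\<Union>k\<le>m. monomials G k" C UNIV h] C G unfolding B_def by force
    \<comment> \<open>The numerator of the sum of \<open>a c / (x - c)\<close> after clearing
      denominators; at \<open>c0\<close> only the summand with \<open>c = c0\<close>
      survives.\<close>
    define p where "p = (\<Sum>c\<in>C. smult (a c) (\<Prod>e\<in>C - {c}. [:-e, 1:]))"
    have poly_p: "poly p z = (\<Sum>c\<in>C. a c * (\<Prod>e\<in>C - {c}. z - e))" for z
      by (simp add: p_def poly_sum poly_prod)
    have "poly p c0 = (\<Sum>c\<in>C. if c = c0 then a c0 * (\<Prod>e\<in>C - {c0}. c0 - e) else 0)"
      unfolding poly_p
    proof (rule sum.cong[OF refl])
      fix c assume "c \<in> C"
      show "a c * (\<Prod>e\<in>C - {c}. c0 - e) =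
          (if c = c0 then a c0 * (\<Prod>e\<in>C - {c0}. c0 - e) else 0)"
        using C(1) a(1) by auto
    qed
    also have "\<dots> \<noteq> 0"
      using a C(1) by simp
    finally have p0: "p \<noteq> 0" by auto
    have pM: "(\<lambda>v. poly p (x v)) \<in> M"
    proof -
      \<comment> \<open>Multiplication by the cofactor of \<open>x - c\<close> gives all terms with
        \<open>h c\<close> the same factor, the product of \<open>x - e\<close> over
        \<open>C\<close>; hence they cancel by the relation between the \<open>h c\<close>.\<close>
      define q where "q c v = a c * (\<Prod>e\<in>C - {c}. x v - e) * (1 - (x v - c) * h c v)" for c v
      have "(\<lambda>v. poly (smult (a c) (\<Prod>e\<in>C - {c}. [:-e, 1:])) (x v)) \<in> ?R" for c
        by (rule comp[OF x])
      then have "q c \<in> M" for c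
        using ideal_ofD(4)[OF M(1) _ h(2)[of c], of "\<lambda>v. a c * (\<Prod>e\<in>C - {c}. x v - e)"]
        unfolding q_def by (simp add: poly_prod)
      then have "(\<lambda>v. \<Sum>c\<in>C. q c v) \<in> M"
        by (intro ideal_of_sum[OF M(1)])
      moreover have "(\<Sum>c\<in>C. q c v) = poly p (x v)" for v
      proof -
        have "q c v = a c * (\<Prod>e\<in>C - {c}. x v - e) - (\<Prod>e\<in>C. x v - e) * (a c * h c v)"
          if "c \<in> C" for c
        proof -
          have "a c * P * (1 - X * H) = a c * P - X * P * (a c * H)" for P X H
            by (simp add: algebra_simps)
          then show ?thesis
            unfolding q_def prod.remove[OF C(1) that, of "\<lambda>e. x v - e"] .
        qed
        then have "(\<Sum>c\<in>C. q c v) = poly p (x v) - (\<Prod>e\<in>C. x v - e) * (\<Sum>c\<in>C. a c * h c v)"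
          by (simp add: sum_subtractf poly_p flip: sum_distrib_left)
        then show ?thesis using a(3) by simp
      qed
      ultimately show ?thesis by simp
    qed
    \<comment> \<open>The linear factors of such a polynomial are units modulo \<open>M\<close> and
      can be cancelled one at a time, until a nonzero constant would lie in
      \<open>M\<close>.\<close>
    have "False" if "p \<noteq> 0" "(\<lambda>v. poly p (x v)) \<in> M" for p
      using that
    proof (induction "degree p" arbitrary: p)
      case 0
      then obtain c where "p = [:c:]" "c \<noteq> 0" by (metis degree_eq_zeroE pCons_eq_0_iff)
      then show ?case using ideal_of_smult[OF M(1) 0(3), of "1 / c"] M(3) by simp
    next
      case (Suc n)
      then obtain c where "poly p c = 0"
        by (metis fundamental_theorem_of_algebra constant_degree nat.distinct(1))
      then obtain q where q: "p = [:-c, 1:] * q" unfolding poly_eq_0_iff_dvd by (elim dvdE)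
      have "degree p = Suc (degree q)" using Suc.prems(1) unfolding q by (subst degree_mult_eq) auto
      moreover have "(\<lambda>v. poly q (x v)) \<in> M"
      proof -
        have "(\<lambda>v. poly q (x v) * (1 - (x v - c) * h c v) + h c v * poly p (x v)) \<in> M"
          by (intro ideal_ofD(3)[OF M(1)] ideal_ofD(4)[OF M(1)] h comp x Suc.prems(2))
        then show ?thesis by (simp add: q algebra_simps)
      qed
      moreover have "q \<noteq> 0" using Suc.prems(1) q by auto
      ultimately show ?case using Suc.hyps(1)[of q] Suc.hyps(2) by simp
    qed
    then show False using p0 pM by blast
  qed
  then obtain c where c: "\<And>x. x \<in> G \<Longrightarrow> (\<lambda>v. x v - c x) \<in> M" by metis
  obtain w where w: "\<forall>g\<in>G. g w = c g" using real by blast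
  have fw: "(\<lambda>v. f v - f w) \<in> M" if "f \<in> ?R" for f
    using that
  proof (induction rule: polynomial_functions.induct)
    case (const k)
    then show ?case using ideal_ofD(2)[OF M(1)] by simp
  next
    case (add f g)
    then show ?case using ideal_ofD(3)[OF M(1) add.IH] by (simp add: algebra_simps)
  next
    case (mult f g)
    have "(\<lambda>v. f v * (g v - g w) + g w * (f v - f w)) \<in> M"
      by (intro ideal_ofD(3)[OF M(1)] ideal_ofD(4)[OF M(1)] mult) auto
    then show ?case by (simp add: algebra_simps)
  qed (use c w in auto)
  have "f w = 0" if "f \<in> J" for f
  proof -
    have "(\<lambda>v. f v - f w) \<in> M" "f \<in> M" using that M(2) ideal_ofD(1)[OF J(1)] fw by auto
    from ideal_of_diff[OF M(1) this(2,1)] have "(\<lambda>v. f w) \<in> M" by simp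
    from ideal_of_smult[OF M(1) this, of "1 / f w"] M(3) show ?thesis by (cases "f w = 0") auto
  qed
  then show ?thesis by blast
qed

section \<open>Zariski closed subsets of the projective space\<close>

lemma PF_cut_eq: "f \<in> PF d \<Longrightarrow> f (cut d v) = f v"
  by (induction rule: polynomial_functions.induct)
    (auto simp: gens_def cut_def coeff_poly_cutoff)

lemma PF_homogeneous_cut:
  "f \<in> homogeneous_functions \<Longrightarrow> (\<lambda>v. f (cut d v)) \<in> PF d"
  using PF_cut unfolding homogeneous_functions_def by blast

lemma homogeneous_scale:
  assumes "f \<in> homogeneous_functions"
  obtains n where "\<And>t v. f (scale t v) = t ^ n * f v"
proof -
  obtain n where "\<forall>c S \<nu>. f (smult c S, c * \<nu>) = c ^ n * f (S, \<nu>)"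
    using assms unfolding homogeneous_functions_def by blast
  then have "f (scale t v) = t ^ n * f v" for t v
    by (cases v) (simp add: scale_def)
  then show ?thesis by (rule that)
qed

lemma proj_cone_cut: "v \<in> proj_cone a b d \<Longrightarrow> cut d v = v"
  by (intro cut_id) (auto simp: proj_cone_def polys_vanishing_deg_def)

lemma affine_in_proj_cone: "P \<in> polys_vanishing_deg a b d \<Longrightarrow> (P, 1) \<in> proj_cone a b d"
  by (auto simp: proj_cone_def)

lemma closure_affine_iff:
  assumes Y: "Y \<subseteq> polys_vanishing_deg a b d" and v: "v \<in> proj_cone a b d"
  shows "proj_point v \<in> zariski_proj a b d closure_of ((\<lambda>P. proj_point (P, 1)) ` Y) \<longleftrightarrow>
    (\<forall>f\<in>homogeneous_functions. (\<forall>P\<in>Y. f (P, 1) = 0) \<longrightarrow> f v = 0)" (is "?L \<longleftrightarrow> ?R")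
proof
  assume L: ?L
  show ?R
  proof (intro ballI impI, rule ccontr)
    fix f assume f: "f \<in> homogeneous_functions" "\<forall>P\<in>Y. f (P, 1) = 0" "f v \<noteq> 0"
    define T where "T = proj_point ` {v \<in> proj_cone a b d. \<exists>f\<in>{f}. f v \<noteq> 0}"
    have "openin (zariski_proj a b d) T"
      unfolding openin_zariski_proj T_def using f(1) by blast
    moreover have "proj_point v \<in> T"
      unfolding T_def using v f(3) by blast
    ultimately obtain y where y: "y \<in> (\<lambda>P. proj_point (P, 1)) ` Y" "y \<in> T"
      using L unfolding in_closure_of by blast
    obtain P where P: "P \<in> Y" "y = proj_point (P, 1)" using y(1) by blast
    obtain w where "y = proj_point w" "f w \<noteq> 0" using y(2) unfolding T_def by auto
    with P have "P \<in> Y" "proj_point (P, 1) = proj_point w" "f w \<noteq> 0" by simp_all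
    then show False
      using homogeneous_proj_point_cong[OF f(1)] f(2) by blast
  qed
next
  assume R: ?R
  show ?L
    unfolding in_closure_of
  proof (intro conjI allI impI)
    show "proj_point v \<in> topspace (zariski_proj a b d)" using v by simp
    fix T assume T: "proj_point v \<in> T \<and> openin (zariski_proj a b d) T"
    then obtain F where F: "F \<subseteq> homogeneous_functions"
      "T = proj_point ` {v \<in> proj_cone a b d. \<exists>f\<in>F. f v \<noteq> 0}"
      unfolding openin_zariski_proj by blast
    have "proj_point v \<in> proj_point ` {v \<in> proj_cone a b d. \<exists>f\<in>F. f v \<noteq> 0}"
      using T unfolding F(2) by (rule conjunct1)
    then obtain w f where "proj_point v = proj_point w" "f \<in> F" "f w \<noteq> 0"
      by auto
    then have f: "f \<in> F" "f v \<noteq> 0" "f \<in> homogeneous_functions"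
      using homogeneous_proj_point_cong[of f v w] F(1) by auto
    then obtain P where P: "P \<in> Y" "f (P, 1) \<noteq> 0" using R by blast
    then have "(P, 1) \<in> {v \<in> proj_cone a b d. \<exists>f\<in>F. f v \<noteq> 0}"
      using f(1) affine_in_proj_cone[of P a b d] Y by auto
    then have "proj_point (P, 1) \<in> T"
      unfolding F(2) by (rule imageI)
    then show "\<exists>y. y \<in> (\<lambda>P. proj_point (P, 1)) ` Y \<and> y \<in> T"
      using P(1) by blast
  qed
qed

lemma proj_point_eqD: "proj_point v = proj_point w \<Longrightarrow> \<exists>c. c \<noteq> 0 \<and> w = scale c v"
proof -
  assume "proj_point v = proj_point w"
  moreover have "w \<in> proj_point w"
    unfolding proj_point_def by (auto intro!: exI[of _ 1] simp: prod_eq_iff)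
  ultimately have "w \<in> proj_point v" by simp
  then show ?thesis unfolding proj_point_def scale_def by blast
qed

lemma in_infinite_hyperplane_iff:
  assumes "v \<in> proj_cone a b d"
  shows "proj_point v \<in> infinite_hyperplane a b d \<longleftrightarrow> snd v = 0"
proof
  assume "proj_point v \<in> infinite_hyperplane a b d"
  then obtain S where "proj_point (S, 0) = proj_point v"
    unfolding infinite_hyperplane_def by auto
  then show "snd v = 0" using proj_point_eqD[of "(S, 0)" v] by (auto simp: scale_def)
next
  assume "snd v = 0"
  then show "proj_point v \<in> infinite_hyperplane a b d"
    using assms unfolding infinite_hyperplane_def by (cases v) auto
qed

lemma closedin_form_zeros:
  assumes "f \<in> homogeneous_functions"
  shows "closedin (zariski_proj a b d) (proj_point ` {v \<in> proj_cone a b d. f v = 0})"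
  unfolding closedin_zariski_proj using assms by (intro exI[of _ "{f}"]) auto

lemma closedin_at_infinity_part: "closedin (zariski_proj a b d) (at_infinity_part a b d Y)"
proof -
  have "snd \<in> homogeneous_functions"
    by (rule form_homogeneous[OF form.gen]) simp
  from closedin_form_zeros[OF this, of a b d]
  have "closedin (zariski_proj a b d) (infinite_hyperplane a b d)"
    by (rule back_subst[of "closedin _"])
      (use in_infinite_hyperplane_iff[of _ a b d] in \<open>force simp: infinite_hyperplane_def\<close>)
  then show ?thesis
    unfolding at_infinity_part_def by (intro closedin_Int) auto
qed

lemma closedin_zariski_proj_separate:
  assumes "closedin (zariski_proj a b d) C" "v \<in> proj_cone a b d" "proj_point v \<notin> C"
  obtains f where "f \<in> homogeneous_functions" "f v \<noteq> 0"
    "\<And>w. w \<in> proj_cone a b d \<Longrightarrow> proj_point w \<in> C \<Longrightarrow> f w = 0"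
proof -
  obtain F where F: "F \<subseteq> homogeneous_functions"
    "C = proj_point ` {v \<in> proj_cone a b d. \<forall>f\<in>F. f v = 0}"
    using assms(1) unfolding closedin_zariski_proj by blast
  with assms(2,3) obtain f where f: "f \<in> F" "f v \<noteq> 0" by auto
  then have fh: "f \<in> homogeneous_functions" using F(1) by blast
  have "f w = 0" if w: "proj_point w \<in> C" for w
  proof -
    obtain u where "proj_point w = proj_point u" "\<forall>f\<in>F. f u = 0"
      using w unfolding F(2) by auto
    then show ?thesis using homogeneous_proj_point_cong[OF fh] f(1) by blast
  qed
  then show ?thesis by (rule that[OF fh f(2)])
qed

text \<open>A strictly descending chain of closed sets yields an ascending chain of ideals of
  functions vanishing on their cones. The ideals live in \<open>PF d\<close>, which has finitely
  many generators; a homogeneous function separating two members enters after composition with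
  \<open>cut d\<close>.\<close>

lemma wf_closedin_zariski_proj:
  "wf {(C, D). closedin (zariski_proj a b d) C \<and> closedin (zariski_proj a b d) D \<and> C \<subset> D}"
  unfolding wf_iff_no_infinite_down_chain
proof
  let ?X = "zariski_proj a b d"
  assume "\<exists>s. \<forall>i. (s (Suc i), s i) \<in> {(C, D). closedin ?X C \<and> closedin ?X D \<and> C \<subset> D}"
  then obtain s where
    "\<forall>i. (s (Suc i), s i) \<in> {(C, D). closedin ?X C \<and> closedin ?X D \<and> C \<subset> D}" ..
  then have s: "closedin ?X (s i)" "s (Suc i) \<subset> s i" for i by auto
  define I where "I n = {f \<in> PF d. \<forall>v\<in>proj_cone a b d. proj_point v \<in> s n \<longrightarrow> f v = 0}" for n
  have "ideal_of (PF d) (I n)" for n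
    unfolding ideal_of_def I_def by (auto intro: polynomial_functions.intros)
  moreover have "I n \<subseteq> I (Suc n)" for n
    using s(2)[of n] unfolding I_def by blast
  ultimately obtain N where N: "\<forall>n\<ge>N. I n = I N"
    using noetherian_polynomial_functions[OF finite_gens, of d] unfolding noetherian_def by blast
  obtain p where p: "p \<in> s N" "p \<notin> s (Suc N)" using s(2)[of N] by blast
  then have "p \<in> topspace ?X" using closedin_subset[OF s(1)] by blast
  then obtain v where v: "v \<in> proj_cone a b d" "p = proj_point v" by auto
  obtain f where f: "f \<in> homogeneous_functions" "f v \<noteq> 0"
    "\<And>w. w \<in> proj_cone a b d \<Longrightarrow> proj_point w \<in> s (Suc N) \<Longrightarrow> f w = 0"
    using closedin_zariski_proj_separate[OF s(1) v(1)] p(2) v(2) by metis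
  have "(\<lambda>v. f (cut d v)) \<in> I (Suc N)"
    unfolding I_def using f(3) PF_homogeneous_cut[OF f(1)] by (auto simp: proj_cone_cut)
  then have "(\<lambda>v. f (cut d v)) \<in> I N" using N[rule_format, of "Suc N"] by simp
  then have "f (cut d v) = 0" using v p unfolding I_def by blast
  then show False using f(2) proj_cone_cut[OF v(1)] by simp
qed

text \<open>Noetherian induction: a reducible closed set is the union of two smaller ones. The empty
  set receives the empty family, as irreducible sets are nonempty; redundant members are
  allowed.\<close>

lemma finite_irreducible_decomposition:
  assumes "closedin (zariski_proj a b d) C"
  shows "\<exists>\<I>. finite \<I> \<and> (\<forall>I\<in>\<I>. closedin (zariski_proj a b d) I \<and>
    irreducible_in (zariski_proj a b d) I) \<and> C = \<Union>\<I>"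
  using wf_closedin_zariski_proj[of a b d] assms
proof (induction C rule: wf_induct_rule)
  case (less C)
  let ?X = "zariski_proj a b d"
  consider "C = {}" | "irreducible_in ?X C" | "C \<noteq> {}" "\<not> irreducible_in ?X C" by blast
  then show ?case
  proof cases
    case 1
    then show ?thesis by (intro exI[of _ "{}"]) simp
  next
    case 2
    then show ?thesis using less.prems by (intro exI[of _ "{C}"]) simp
  next
    case 3
    then obtain D E where DE: "closedin ?X D" "closedin ?X E" "C \<subseteq> D \<union> E" "\<not> C \<subseteq> D" "\<not> C \<subseteq> E"
      using closedin_subset[OF less.prems] unfolding irreducible_in_def by blast
    have "closedin ?X (C \<inter> D)" "closedin ?X (C \<inter> E)" "C \<inter> D \<subset> C" "C \<inter> E \<subset> C"
      using DE less.prems by auto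
    then have "\<exists>\<I>. finite \<I> \<and> (\<forall>I\<in>\<I>. closedin ?X I \<and> irreducible_in ?X I) \<and> C \<inter> D = \<Union>\<I>"
      and "\<exists>\<I>. finite \<I> \<and> (\<forall>I\<in>\<I>. closedin ?X I \<and> irreducible_in ?X I) \<and> C \<inter> E = \<Union>\<I>"
      using less.IH less.prems by simp_all
    then obtain \<I> \<J> where
      I: "finite \<I>" "\<forall>I\<in>\<I>. closedin ?X I \<and> irreducible_in ?X I" "C \<inter> D = \<Union>\<I>" and
      J: "finite \<J>" "\<forall>I\<in>\<J>. closedin ?X I \<and> irreducible_in ?X I" "C \<inter> E = \<Union>\<J>"
      by (elim exE conjE)
    have "C = (C \<inter> D) \<union> (C \<inter> E)" using DE(3) by blast
    then have "C = \<Union>(\<I> \<union> \<J>)" unfolding I(3) J(3) by simp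
    then show ?thesis using I(1,2) J(1,2) by (intro exI[of _ "\<I> \<union> \<J>"]) auto
  qed
qed

lemma irreducible_in_Union:
  assumes "irreducible_in X S" "finite \<I>" "\<forall>I\<in>\<I>. closedin X I" "S \<subseteq> \<Union>\<I>"
  shows "\<exists>I\<in>\<I>. S \<subseteq> I"
  using assms(2-)
proof (induction \<I> rule: finite_induct)
  case empty
  then show ?case using assms(1) by (auto simp: irreducible_in_def)
next
  case (insert I \<I>)
  have "closedin X (\<Union>\<I>)" using insert by (intro closedin_Union) auto
  then have "S \<subseteq> I \<or> S \<subseteq> \<Union>\<I>"
    using assms(1) insert.prems unfolding irreducible_in_def by auto
  then show ?case using insert by auto
qed

section \<open>Hyperplane sections and chains of irreducible closed sets\<close>

lemma poly_eq_sum_coeff: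
  fixes p :: "'a::comm_ring_1 poly"
  assumes "degree p \<le> n" shows "poly p x = (\<Sum>i\<le>n. coeff p i * x ^ i)"
  by (subst poly_as_sum_of_monoms'[OF assms, symmetric]) (simp add: poly_sum poly_monom)

text \<open>The form evaluates the polynomial \<open>pCons (snd v) (fst v)\<close> at a point
  \<open>t\<close>; finitely many nonzero polynomials have a common non-root.\<close>

lemma exists_linear_form_nonzero:
  assumes "finite V" "V \<subseteq> proj_cone a b d"
  shows "\<exists>l. form d 1 l \<and> (\<forall>v\<in>V. l v \<noteq> 0)"
proof -
  define p where "p v = pCons (snd v) (fst v)" for v :: "complex poly \<times> complex"
  have "finite (\<Union>v\<in>V. {t. poly (p v) t = 0})"
  proof (intro finite_UN_I assms poly_roots_finite)
    fix v assume "v \<in> V"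
    then show "p v \<noteq> 0" using assms(2) by (auto simp: p_def proj_cone_def)
  qed
  then obtain t where t: "t \<notin> (\<Union>v\<in>V. {t. poly (p v) t = 0})"
    using ex_new_if_finite[OF infinite_UNIV_char_0] by blast
  define l where "l v = snd v + (\<Sum>i\<le>d. t ^ Suc i * coeff (fst v) i)"
    for v :: "complex poly \<times> complex"
  have "form d 1 l"
    unfolding l_def
    by (intro form.add form_sum form_smult form.gen coeff_in_gens snd_in_gens) simp
  moreover have "l v = poly (p v) t" if "v \<in> V" for v
  proof -
    have "degree (fst v) \<le> d"
      using that assms(2) by (auto simp: proj_cone_def polys_vanishing_deg_def)
    then show ?thesis
      unfolding l_def p_def poly_pCons poly_eq_sum_coeff[OF \<open>degree (fst v) \<le> d\<close>]
      by (simp add: sum_distrib_left algebra_simps)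
  qed
  ultimately show ?thesis using t by (intro exI[of _ l]) auto
qed

text \<open>The members are closed in \<open>X\<close> itself and merely contained in
  \<open>B\<close>; the length \<open>k\<close> counts inclusions, so there are \<open>k + 1\<close>
  members.\<close>

definition has_chain :: "'a topology \<Rightarrow> 'a set \<Rightarrow> nat \<Rightarrow> bool" where
  "has_chain X B k \<longleftrightarrow> (\<exists>Z :: nat \<Rightarrow> 'a set.
     (\<forall>i\<le>k. closedin X (Z i) \<and> irreducible_in X (Z i) \<and> Z i \<subseteq> B) \<and> (\<forall>i<k. Z i \<subset> Z (Suc i)))"

text \<open>Each new form is nonzero at a chosen point of every member of a decomposition of
  \<open>B\<close>. A chain in the hyperplane section then extends by one: its top lies in some
  member, strictly because of the chosen point. So each cut lowers the bound on chains by one, and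
  no chain of length 0 means that nothing is left.\<close>

lemma exists_cutting_linear_forms:
  assumes "closedin (zariski_proj a b d) B" "\<not> has_chain (zariski_proj a b d) B k"
  shows "\<exists>l. (\<forall>i<k. form d 1 (l i)) \<and>
    (\<forall>v\<in>proj_cone a b d. proj_point v \<in> B \<longrightarrow> (\<exists>i<k. l i v \<noteq> 0))"
  using assms
proof (induction k arbitrary: B)
  case 0
  let ?X = "zariski_proj a b d"
  obtain \<I> where I: "\<forall>I\<in>\<I>. closedin ?X I \<and> irreducible_in ?X I" "B = \<Union>\<I>"
    using finite_irreducible_decomposition[OF 0(1)] by blast
  have "I \<notin> \<I>" for I
    using 0(2) I unfolding has_chain_def by (auto dest!: spec[of _ "\<lambda>_. I"])
  then have "B = {}" using I by auto
  then show ?case by simp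
next
  case (Suc k)
  let ?X = "zariski_proj a b d"
  obtain \<I> where I: "finite \<I>" "\<forall>I\<in>\<I>. closedin ?X I \<and> irreducible_in ?X I" "B = \<Union>\<I>"
    using finite_irreducible_decomposition[OF Suc.prems(1)] by blast
  have "\<exists>v\<in>proj_cone a b d. proj_point v \<in> I" if "I \<in> \<I>" for I
    using I(2) that unfolding irreducible_in_def topspace_zariski_proj by blast
  then obtain v where v: "\<And>I. I \<in> \<I> \<Longrightarrow> v I \<in> proj_cone a b d" "\<And>I. I \<in> \<I> \<Longrightarrow> proj_point (v I) \<in> I"
    by metis
  obtain l0 where l0: "form d 1 l0" "\<forall>w\<in>v ` \<I>. l0 w \<noteq> 0"
    using exists_linear_form_nonzero[of "v ` \<I>" a b d] I(1) v(1) by blast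
  define C where "C = proj_point ` {v \<in> proj_cone a b d. l0 v = 0}"
  have C: "closedin ?X C"
    unfolding C_def by (intro closedin_form_zeros form_homogeneous[OF l0(1)])
  have notC: "proj_point (v I) \<notin> C" if "I \<in> \<I>" for I
    using homogeneous_proj_point_cong[OF form_homogeneous[OF l0(1)], of "v I"] l0(2) that
    unfolding C_def by blast
  have "\<not> has_chain ?X (B \<inter> C) k"
  proof
    assume "has_chain ?X (B \<inter> C) k"
    then obtain Z where Z: "\<And>i. i \<le> k \<Longrightarrow> closedin ?X (Z i) \<and> irreducible_in ?X (Z i) \<and> Z i \<subseteq> B \<inter> C"
      "\<And>i. i < k \<Longrightarrow> Z i \<subset> Z (Suc i)" unfolding has_chain_def by blast
    obtain I where "I \<in> \<I>" "Z k \<subseteq> I"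
      using irreducible_in_Union[of ?X "Z k" \<I>] Z(1)[of k] I by auto
    with Z(1)[of k] v(2) notC have "Z k \<subset> I" by blast
    then have "has_chain ?X B (Suc k)"
      unfolding has_chain_def using Z I \<open>I \<in> \<I>\<close>
      by (intro exI[of _ "\<lambda>i. if i \<le> k then Z i else I"]) (auto simp: less_Suc_eq le_Suc_eq)
    then show False using Suc.prems(2) by blast
  qed
  from Suc.IH[OF closedin_Int[OF Suc.prems(1) C] this] obtain l where
    l: "\<forall>i<k. form d 1 (l i)"
    "\<forall>v\<in>proj_cone a b d. proj_point v \<in> B \<inter> C \<longrightarrow> (\<exists>i<k. l i v \<noteq> 0)" by blast
  have "\<exists>i<Suc k. (if i < k then l i else l0) w \<noteq> 0"
    if w: "w \<in> proj_cone a b d" "proj_point w \<in> B" for w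
  proof (cases "l0 w = 0")
    case True
    then have "proj_point w \<in> C" unfolding C_def using w(1) by blast
    then obtain i where "i < k" "l i w \<noteq> 0" using l(2) w by blast
    then show ?thesis by (intro exI[of _ i]) auto
  qed (auto intro!: exI[of _ k])
  then show ?case
    using l(1) l0(1) by (intro exI[of _ "\<lambda>i. if i < k then l i else l0"]) auto
qed

section \<open>Regular functions on an affine set with few points at infinity\<close>

lemma gens_realizable: "\<exists>v. \<forall>g\<in>gens d. g v = c g"
proof -
  let ?S = "\<Sum>i\<le>d. monom (c (\<lambda>v. coeff (fst v) i)) i"
  have "coeff ?S i = c (\<lambda>v. coeff (fst v) i)" if "i \<le> d" for i
    using that by (simp add: coeff_sum)
  then have "\<forall>g\<in>gens d. g (?S, c snd) = c g"
    unfolding gens_def by auto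
  then show ?thesis by blast
qed

lemma cone_ideal:
  "ideal_of (PF d) {f \<in> PF d. \<forall>P\<in>A. \<forall>t. f (scale t (P, 1)) = 0}"
  unfolding ideal_of_def by (auto intro: polynomial_functions.intros)

text \<open>The Nullstellensatz yields a zero among all polynomials of degree at most
  \<open>d\<close>. That it vanishes at \<open>a\<close> and \<open>b\<close> is recovered from
  evaluation at these points, a linear form that vanishes on the cone over \<open>A\<close>.\<close>

lemma cone_ideal_zero_in_at_infinity_part:
  assumes A: "A \<subseteq> polys_vanishing_deg a b d"
    and w: "degree (fst w) \<le> d" "w \<noteq> (0, 0)" "snd w = 0"
    and J: "\<And>f. f \<in> PF d \<Longrightarrow> \<forall>P\<in>A. \<forall>t. f (scale t (P, 1)) = 0 \<Longrightarrow> f w = 0"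
  shows "w \<in> proj_cone a b d" "proj_point w \<in> at_infinity_part a b d A"
proof -
  have root: "poly (fst w) x = 0" if x: "\<And>P. P \<in> A \<Longrightarrow> poly P x = 0" for x
  proof -
    let ?f = "\<lambda>v :: complex poly \<times> complex. \<Sum>i\<le>d. x ^ i * coeff (fst v) i"
    have f: "?f v = poly (fst v) x" if "degree (fst v) \<le> d" for v
      using poly_eq_sum_coeff[OF that, of x] by (simp add: mult.commute)
    have "form d 1 ?f"
      by (intro form_sum form_smult form.gen coeff_in_gens) simp
    then have "?f \<in> PF d" by (rule form_PF)
    moreover have "\<forall>P\<in>A. \<forall>t. ?f (scale t (P, 1)) = 0"
    proof (intro ballI allI)
      fix P t assume P: "P \<in> A"
      then have "degree (fst (scale t (P, 1))) \<le> d"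
        using A degree_smult_le[of t P] by (force simp: scale_def polys_vanishing_deg_def)
      then show "?f (scale t (P, 1)) = 0"
        unfolding f[OF \<open>degree (fst (scale t (P, 1))) \<le> d\<close>] using x[OF P] by (simp add: scale_def)
    qed
    ultimately have "?f w = 0" by (rule J)
    then show ?thesis using f[OF w(1)] by simp
  qed
  have "poly (fst w) a = 0" "poly (fst w) b = 0"
    using A by (auto intro!: root simp: polys_vanishing_deg_def polys_vanishing_def)
  then show cone: "w \<in> proj_cone a b d"
    using w by (cases w) (auto simp: proj_cone_def polys_vanishing_deg_def polys_vanishing_def)
  have "f w = 0" if f: "f \<in> homogeneous_functions" "\<forall>P\<in>A. f (P, 1) = 0" for f
  proof -
    obtain n where n: "\<And>t v. f (scale t v) = t ^ n * f v"
      using homogeneous_scale[OF f(1)] by blast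
    have "\<forall>P\<in>A. \<forall>t. f (cut d (scale t (P, 1))) = 0"
    proof (intro ballI allI)
      fix P t assume P: "P \<in> A"
      have "degree (fst (scale t (P, 1))) \<le> d"
        using A P degree_smult_le[of t P] by (force simp: scale_def polys_vanishing_deg_def)
      then show "f (cut d (scale t (P, 1))) = 0"
        using f(2) P by (simp add: cut_id n)
    qed
    from J[OF PF_homogeneous_cut[OF f(1)] this] show ?thesis
      by (simp add: cut_id[OF w(1)])
  qed
  then show "proj_point w \<in> at_infinity_part a b d A"
    unfolding at_infinity_part_def
    using closure_affine_iff[OF A cone] in_infinite_hyperplane_iff[OF cone] w(3) by blast
qed

text \<open>Finiteness of a linear projection: the cutting forms together with \<open>snd\<close>
  have no common zero on the closure of \<open>A\<close>, so in the chart \<open>x = 1\<close> they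
  generate the unit ideal modulo the ideal of the cone. Homogenizing that expression of 1 gives a
  power of \<open>x\<close>.\<close>

lemma coordinate_integral:
  fixes l :: "nat \<Rightarrow> complex poly \<times> complex \<Rightarrow> complex"
  assumes A: "A \<subseteq> polys_vanishing_deg a b d"
    and l: "\<And>i. i \<le> k \<Longrightarrow> form d 1 (l i)" "l k = snd"
    and cutting: "\<forall>v\<in>proj_cone a b d. proj_point v \<in> at_infinity_part a b d A \<longrightarrow> (\<exists>i<k. l i v \<noteq> 0)"
    and x: "x \<in> gens d"
  shows "\<exists>N g. (\<forall>i\<le>k. form d N (g i)) \<and>
    (\<forall>P\<in>A. x (P, 1) ^ Suc N = (\<Sum>i\<le>k. l i (P, 1) * g i (P, 1)))"
proof -
  note [intro] = polynomial_functions.intros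
  define J0 where "J0 = {f \<in> PF d. \<forall>P\<in>A. \<forall>t. f (scale t (P, 1)) = 0}"
  have J0: "ideal_of (PF d) J0" unfolding J0_def by (rule cone_ideal)
  have lPF: "l i \<in> PF d" if "i \<le> k" for i using form_PF[OF l(1)[OF that]] .
  have xPF: "x \<in> PF d" using x by blast
  \<comment> \<open>Imposing \<open>x = 1\<close> excludes the vertex of the cone, so a zero of
    \<open>J\<close> would be an actual point of \<open>A\<close> at infinity at which all
    \<open>l i\<close> vanish.\<close>
  define J where "J = {\<lambda>v. j v + (\<Sum>i\<le>k. l i v * h i v) + (1 - x v) * q v | j h q.
    j \<in> J0 \<and> (\<forall>i. h i \<in> PF d) \<and> q \<in> PF d}"
  have J_ideal: "ideal_of (PF d) J"
    unfolding ideal_of_def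
  proof (intro conjI ballI subsetI)
    fix f assume "f \<in> J"
    then obtain j h q where f: "f = (\<lambda>v. j v + (\<Sum>i\<le>k. l i v * h i v) + (1 - x v) * q v)"
      "j \<in> J0" "\<forall>i. h i \<in> PF d" "q \<in> PF d" unfolding J_def by blast
    have "(\<lambda>v. 1 + (-1) * x v) \<in> PF d"
      by (rule polynomial_functions.add[OF polynomial_functions.const
            polynomial_functions.mult[OF polynomial_functions.const xPF]])
    then have "(\<lambda>v. 1 - x v) \<in> PF d" by simp
    moreover have "j \<in> PF d" using f(2) unfolding J0_def by blast
    ultimately show "f \<in> PF d"
      unfolding f(1) using f(3,4) lPF
      by (intro polynomial_functions.add polynomial_functions.mult PF_sum) auto
  next
    show "(\<lambda>_. 0) \<in> J"
      unfolding J_def using ideal_ofD(2)[OF J0]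
      by (intro CollectI exI[of _ "\<lambda>_. 0"] exI[of _ "\<lambda>_ _. 0"]) auto
  next
    fix f f' assume "f \<in> J" "f' \<in> J"
    then obtain j h q j' h' q' where
      f: "f = (\<lambda>v. j v + (\<Sum>i\<le>k. l i v * h i v) + (1 - x v) * q v)"
        "j \<in> J0" "\<forall>i. h i \<in> PF d" "q \<in> PF d" and
      f': "f' = (\<lambda>v. j' v + (\<Sum>i\<le>k. l i v * h' i v) + (1 - x v) * q' v)"
        "j' \<in> J0" "\<forall>i. h' i \<in> PF d" "q' \<in> PF d" unfolding J_def by blast
    have "(\<lambda>v. j v + j' v) \<in> J0" using ideal_ofD(3)[OF J0 f(2) f'(2)] .
    then show "(\<lambda>v. f v + f' v) \<in> J"
      unfolding J_def f(1) f'(1) using f(3,4) f'(3,4)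
      by (intro CollectI exI[of _ "\<lambda>v. j v + j' v"] exI[of _ "\<lambda>i v. h i v + h' i v"]
          exI[of _ "\<lambda>v. q v + q' v"])
        (auto simp: algebra_simps sum.distrib)
  next
    fix r f assume r: "r \<in> PF d" and "f \<in> J"
    then obtain j h q where f: "f = (\<lambda>v. j v + (\<Sum>i\<le>k. l i v * h i v) + (1 - x v) * q v)"
      "j \<in> J0" "\<forall>i. h i \<in> PF d" "q \<in> PF d" unfolding J_def by blast
    have "(\<lambda>v. r v * j v) \<in> J0" using ideal_ofD(4)[OF J0 r f(2)] .
    then show "(\<lambda>v. r v * f v) \<in> J"
      unfolding J_def f(1) using f(3,4) r
      by (intro CollectI exI[of _ "\<lambda>v. r v * j v"] exI[of _ "\<lambda>i v. r v * h i v"]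
          exI[of _ "\<lambda>v. r v * q v"])
        (auto simp: algebra_simps sum_distrib_left)
  qed
  have "(\<lambda>_. 1) \<in> J"
  proof (rule ccontr)
    assume "(\<lambda>_. 1) \<notin> J"
    from nullstellensatz[OF finite_gens gens_realizable J_ideal this]
    obtain v where v: "\<forall>f\<in>J. f v = 0" by blast
    define w where "w = cut d v"
    have w: "f w = 0" if "f \<in> J" for f
      using that v PF_cut_eq[of f d v] ideal_ofD(1)[OF J_ideal] unfolding w_def by auto
    have J0J: "j \<in> J" if "j \<in> J0" for j
      unfolding J_def using that
      by (intro CollectI exI[of _ j] exI[of _ "\<lambda>_ _. 0"] exI[of _ "\<lambda>_. 0"]) auto
    have lJ: "l i \<in> J" if "i \<le> k" for i
    proof -
      have "l i = (\<lambda>v. 0 + (\<Sum>m\<le>k. l m v * (if m = i then 1 else 0)) + (1 - x v) * 0)"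
        using that by (simp add: if_distrib[of "\<lambda>c. _ * c"] cong: if_cong)
      then show ?thesis
        unfolding J_def using ideal_ofD(2)[OF J0]
        by (intro CollectI exI[of _ "\<lambda>_. 0"] exI[of _ "\<lambda>m _. if m = i then 1 else 0"]) auto
    qed
    have "(\<lambda>v. 1 - x v) \<in> J"
      unfolding J_def using ideal_ofD(2)[OF J0]
      by (intro CollectI exI[of _ "\<lambda>_. 0"] exI[of _ "\<lambda>_ _. 0"] exI[of _ "\<lambda>_. 1"]) auto
    from w[OF this] have "x w = 1" by simp
    then have "w \<noteq> (0, 0)"
      using gens_scale[OF x, of 0 w] by (auto simp: scale_def)
    moreover have "degree (fst w) \<le> d"
      unfolding w_def cut_def
      by (intro degree_le) (simp add: coeff_poly_cutoff)
    moreover have "snd w = 0" using w[OF lJ[of k]] l(2) by simp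
    moreover have "f w = 0" if "f \<in> PF d" "\<forall>P\<in>A. \<forall>t. f (scale t (P, 1)) = 0" for f
      using w[OF J0J[of f]] that unfolding J0_def by blast
    ultimately have "w \<in> proj_cone a b d" "proj_point w \<in> at_infinity_part a b d A"
      using cone_ideal_zero_in_at_infinity_part[OF A, of w] by blast+
    then obtain i where "i < k" "l i w \<noteq> 0" using cutting by blast
    then show False using w[OF lJ[of i]] by simp
  qed
  then obtain j h q where one: "(\<lambda>_. 1) = (\<lambda>v. j v + (\<Sum>i\<le>k. l i v * h i v) + (1 - x v) * q v)"
    and j: "j \<in> J0" and h: "\<forall>i. h i \<in> PF d" unfolding J_def by blast
  have "\<forall>i. \<exists>M. \<forall>N\<ge>M. \<exists>g. form d N g \<and> (\<forall>v. x v \<noteq> 0 \<longrightarrow> g v = x v ^ N * h i (scale (1 / x v) v))"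
    using PF_homogenize[OF h[rule_format] x] by blast
  then obtain M where M: "\<And>i N. N \<ge> M i \<Longrightarrow>
      \<exists>g. form d N g \<and> (\<forall>v. x v \<noteq> 0 \<longrightarrow> g v = x v ^ N * h i (scale (1 / x v) v))" by metis
  define N where "N = Max (M ` {..k})"
  have N: "M i \<le> N" if "i \<le> k" for i unfolding N_def by (rule Max_ge) (use that in auto)
  have "\<forall>i. \<exists>g. i \<le> k \<longrightarrow> form d N g \<and> (\<forall>v. x v \<noteq> 0 \<longrightarrow> g v = x v ^ N * h i (scale (1 / x v) v))"
    using M N by blast
  then obtain g where g: "\<And>i. i \<le> k \<Longrightarrow> form d N (g i)"
    "\<And>i v. i \<le> k \<Longrightarrow> x v \<noteq> 0 \<Longrightarrow> g i v = x v ^ N * h i (scale (1 / x v) v)" by metis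
  \<comment> \<open>The extra factor \<open>x\<close> makes the identity trivial where
    \<open>x\<close> vanishes; there the homogenization says nothing about \<open>g\<close>.\<close>
  have "x v ^ Suc (Suc N) = (\<Sum>i\<le>k. l i v * (x v * g i v))"
    if v: "v = (P, 1)" and P: "P \<in> A" for P v
  proof (cases "x v = 0")
    case False
    let ?u = "scale (1 / x v) v"
    have "j ?u = 0" using j P unfolding J0_def v by blast
    moreover have "x ?u = 1" using False by (simp add: gens_scale[OF x])
    ultimately have "1 = (\<Sum>i\<le>k. l i ?u * h i ?u)"
      using fun_cong[OF one, of ?u] by simp
    also have "\<dots> = (\<Sum>i\<le>k. l i v * g i v) / x v ^ Suc N"
      unfolding sum_divide_distrib
    proof (rule sum.cong[OF refl])
      fix i assume "i \<in> {..k}"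
      then have "i \<le> k" by simp
      from form_scale[OF l(1)[OF this], of "1 / x v" v] g(2)[OF this False]
      show "l i ?u * h i ?u = l i v * g i v / x v ^ Suc N" using False by simp
    qed
    finally have "x v ^ Suc N = (\<Sum>i\<le>k. l i v * g i v)" using False by simp
    then show ?thesis by (simp add: sum_distrib_left mult.left_commute)
  qed simp
  moreover have "form d (Suc N) (\<lambda>v. x v * g i v)" if "i \<le> k" for i
    using form.mult[OF form.gen[OF x] g(1)[OF that]] by simp
  ultimately show ?thesis
    by (intro exI[of _ "Suc N"] exI[of _ "\<lambda>i v. x v * g i v"]) auto
qed

text \<open>Powers of a coordinate \<open>x\<close> above \<open>N x\<close> are traded for the
  forms \<open>L i\<close>, which leaves powers of these times monomials with bounded exponents;
  \<open>K\<close> counts the latter. As \<open>snd\<close> equals 1 on \<open>A\<close>, it costs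
  no exponent, and the count grows with exponent \<open>k\<close> instead of
  \<open>k + 1\<close>.\<close>

lemma forms_spanned_by_few_monomials:
  fixes l :: "nat \<Rightarrow> complex poly \<times> complex \<Rightarrow> complex"
  assumes A: "A \<subseteq> polys_vanishing_deg a b d"
    and l: "\<And>i. i < k \<Longrightarrow> form d 1 (l i)"
    and cutting: "\<forall>v\<in>proj_cone a b d. proj_point v \<in> at_infinity_part a b d A \<longrightarrow> (\<exists>i<k. l i v \<noteq> 0)"
  shows "\<exists>K. \<forall>m. \<exists>T. finite T \<and> card T \<le> (m + 1) ^ k * K \<and>
    (\<forall>f. form d m f \<longrightarrow> (\<exists>h\<in>lspan T. \<forall>P\<in>A. f (P, 1) = h (P, 1 :: complex)))"
proof -
  define L where "L i = (if i < k then l i else snd)" for i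
  have L: "form d 1 (L i)" for i
    unfolding L_def using l form.gen[OF snd_in_gens] by simp
  have L_less: "i < k \<Longrightarrow> L i = l i" for i by (simp add: L_def)
  have "\<forall>x\<in>gens d. \<exists>N g. (\<forall>i\<le>k. form d N (g i)) \<and>
    (\<forall>P\<in>A. x (P, 1) ^ Suc N = (\<Sum>i\<le>k. L i (P, 1) * g i (P, 1)))"
    by (intro ballI coordinate_integral[OF A]) (use L cutting in \<open>auto simp: L_def\<close>)
  then obtain N g where
    Ng: "\<And>x i. x \<in> gens d \<Longrightarrow> i \<le> k \<Longrightarrow> form d (N x) (g x i)"
    "\<And>x P. x \<in> gens d \<Longrightarrow> P \<in> A \<Longrightarrow>
       x (P, 1) ^ Suc (N x) = (\<Sum>i\<le>k. L i (P, 1) * g x i (P, 1))" by metis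
  define mono where "mono \<beta> e v = (\<Prod>i<k. L i v ^ \<beta> i) * (\<Prod>x\<in>gens d. x v ^ e x)"
    for \<beta> :: "nat \<Rightarrow> nat" and e and v :: "complex poly \<times> complex"
  define T where "T m = (\<lambda>(\<beta>, e). mono \<beta> e) `
    (({..<k} \<rightarrow>\<^sub>E {..m}) \<times> (\<Pi>\<^sub>E x\<in>gens d. {..N x}))" for m :: nat
  have T_memI: "mono \<beta> e \<in> T m" if "\<And>i. i < k \<Longrightarrow> \<beta> i \<le> m" "\<And>x. x \<in> gens d \<Longrightarrow> e x \<le> N x" for \<beta> e m
  proof -
    have "mono \<beta> e = mono (restrict \<beta> {..<k}) (restrict e (gens d))"
      by (simp add: mono_def fun_eq_iff)
    moreover have "(restrict \<beta> {..<k}, restrict e (gens d)) \<in>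
        ({..<k} \<rightarrow>\<^sub>E {..m}) \<times> (\<Pi>\<^sub>E x\<in>gens d. {..N x})"
      using that by (simp add: restrict_PiE_iff)
    ultimately show ?thesis
      unfolding T_def by (metis (no_types, lifting) case_prod_conv image_eqI)
  qed
  have T_memE: "\<exists>\<beta> e. t = mono \<beta> e \<and> (\<forall>i<k. \<beta> i \<le> m) \<and> (\<forall>x\<in>gens d. e x \<le> N x)"
    if "t \<in> T m" for t m using that unfolding T_def by (auto simp: PiE_iff)
  have fin: "finite (T m)" for m
    unfolding T_def by (intro finite_imageI finite_cartesian_product finite_PiE) auto
  have card: "card (T m) \<le> (m + 1) ^ k * (\<Prod>x\<in>gens d. Suc (N x))" for m
  proof -
    have "card (T m) \<le> card (({..<k} \<rightarrow>\<^sub>E {..m}) \<times> (\<Pi>\<^sub>E x\<in>gens d. {..N x}))"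
      unfolding T_def by (intro card_image_le finite_cartesian_product finite_PiE) auto
    then show ?thesis by (simp add: card_PiE card_cartesian_product)
  qed
  define repr where "repr m f \<longleftrightarrow> (\<exists>h\<in>lspan (T m). \<forall>P\<in>A. f (P, 1) = h (P, 1 :: complex))"
    for m and f :: "complex poly \<times> complex \<Rightarrow> complex"
  have repr_sum: "repr m (\<lambda>v. \<Sum>i\<in>I. f i v)" if "\<And>i. i \<in> I \<Longrightarrow> repr m (f i)" for m I and f :: "'i \<Rightarrow> _"
  proof -
    have "\<forall>i\<in>I. \<exists>h. h \<in> lspan (T m) \<and> (\<forall>P\<in>A. f i (P, 1) = h (P, 1 :: complex))"
      using that unfolding repr_def by blast
    then obtain h where "\<forall>i\<in>I. h i \<in> lspan (T m) \<and> (\<forall>P\<in>A. f i (P, 1) = h i (P, 1))" by metis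
    then show ?thesis
      unfolding repr_def by (intro bexI[of _ "\<lambda>v. \<Sum>i\<in>I. h i v"] lspan_sum) auto
  qed
  have repr_smult: "repr m (\<lambda>v. c * f v)" if f: "repr m f" for m c f
  proof -
    obtain h where "h \<in> lspan (T m)" "\<forall>P\<in>A. f (P, 1) = h (P, 1)"
      using f unfolding repr_def by blast
    then show ?thesis
      unfolding repr_def by (intro bexI[of _ "\<lambda>v. c * h v"] lspan_smult) auto
  qed
  have repr_lspan: "repr m f" if S: "f \<in> lspan S" "\<And>s. s \<in> S \<Longrightarrow> repr m s" for m f S
  proof -
    obtain c where f: "f = (\<lambda>v. \<Sum>s\<in>S. c s * s v)" using S(1) unfolding lspan_def by blast
    show ?thesis unfolding f by (intro repr_sum repr_smult S(2))
  qed
  have repr_L: "repr (Suc m) (\<lambda>v. L i v * f v)" if f: "repr m f" and i: "i \<le> k" for m i f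
  proof -
    obtain h where h: "h \<in> lspan (T m)" "\<forall>P\<in>A. f (P, 1) = h (P, 1)"
      using f unfolding repr_def by blast
    show ?thesis
    proof (cases "i < k")
      case True
      have LL: "L i \<in> lspan {L i}" by (rule lspan_base) auto
      have "(\<lambda>v. L i v * h v) \<in> lspan (T (Suc m))"
      proof (rule lspan_mult[OF LL h(1)], rule lspan_base[OF fin])
        fix s t assume s: "s \<in> {L i}" and "t \<in> T m"
        then obtain \<beta> e where t: "t = mono \<beta> e" "\<forall>i<k. \<beta> i \<le> m" "\<forall>x\<in>gens d. e x \<le> N x"
          using T_memE by blast
        have "(\<Prod>j<k. L j v ^ (\<beta>(i := Suc (\<beta> i))) j) = L i v * (\<Prod>j<k. L j v ^ \<beta> j)" for v
        proof -
          have "(\<Prod>j<k. L j v ^ (\<beta>(i := Suc (\<beta> i))) j) =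
              L i v ^ Suc (\<beta> i) * (\<Prod>j\<in>{..<k} - {i}. L j v ^ \<beta> j)"
            using True by (subst prod.remove[of _ i]) (auto intro!: prod.cong)
          moreover have "(\<Prod>j<k. L j v ^ \<beta> j) = L i v ^ \<beta> i * (\<Prod>j\<in>{..<k} - {i}. L j v ^ \<beta> j)"
            using True by (subst prod.remove[of _ i]) auto
          ultimately show ?thesis by simp
        qed
        then have "(\<lambda>v. s v * t v) = mono (\<beta>(i := Suc (\<beta> i))) e"
          using s t(1) by (auto simp: mono_def fun_eq_iff)
        also have "\<dots> \<in> T (Suc m)"
          by (rule T_memI) (use t(2,3) le_SucI in auto)
        finally show "(\<lambda>v. s v * t v) \<in> T (Suc m)" .
      qed
      then show ?thesis unfolding repr_def using h(2) by auto
    next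
      \<comment> \<open>Here \<open>L i\<close> is \<open>snd\<close>, which is 1 at
        \<open>(P, 1)\<close>; it remains to enlarge the bound on the exponents.\<close>
      case False
      have "h \<in> lspan (T (Suc m))"
        using h(1)
      proof (rule lspan_subset)
        fix t assume "t \<in> T m"
        then obtain \<beta> e where "t = mono \<beta> e" "\<forall>i<k. \<beta> i \<le> m" "\<forall>x\<in>gens d. e x \<le> N x"
          using T_memE by blast
        then show "t \<in> lspan (T (Suc m))"
          by (intro lspan_base[OF fin]) (auto intro!: T_memI le_SucI)
      qed
      then show ?thesis unfolding repr_def using h(2) False i by (auto simp: L_def)
    qed
  qed
  have repr_form: "repr m f" if "form d m f" for m f
    using that
  proof (induction m arbitrary: f)
    case (0 f)
    have mono_repr: "repr 0 t" if t: "t \<in> monomials (gens d) 0" for t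
    proof -
      obtain e where e: "t = (\<lambda>v. \<Prod>x\<in>gens d. x v ^ e x)" "sum e (gens d) = 0"
        using t unfolding monomials_def by blast
      have "t = mono (\<lambda>_. 0) e" unfolding e(1) mono_def by (rule ext) simp
      also have "\<dots> \<in> T 0" by (rule T_memI) (use e(2) in auto)
      finally show ?thesis unfolding repr_def using lspan_base[OF fin] by blast
    qed
    show ?case by (rule repr_lspan[OF form_monomials[OF 0] mono_repr])
  next
    case (Suc m f)
    have mono_repr: "repr (Suc m) t" if t: "t \<in> monomials (gens d) (Suc m)" for t
    proof -
      obtain e where e: "t = (\<lambda>v. \<Prod>x\<in>gens d. x v ^ e x)" "sum e (gens d) = Suc m"
        using t unfolding monomials_def by blast
      show ?thesis
      proof (cases "\<forall>x\<in>gens d. e x \<le> N x")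
        case True
        have "t = mono (\<lambda>_. 0) e" unfolding e(1) mono_def by (rule ext) simp
        also have "\<dots> \<in> T (Suc m)" by (rule T_memI) (use True in auto)
        finally show ?thesis unfolding repr_def using lspan_base[OF fin] by blast
      next
        case False
        then obtain x where x: "x \<in> gens d" "e x > N x" by force
        \<comment> \<open>One oversized power is split off and rewritten by \<open>Ng\<close>. Each
          resulting summand has a factor \<open>L i\<close>, and the other factor has degree
          \<open>m\<close>, so the induction hypothesis applies to it.\<close>
        define e' where "e' = e(x := e x - Suc (N x))"
        define r where "r v = (\<Prod>y\<in>gens d. y v ^ e' y)" for v :: "complex poly \<times> complex"
        have tr: "t v = x v ^ Suc (N x) * r v" for v
        proof -
          have "t v = x v ^ e x * (\<Prod>y\<in>gens d - {x}. y v ^ e y)"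
            unfolding e(1) using x(1) by (simp add: prod.remove)
          moreover have "r v = x v ^ (e x - Suc (N x)) * (\<Prod>y\<in>gens d - {x}. y v ^ e y)"
            unfolding r_def e'_def using x(1) by (subst prod.remove[of _ x]) (auto intro!: prod.cong)
          moreover have "x v ^ e x = x v ^ Suc (N x) * x v ^ (e x - Suc (N x))"
            using x(2) by (subst power_add[symmetric]) simp
          ultimately show ?thesis by simp
        qed
        have "sum e' (gens d) = e x - Suc (N x) + sum e (gens d - {x})"
          unfolding e'_def using x(1) by (subst sum.remove[of _ x]) (auto intro!: sum.cong)
        moreover have "sum e (gens d) = e x + sum e (gens d - {x})"
          using x(1) by (simp add: sum.remove)
        ultimately have deg: "sum e' (gens d) + N x = m" using e(2) x(2) by simp
        have "form d (\<Sum>y\<in>gens d. e' y * 1) r"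
          unfolding r_def by (intro form_prod form_power form.gen)
        then have r: "form d (sum e' (gens d)) r" by simp
        have "repr (Suc m) (\<lambda>v. \<Sum>i\<le>k. L i v * (g x i v * r v))"
        proof (intro repr_sum repr_L Suc.IH)
          fix i assume "i \<in> {..k}"
          then have "form d (N x + sum e' (gens d)) (\<lambda>v. g x i v * r v)"
            by (intro form.mult Ng(1)[OF x(1)] r) simp
          then show "form d m (\<lambda>v. g x i v * r v)" using deg by (simp add: add.commute)
        qed auto
        moreover have "t (P, 1) = (\<Sum>i\<le>k. L i (P, 1) * (g x i (P, 1) * r (P, 1)))" if "P \<in> A" for P
          unfolding tr Ng(2)[OF x(1) that] by (simp add: sum_distrib_right mult.assoc)
        ultimately show ?thesis unfolding repr_def by auto
      qed
    qed
    show ?case by (rule repr_lspan[OF form_monomials[OF Suc.prems] mono_repr])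
  qed
  show ?thesis
  proof (rule exI[of _ "\<Prod>x\<in>gens d. Suc (N x)"], rule allI)
    fix m
    have forms: "\<forall>f. form d m f \<longrightarrow> (\<exists>h\<in>lspan (T m). \<forall>P\<in>A. f (P, 1) = h (P, 1 :: complex))"
      using repr_form unfolding repr_def by blast
    show "\<exists>T. finite T \<and> card T \<le> (m + 1) ^ k * (\<Prod>x\<in>gens d. Suc (N x)) \<and>
        (\<forall>f. form d m f \<longrightarrow> (\<exists>h\<in>lspan T. \<forall>P\<in>A. f (P, 1) = h (P, 1 :: complex)))"
      by (rule exI[of _ "T m"], intro conjI, rule fin, rule card, rule forms)
  qed
qed

section \<open>Chains of irreducible sets and independent monomials\<close>

lemma affine_regular_sum:
  "(\<And>i. i \<in> I \<Longrightarrow> f i \<in> affine_regular) \<Longrightarrow> (\<lambda>v. \<Sum>i\<in>I. f i v) \<in> affine_regular"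
  unfolding affine_regular_def by (rule PF_sum)

lemma affine_regular_prod:
  "(\<And>i. i \<in> I \<Longrightarrow> f i \<in> affine_regular) \<Longrightarrow> (\<lambda>v. \<Prod>i\<in>I. f i v) \<in> affine_regular"
  unfolding affine_regular_def
  by (induction I rule: infinite_finite_induct) (auto intro: polynomial_functions.intros)

lemma affine_regular_power: "f \<in> affine_regular \<Longrightarrow> (\<lambda>v. f v ^ n) \<in> affine_regular"
  unfolding affine_regular_def by (induction n) (auto intro: polynomial_functions.intros)

definition prime_on :: "complex poly set \<Rightarrow> bool" where
  "prime_on Z \<longleftrightarrow> (\<forall>f\<in>affine_regular. \<forall>g\<in>affine_regular. (\<forall>P\<in>Z. f P * g P = 0) \<longrightarrow>
     (\<forall>P\<in>Z. f P = 0) \<or> (\<forall>P\<in>Z. g P = 0))"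

lemma prime_on_power:
  assumes "prime_on Z" "f \<in> affine_regular" "g \<in> affine_regular"
    and "\<And>P. P \<in> Z \<Longrightarrow> f P ^ n * g P = 0" "P0 \<in> Z" "f P0 \<noteq> 0" "P \<in> Z"
  shows "g P = 0"
  using assms(1)[unfolded prime_on_def, rule_format, OF affine_regular_power[OF assms(2), of n] assms(3)]
    assms(4-7) by auto

lemma sum_PiE_Suc:
  fixes F :: "(nat \<Rightarrow> nat) \<Rightarrow> complex"
  shows "(\<Sum>\<alpha>\<in>{..<Suc n} \<rightarrow>\<^sub>E {..m}. F \<alpha>) = (\<Sum>j\<le>m. \<Sum>\<alpha>\<in>{..<n} \<rightarrow>\<^sub>E {..m}. F (\<alpha>(n := j)))"
proof -
  have "inj_on (\<lambda>(j, \<alpha>). \<alpha>(n := j)) ({..m} \<times> ({..<n} \<rightarrow>\<^sub>E {..m}))"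
    by (rule inj_combinator) simp
  then have "(\<Sum>\<alpha>\<in>{..<Suc n} \<rightarrow>\<^sub>E {..m}. F \<alpha>) =
      (\<Sum>(j, \<alpha>)\<in>{..m} \<times> ({..<n} \<rightarrow>\<^sub>E {..m}). F (\<alpha>(n := j)))"
    unfolding lessThan_Suc PiE_insert_eq by (subst sum.reindex) (auto simp: case_prod_unfold)
  then show ?thesis by (simp add: sum.cartesian_product)
qed

text \<open>A relation is read as a polynomial in the last function \<open>f n\<close> with
  coefficients \<open>h j\<close> in the earlier ones. On the prime set \<open>Z (Suc n)\<close> a
  power of \<open>f n\<close> can be cancelled; restricting what remains to \<open>Z n\<close>,
  where \<open>f n\<close> vanishes, isolates the lowest coefficient, to which the induction on
  \<open>n\<close> applies.\<close>

lemma chain_monomials_independent: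
  assumes "\<And>i. i \<le> n \<Longrightarrow> prime_on (Z i)" "Z 0 \<noteq> {}"
    and "\<And>i. i < n \<Longrightarrow> Z i \<subseteq> Z (Suc i)" and "\<And>i. i < n \<Longrightarrow> f i \<in> affine_regular"
    and "\<And>i P. i < n \<Longrightarrow> P \<in> Z i \<Longrightarrow> f i P = 0" and "\<And>i. i < n \<Longrightarrow> \<exists>P\<in>Z (Suc i). f i P \<noteq> 0"
    and "\<And>P. P \<in> Z n \<Longrightarrow> (\<Sum>\<alpha>\<in>{..<n} \<rightarrow>\<^sub>E {..m}. c \<alpha> * (\<Prod>i<n. f i P ^ \<alpha> i)) = 0"
    and "\<alpha> \<in> {..<n} \<rightarrow>\<^sub>E {..m}"
  shows "c \<alpha> = 0"
  using assms
proof (induction n arbitrary: c \<alpha>)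
  case 0
  then obtain P where "P \<in> Z 0" by blast
  from 0(7)[OF this] 0(8) show ?case by (simp add: PiE_empty_domain)
next
  case (Suc n)
  let ?E = "{..<n} \<rightarrow>\<^sub>E {..m}"
  define h where "h j P = (\<Sum>\<alpha>\<in>?E. c (\<alpha>(n := j)) * (\<Prod>i<n. f i P ^ \<alpha> i))" for j P
  have hreg: "h j \<in> affine_regular" for j
    unfolding h_def using Suc.prems(4)
    by (intro affine_regular_sum)
      (auto simp: affine_regular_def[symmetric] intro!: affine_regular_prod affine_regular_power
        polynomial_functions.mult[where G = "range (\<lambda>i P. coeff P i)", folded affine_regular_def]
        polynomial_functions.const[where G = "range (\<lambda>i P. coeff P i)", folded affine_regular_def])
  have total: "(\<Sum>j\<le>m. f n P ^ j * h j P) = 0" if "P \<in> Z (Suc n)" for P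
  proof -
    have "(\<Sum>\<alpha>\<in>?E. c (\<alpha>(n := j)) * (\<Prod>i<Suc n. f i P ^ (\<alpha>(n := j)) i)) = f n P ^ j * h j P" for j
      unfolding h_def sum_distrib_left by (intro sum.cong) (auto simp: algebra_simps)
    then show ?thesis using Suc.prems(7)[OF that] unfolding sum_PiE_Suc by simp
  qed
  obtain P0 where P0: "P0 \<in> Z (Suc n)" "f n P0 \<noteq> 0" using Suc.prems(6)[of n] by blast
  have zero: "j \<le> m \<longrightarrow> (\<forall>\<alpha>\<in>?E. c (\<alpha>(n := j)) = 0)" for j
  proof (induction j rule: less_induct)
    case (less j)
    show ?case
    proof (intro impI)
      assume j: "j \<le> m"
      have h0: "h i P = 0" if "i < j" for i P
        unfolding h_def
      proof (rule sum.neutral, rule ballI)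
        fix \<beta> assume "\<beta> \<in> ?E"
        then have "c (\<beta>(n := i)) = 0" using less.IH[OF that] that j by (meson less_imp_le order_trans)
        then show "c (\<beta>(n := i)) * (\<Prod>i<n. f i P ^ \<beta> i) = 0" by (simp only: mult_zero_left)
      qed
      define r where "r P = (\<Sum>i\<in>{Suc j..m}. f n P ^ (i - Suc j) * h i P)" for P
      have split: "(\<Sum>i\<le>m. f n P ^ i * h i P) = f n P ^ j * (h j P + f n P * r P)" for P
      proof -
        have "{..m} = {..<j} \<union> ({j} \<union> {Suc j..m})" using j by auto
        then have "(\<Sum>i\<le>m. f n P ^ i * h i P) =
            (\<Sum>i<j. f n P ^ i * h i P) + (f n P ^ j * h j P + (\<Sum>i\<in>{Suc j..m}. f n P ^ i * h i P))"
          by (simp only:) (subst sum.union_disjoint, auto)+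
        moreover have "(\<Sum>i\<in>{Suc j..m}. f n P ^ i * h i P) = f n P ^ j * (f n P * r P)"
          unfolding r_def sum_distrib_left
        proof (rule sum.cong[OF refl])
          fix i assume "i \<in> {Suc j..m}"
          then have "f n P ^ i = f n P ^ (Suc j + (i - Suc j))" by simp
          then show "f n P ^ i * h i P = f n P ^ j * (f n P * (f n P ^ (i - Suc j) * h i P))"
            by (simp only: power_add power_Suc2 mult.assoc)
        qed
        ultimately show ?thesis using h0 by (simp add: algebra_simps)
      qed
      have "r \<in> affine_regular"
        unfolding r_def using hreg Suc.prems(4)[of n]
        by (intro affine_regular_sum)
          (auto intro!: affine_regular_power
            polynomial_functions.mult[where G = "range (\<lambda>i P. coeff P i)", folded affine_regular_def])
      then have reg: "(\<lambda>P. h j P + f n P * r P) \<in> affine_regular"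
        using hreg[of j] Suc.prems(4)[of n] unfolding affine_regular_def
        by (auto intro: polynomial_functions.intros)
      have "h j P = 0" if P: "P \<in> Z n" for P
      proof -
        have "P \<in> Z (Suc n)" using Suc.prems(3)[of n] P by blast
        from prime_on_power[OF Suc.prems(1)[of "Suc n"] Suc.prems(4)[of n] reg _ P0 this, of j]
        have "h j P + f n P * r P = 0" using total split by simp
        then show ?thesis using Suc.prems(5)[of n P] P by simp
      qed
      then show "\<forall>\<alpha>\<in>?E. c (\<alpha>(n := j)) = 0"
        unfolding h_def using Suc.prems by (intro ballI Suc.IH[of "\<lambda>\<alpha>. c (\<alpha>(n := j))"]) auto
    qed
  qed
  obtain j \<alpha>' where "j \<le> m" "\<alpha>' \<in> ?E" "\<alpha> = \<alpha>'(n := j)"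
    using Suc.prems(8) unfolding lessThan_Suc PiE_insert_eq by auto
  then show ?case using zero by blast
qed

lemma affine_regular_homogenize:
  assumes "f \<in> affine_regular"
  shows "\<exists>N0. \<forall>N\<ge>N0. \<exists>g. form d N g \<and> (\<forall>P. degree P \<le> d \<longrightarrow> g (P, 1) = f P)"
proof -
  have "(\<lambda>v. f (fst v)) \<in> polynomial_functions (insert snd (range (\<lambda>i v. coeff (fst v) i)))"
    using assms unfolding affine_regular_def
    by (induction rule: polynomial_functions.induct) (auto intro: polynomial_functions.intros)
  from PF_homogenize[OF PF_cut[OF this] snd_in_gens]
  obtain N0 where N0: "\<And>N. N \<ge> N0 \<Longrightarrow> \<exists>g. form d N g \<and>
      (\<forall>v. snd v \<noteq> 0 \<longrightarrow> g v = snd v ^ N * f (fst (cut d (scale (1 / snd v) v))))" by blast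
  show ?thesis
  proof (intro exI[of _ N0] allI impI)
    fix N assume "N0 \<le> N"
    from N0[OF this] obtain g where g: "form d N g"
      "\<And>v. snd v \<noteq> 0 \<Longrightarrow> g v = snd v ^ N * f (fst (cut d (scale (1 / snd v) v)))" by blast
    have "g (P, 1) = f P" if "degree P \<le> d" for P
      using g(2)[of "(P, 1)"] cut_id[of "(P, 1)" d] that by (simp add: scale_def)
    with g(1) show "\<exists>g. form d N g \<and> (\<forall>P. degree P \<le> d \<longrightarrow> g (P, 1) = f P)" by blast
  qed
qed

lemma chain_at_infinity:
  assumes A: "A \<subseteq> polys_vanishing_deg a b d"
    and Z: "\<And>i. i \<le> Suc k \<Longrightarrow> prime_on (Z i) \<and> Z i \<subseteq> A" "Z 0 \<noteq> {}"
    and f: "\<And>i. i \<le> k \<Longrightarrow> Z i \<subseteq> Z (Suc i) \<and> f i \<in> affine_regular \<and>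
       (\<forall>P\<in>Z i. f i P = 0) \<and> (\<exists>P\<in>Z (Suc i). f i P \<noteq> 0)"
  shows "has_chain (zariski_proj a b d) (at_infinity_part a b d A) k"
proof (rule ccontr)
  assume "\<not> ?thesis"
  from exists_cutting_linear_forms[OF closedin_at_infinity_part this] obtain l where
    l: "\<And>i. i < k \<Longrightarrow> form d 1 (l i)"
      "\<forall>v\<in>proj_cone a b d. proj_point v \<in> at_infinity_part a b d A \<longrightarrow> (\<exists>i<k. l i v \<noteq> 0)" by blast
  from forms_spanned_by_few_monomials[OF A l] obtain K where
    K: "\<And>m. \<exists>T. finite T \<and> card T \<le> (m + 1) ^ k * K \<and>
      (\<forall>f. form d m f \<longrightarrow> (\<exists>h\<in>lspan T. \<forall>P\<in>A. f (P, 1) = h (P, 1 :: complex)))" by blast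
  have "\<forall>i. \<exists>N0. i \<le> k \<longrightarrow> (\<forall>N\<ge>N0. \<exists>g. form d N g \<and> (\<forall>P. degree P \<le> d \<longrightarrow> g (P, 1) = f i P))"
    using affine_regular_homogenize f by blast
  then obtain N0 where N0: "\<And>i N. i \<le> k \<Longrightarrow> N0 i \<le> N \<Longrightarrow>
      \<exists>g. form d N g \<and> (\<forall>P. degree P \<le> d \<longrightarrow> g (P, 1) = f i P)" by metis
  define N where "N = Max (N0 ` {..k})"
  have "N0 i \<le> N" if "i \<le> k" for i unfolding N_def by (rule Max_ge) (use that in auto)
  then have "\<forall>i. \<exists>g. i \<le> k \<longrightarrow> form d N g \<and> (\<forall>P. degree P \<le> d \<longrightarrow> g (P, 1) = f i P)"
    using N0 by blast
  then obtain g where g: "\<And>i. i \<le> k \<Longrightarrow> form d N (g i)"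
    "\<And>i P. i \<le> k \<Longrightarrow> degree P \<le> d \<Longrightarrow> g i (P, 1) = f i P" by metis
  \<comment> \<open>\<open>D\<close> is chosen for \<open>M + 1 \<le> D * (m + 1)\<close>. With this
    \<open>m\<close>, the bound \<open>(M + 1)^k * K\<close> becomes at most
    \<open>m * (m + 1)^k\<close>, which is less than the number \<open>(m + 1)^(k + 1)\<close> of
    monomials.\<close>
  define D where "D = N * Suc k + 1"
  define m where "m = D ^ k * K"
  define M where "M = N * Suc k * m"
  let ?E = "{..<Suc k} \<rightarrow>\<^sub>E {..m}"
  obtain T where T: "finite T" "card T \<le> (M + 1) ^ k * K"
    "\<And>f. form d M f \<Longrightarrow> \<exists>h\<in>lspan T. \<forall>P\<in>A. f (P, 1) = h (P, 1 :: complex)" using K[of M] by blast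
  have "card T < card ?E"
  proof -
    have "M + 1 \<le> D * (m + 1)" by (simp add: M_def D_def algebra_simps)
    then have "(M + 1) ^ k * K \<le> (D * (m + 1)) ^ k * K"
      by (intro mult_right_mono power_mono) auto
    also have "\<dots> = m * (m + 1) ^ k" unfolding power_mult_distrib by (simp only: m_def mult_ac)
    also have "\<dots> < (m + 1) * (m + 1) ^ k" by simp
    also have "\<dots> = card ?E" by (simp add: card_PiE)
    finally show ?thesis using T(2) by simp
  qed
  moreover have "\<exists>h\<in>lspan T. \<forall>v\<in>(\<lambda>P. (P, 1)) ` A. (\<Prod>i<Suc k. f i (fst v) ^ \<alpha> i) = h v"
    if \<alpha>: "\<alpha> \<in> ?E" for \<alpha>
  proof -
    define s where "s = (\<Sum>i<Suc k. \<alpha> i * N)"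
    have "s \<le> (\<Sum>i<Suc k. m * N)"
      unfolding s_def by (intro sum_mono mult_right_mono) (use \<alpha> in auto)
    then have s: "s \<le> M" by (simp add: M_def algebra_simps)
    \<comment> \<open>Padding with powers of \<open>snd\<close>, equal to 1 on \<open>A\<close>,
      brings all monomials to the common degree \<open>M\<close>.\<close>
    have "form d (s + (M - s) * 1) (\<lambda>v. (\<Prod>i<Suc k. g i v ^ \<alpha> i) * snd v ^ (M - s))"
      unfolding s_def by (intro form.mult form_prod form_power form.gen snd_in_gens g) auto
    then have "form d M (\<lambda>v. (\<Prod>i<Suc k. g i v ^ \<alpha> i) * snd v ^ (M - s))" using s by simp
    from T(3)[OF this] obtain h where h: "h \<in> lspan T"
      "\<forall>P\<in>A. (\<Prod>i<Suc k. g i (P, 1) ^ \<alpha> i) * snd (P, 1) ^ (M - s) = h (P, 1)" by blast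
    have "(\<Prod>i<Suc k. f i P ^ \<alpha> i) = h (P, 1)" if P: "P \<in> A" for P
    proof -
      have "degree P \<le> d" using A P by (auto simp: polys_vanishing_deg_def)
      then have "(\<Prod>i<Suc k. f i P ^ \<alpha> i) = (\<Prod>i<Suc k. g i (P, 1) ^ \<alpha> i)"
        by (intro prod.cong) (auto simp: g(2))
      then show ?thesis using h(2) P by simp
    qed
    with h(1) show ?thesis by auto
  qed
  ultimately obtain c where c: "\<exists>\<alpha>\<in>?E. c \<alpha> \<noteq> 0"
    "\<forall>v\<in>(\<lambda>P. (P, 1)) ` A. (\<Sum>\<alpha>\<in>?E. c \<alpha> * (\<Prod>i<Suc k. f i (fst v) ^ \<alpha> i)) = 0"
    using family_dependent[of T ?E "(\<lambda>P. (P, 1)) ` A" "\<lambda>\<alpha> v. \<Prod>i<Suc k. f i (fst v) ^ \<alpha> i"]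
      T(1) finite_PiE[of "{..<Suc k}" "\<lambda>_. {..m}"] by auto
  have rel: "(\<Sum>\<alpha>\<in>?E. c \<alpha> * (\<Prod>i<Suc k. f i P ^ \<alpha> i)) = 0" if "P \<in> Z (Suc k)" for P
    using c(2) Z(1)[of "Suc k"] that by auto
  have "c \<alpha> = 0" if "\<alpha> \<in> ?E" for \<alpha>
    by (rule chain_monomials_independent[where Z = Z and f = f and n = "Suc k" and m = m and c = c])
      (use that Z f rel in auto)
  then show False using c(1) by blast
qed

lemma irreducible_prime_on:
  assumes "irreducible_in (subtopology (zariski_affine a b d) A) Z" "A \<subseteq> polys_vanishing_deg a b d"
  shows "prime_on Z" "Z \<subseteq> A" "Z \<noteq> {}"
proof -
  let ?X = "zariski_affine a b d"
  show Z: "Z \<subseteq> A" "Z \<noteq> {}" using assms(1) unfolding irreducible_in_def by auto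
  show "prime_on Z"
    unfolding prime_on_def
  proof (intro ballI impI)
    fix f g assume fg: "f \<in> affine_regular" "g \<in> affine_regular" "\<forall>P\<in>Z. f P * g P = 0"
    define N where "N f = {P \<in> polys_vanishing_deg a b d. f P = 0}" for f :: "complex poly \<Rightarrow> complex"
    have N: "closedin (subtopology ?X A) (A \<inter> N h)" if "h \<in> affine_regular" for h
    proof (rule closedin_subtopology_Int_closed)
      show "closedin ?X (N h)"
        unfolding closedin_zariski_affine N_def using that by (intro exI[of _ "{h}"]) auto
    qed
    have "Z \<subseteq> (A \<inter> N f) \<union> (A \<inter> N g)"
      using fg(3) Z(1) assms(2) unfolding N_def by fastforce
    then have "Z \<subseteq> A \<inter> N f \<or> Z \<subseteq> A \<inter> N g"
      using assms(1) N[OF fg(1)] N[OF fg(2)] unfolding irreducible_in_def by blast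
    then show "(\<forall>P\<in>Z. f P = 0) \<or> (\<forall>P\<in>Z. g P = 0)" unfolding N_def by blast
  qed
qed

lemma krull_dim_ge: "- 1 \<le> krull_dim X"
  unfolding krull_dim_def by (rule Sup_upper) simp

text \<open>Chain members closed in \<open>X\<close> stay closed and irreducible in every subspace
  containing them. In the application \<open>Y\<close> involves the non-definite points, whose
  closedness is left open.\<close>

lemma has_chain_krull_dim:
  assumes "has_chain X B k" "B \<subseteq> Y"
  shows "ereal (real k) \<le> krull_dim (subtopology X Y)"
proof -
  obtain Z where Z: "\<And>i. i \<le> k \<Longrightarrow> closedin X (Z i) \<and> irreducible_in X (Z i) \<and> Z i \<subseteq> B"
    "\<And>i. i < k \<Longrightarrow> Z i \<subset> Z (Suc i)" using assms(1) unfolding has_chain_def by blast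
  have "closedin (subtopology X Y) (Z i) \<and> irreducible_in (subtopology X Y) (Z i)" if "i \<le> k" for i
  proof
    have sub: "Z i \<subseteq> Y" using Z(1)[OF that] assms(2) by blast
    then show cl: "closedin (subtopology X Y) (Z i)"
      using Z(1)[OF that] by (intro closedin_subset_topspace) auto
    show "irreducible_in (subtopology X Y) (Z i)"
      unfolding irreducible_in_def
    proof (intro conjI allI impI)
      show "Z i \<subseteq> topspace (subtopology X Y)" using closedin_subset[OF cl] .
      show "Z i \<noteq> {}" using Z(1)[OF that] unfolding irreducible_in_def by blast
      fix C D assume CD: "closedin (subtopology X Y) C \<and> closedin (subtopology X Y) D \<and> Z i \<subseteq> C \<union> D"
      then obtain C' D' where "closedin X C'" "C = C' \<inter> Y" "closedin X D'" "D = D' \<inter> Y"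
        unfolding closedin_subtopology by auto
      moreover from this have "Z i \<subseteq> C' \<or> Z i \<subseteq> D'"
        using CD Z(1)[OF that] unfolding irreducible_in_def by blast
      ultimately show "Z i \<subseteq> C \<or> Z i \<subseteq> D" using sub by blast
    qed
  qed
  then have "\<exists>Z :: nat \<Rightarrow> 'a set. (\<forall>i\<le>k. closedin (subtopology X Y) (Z i) \<and>
      irreducible_in (subtopology X Y) (Z i)) \<and> (\<forall>i<k. Z i \<subset> Z (Suc i))"
    using Z(2) by (intro exI[of _ Z]) blast
  then show ?thesis
    unfolding krull_dim_def by (intro Sup_upper) auto
qed

theorem krull_dim_le_at_infinity:
  assumes A: "A \<subseteq> polys_vanishing_deg a b d" and Y: "at_infinity_part a b d A \<subseteq> Y"
  shows "krull_dim (subtopology (zariski_affine a b d) A)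
    \<le> krull_dim (subtopology (zariski_proj a b d) Y) + 1"
proof -
  let ?X = "subtopology (zariski_affine a b d) A" and ?D = "krull_dim (subtopology (zariski_proj a b d) Y)"
  have D: "0 \<le> ?D + 1"
    using krull_dim_ge[of "subtopology (zariski_proj a b d) Y"]
    by (cases ?D) (auto simp: one_ereal_def)
  have chain: "ereal (real n) \<le> ?D + 1"
    if Z: "\<forall>i\<le>n. closedin ?X (Z i) \<and> irreducible_in ?X (Z i)" "\<forall>i<n. Z i \<subset> Z (Suc i)" for n Z
  proof (cases n)
    case 0
    \<comment> \<open>A chain of length 0 promises no point at infinity; the bound holds because
      every dimension is at least -1.\<close>
    then show ?thesis using D by (simp add: zero_ereal_def)
  next
    case (Suc k)
    have prime: "prime_on (Z i) \<and> Z i \<subseteq> A" "Z i \<noteq> {}" if "i \<le> Suc k" for i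
      using irreducible_prime_on[OF _ A, of "Z i"] Z(1) that Suc by auto
    have "\<exists>f. i \<le> k \<longrightarrow> Z i \<subseteq> Z (Suc i) \<and> f \<in> affine_regular \<and>
        (\<forall>P\<in>Z i. f P = 0) \<and> (\<exists>P\<in>Z (Suc i). f P \<noteq> 0)" for i
    proof (cases "i \<le> k")
      case True
      then have sub: "Z i \<subset> Z (Suc i)" and "closedin ?X (Z i)" using Z Suc by auto
      then obtain C where C: "closedin (zariski_affine a b d) C" "Z i = C \<inter> A"
        unfolding closedin_subtopology by blast
      then obtain F where F: "F \<subseteq> affine_regular" "C = {P \<in> polys_vanishing_deg a b d. \<forall>f\<in>F. f P = 0}"
        unfolding closedin_zariski_affine by blast
      obtain P where P: "P \<in> Z (Suc i)" "P \<notin> Z i" using sub by blast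
      then have "P \<in> A" using prime[of "Suc i"] True by auto
      then obtain f where "f \<in> F" "f P \<noteq> 0" using P(2) C(2) F(2) A by blast
      then show ?thesis using sub P(1) C(2) F by (intro exI[of _ f]) auto
    qed simp
    then obtain f where "\<And>i. i \<le> k \<Longrightarrow> Z i \<subseteq> Z (Suc i) \<and> f i \<in> affine_regular \<and>
        (\<forall>P\<in>Z i. f i P = 0) \<and> (\<exists>P\<in>Z (Suc i). f i P \<noteq> 0)" by metis
    from chain_at_infinity[OF A prime(1) prime(2)[of 0] this]
    have "has_chain (zariski_proj a b d) (at_infinity_part a b d A) k" by simp
    from add_right_mono[OF has_chain_krull_dim[OF this Y], of 1]
    show ?thesis unfolding Suc by (simp add: one_ereal_def add.commute)
  qed
  show ?thesis
    unfolding krull_dim_def[of ?X]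
  proof (rule Sup_least)
    fix z assume "z \<in> insert (- 1) {ereal (real n) | n. \<exists>Z :: nat \<Rightarrow> complex poly set.
      (\<forall>i\<le>n. closedin ?X (Z i) \<and> irreducible_in ?X (Z i)) \<and> (\<forall>i<n. Z i \<subset> Z (Suc i))}"
    then consider "z = - 1" | n Z where "z = ereal (real n)"
      "\<forall>i\<le>n. closedin ?X (Z i) \<and> irreducible_in ?X (Z i)" "\<forall>i<n. Z i \<subset> Z (Suc i)" by blast
    then show "z \<le> ?D + 1"
    proof cases
      case 1
      have "(- 1 :: ereal) \<le> 0" by simp
      then show ?thesis unfolding 1 using D by (rule order_trans)
    qed (use chain in simp)
  qed
qed

section \<open>Primitives and integrals of polynomials\<close>

definition prim :: "complex \<Rightarrow> complex poly \<Rightarrow> complex poly" where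
  "prim a f = (let F = \<Sum>i\<le>degree f. monom (coeff f i / of_nat (Suc i)) (Suc i) in F - [:poly F a:])"

text \<open>The integral from \<open>a\<close> to \<open>b\<close> by way of a polynomial primitive,
  so that linearity and integration by parts become algebra; \<open>contour_integral_poly\<close> is
  the link with path integrals.\<close>

definition pint :: "complex \<Rightarrow> complex \<Rightarrow> complex poly \<Rightarrow> complex" where
  "pint a b f = poly (prim a f) b"

lemma pderiv_prim [simp]: "pderiv (prim a f) = f"
proof (rule poly_eqI)
  fix n
  have "coeff (pderiv (\<Sum>i\<le>degree f. monom (coeff f i / of_nat (Suc i)) (Suc i))) n =
      of_nat (Suc n) * (\<Sum>i\<le>degree f. if i = n then coeff f i / of_nat (Suc i) else 0)"
    by (simp add: coeff_pderiv coeff_sum)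
  also have "\<dots> = coeff f n"
    using le_degree[of f n] by (cases "coeff f n = 0") (simp_all del: of_nat_Suc)
  finally show "coeff (pderiv (prim a f)) n = coeff f n"
    by (simp add: prim_def Let_def pderiv_diff pderiv_pCons)
qed

lemma poly_prim_base [simp]: "poly (prim a f) a = 0"
  by (simp add: prim_def Let_def)

lemma poly_eq_of_pderiv:
  fixes F G :: "complex poly"
  assumes "pderiv F = pderiv G" "poly F a = poly G a" shows "F = G"
proof -
  have "pderiv (F - G) = 0" using assms(1) by (simp add: pderiv_diff)
  then obtain c where "F - G = [:c:]" by (metis pderiv_iszero)
  moreover from this have "c = 0" using assms(2) by (metis diff_self poly_const_conv poly_diff)
  ultimately show ?thesis by simp
qed

lemma prim_eqI: "pderiv F = f \<Longrightarrow> poly F a = 0 \<Longrightarrow> prim a f = F"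
  by (rule poly_eq_of_pderiv[of _ _ a]) simp_all

lemma prim_add: "prim a (f + g) = prim a f + prim a g"
  by (rule prim_eqI) (simp_all add: pderiv_add)

lemma prim_smult: "prim a (smult c f) = smult c (prim a f)"
  by (rule prim_eqI) (simp_all add: pderiv_smult)

lemma pint_add: "pint a b (f + g) = pint a b f + pint a b g"
  by (simp add: pint_def prim_add)

lemma pint_smult: "pint a b (smult c f) = c * pint a b f"
  by (simp add: pint_def prim_smult)

lemma pint_0 [simp]: "pint a b 0 = 0"
  using pint_smult[of a b 0 0] by simp

lemma pint_sum: "pint a b (\<Sum>i\<in>I. f i) = (\<Sum>i\<in>I. pint a b (f i))"
  by (induction I rule: infinite_finite_induct) (simp_all add: pint_add)

lemma pint_pderiv: "pint a b (pderiv F) = poly F b - poly F a"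
proof -
  have "prim a (pderiv F) = F - [:poly F a:]"
    by (rule prim_eqI) (simp_all add: pderiv_diff pderiv_pCons)
  then show ?thesis by (simp add: pint_def)
qed

lemma contour_integral_poly: "contour_integral (linepath a b) (poly f) = pint a b f"
proof -
  have "(poly f has_contour_integral (poly (prim a f) (pathfinish (linepath a b)) -
      poly (prim a f) (pathstart (linepath a b)))) (linepath a b)"
  proof (rule contour_integral_primitive[of UNIV])
    fix x
    show "(poly (prim a f) has_field_derivative poly f x) (at x within UNIV)"
      using poly_DERIV[of "prim a f" x] by simp
  qed auto
  then show ?thesis by (simp add: pint_def contour_integral_unique)
qed

lemma moments_vanish_iff: "moments_vanish a b P Q \<longleftrightarrow> (\<forall>k. pint a b (P ^ k * pderiv Q) = 0)"
proof -
  have "contour_integral (linepath a b) (\<lambda>x. poly P x ^ k * poly (pderiv Q) x) =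
      pint a b (P ^ k * pderiv Q)" for k
    using contour_integral_poly[of a b "P ^ k * pderiv Q"] by (simp add: poly_mult[abs_def] poly_power[abs_def])
  then show ?thesis by (simp add: moments_vanish_def)
qed

section \<open>Polynomials in a right factor\<close>

definition comp_alg :: "complex poly \<Rightarrow> complex poly set" where
  "comp_alg W = range (\<lambda>p. pcompose p W)"

lemma comp_algI: "f = pcompose p W \<Longrightarrow> f \<in> comp_alg W"
  by (simp add: comp_alg_def)

lemma comp_algE: "f \<in> comp_alg W \<Longrightarrow> (\<And>p. f = pcompose p W \<Longrightarrow> thesis) \<Longrightarrow> thesis"
  by (auto simp: comp_alg_def)

lemma comp_alg_const: "[:c:] \<in> comp_alg W"
  by (rule comp_algI[of _ "[:c:]"]) simp

lemma comp_alg_0: "0 \<in> comp_alg W"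
  using comp_alg_const[of 0] by simp

lemma comp_alg_add: "f \<in> comp_alg W \<Longrightarrow> g \<in> comp_alg W \<Longrightarrow> f + g \<in> comp_alg W"
  by (auto elim!: comp_algE intro: comp_algI simp flip: pcompose_add)

lemma comp_alg_smult: "f \<in> comp_alg W \<Longrightarrow> smult c f \<in> comp_alg W"
  by (auto elim!: comp_algE intro: comp_algI simp flip: pcompose_smult)

lemma comp_alg_mult: "f \<in> comp_alg W \<Longrightarrow> g \<in> comp_alg W \<Longrightarrow> f * g \<in> comp_alg W"
  by (auto elim!: comp_algE intro: comp_algI simp flip: pcompose_mult)

lemma comp_alg_diff:
  assumes "f \<in> comp_alg W" "g \<in> comp_alg W" shows "f - g \<in> comp_alg W"
  using comp_alg_add[OF assms(1) comp_alg_smult[OF assms(2), of "-1"]] by simp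

lemma comp_alg_poly_eq: "f \<in> comp_alg W \<Longrightarrow> poly W a = poly W b \<Longrightarrow> poly f a = poly f b"
  by (auto elim!: comp_algE simp: poly_pcompose)

lemma comp_alg_pderivE:
  assumes "f \<in> comp_alg W"
  obtains g where "g \<in> comp_alg W" "pderiv f = g * pderiv W"
proof -
  obtain p where "f = pcompose p W" using assms by (rule comp_algE)
  then have "pderiv f = pcompose (pderiv p) W * pderiv W" by (simp add: pderiv_pcompose)
  then show ?thesis using that comp_algI[OF refl] by blast
qed

text \<open>Substitution: a primitive of \<open>p(W) W'\<close> is a primitive of \<open>p\<close>,
  based at \<open>W(a)\<close>, composed with \<open>W\<close>.\<close>

lemma comp_alg_prim:
  assumes "f \<in> comp_alg W" shows "prim a (f * pderiv W) \<in> comp_alg W"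
proof -
  obtain p where p: "f = pcompose p W" using assms by (rule comp_algE)
  have "prim a (f * pderiv W) = pcompose (prim (poly W a) p) W"
    by (rule prim_eqI) (simp_all add: pderiv_pcompose p poly_pcompose)
  then show ?thesis by (rule comp_algI)
qed

lemma comp_alg_affine:
  assumes "W' = smult \<alpha> W + [:\<beta>:]" shows "comp_alg W' \<subseteq> comp_alg W"
proof
  fix f assume "f \<in> comp_alg W'"
  then obtain p where "f = pcompose p W'" by (rule comp_algE)
  moreover have "W' = pcompose [:\<beta>, \<alpha>:] W"
    unfolding assms by (simp add: pcompose_pCons)
  ultimately have "f = pcompose (pcompose p [:\<beta>, \<alpha>:]) W" by (simp add: pcompose_assoc)
  then show "f \<in> comp_alg W" by (rule comp_algI)
qed

section \<open>Uniqueness of right factors of a given degree\<close>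

lemma degree_pcompose_tail:
  fixes A U :: "complex poly"
  assumes "degree A = k" "k > 0"
  shows "degree (pcompose A U - smult (lead_coeff A) (U ^ k)) \<le> (k - 1) * degree U"
proof -
  define B where "B = A - monom (lead_coeff A) k"
  have "coeff B i = 0" if "i > k - 1" for i
    using that assms coeff_eq_0[of A i] by (cases "i = k") (auto simp: B_def)
  then have "degree B \<le> k - 1" by (intro degree_le) auto
  moreover have monom: "pcompose (monom c n) U = smult c (U ^ n)" for c n
    by (induction n) (simp_all add: monom_0 monom_Suc pcompose_pCons)
  have "pcompose A U - smult (lead_coeff A) (U ^ k) = pcompose B U"
    unfolding B_def pcompose_diff monom ..
  ultimately show ?thesis
    using degree_pcompose_le[of B U] by (simp add: order_trans mult_le_mono1)
qed

text \<open>With equal leading coefficients, \<open>U^k - V^k\<close> has the cofactor \<open>\<Sum>i<k. U^i V^(k-1-i)\<close>,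
  which already has degree \<open>(k - 1) deg U\<close>.\<close>

lemma power_diff_degree:
  fixes U V :: "complex poly"
  assumes "degree U = w" "degree V = w" "lead_coeff U = lead_coeff V" "U \<noteq> 0" "k > 0"
    and "degree (U ^ k - V ^ k) \<le> (k - 1) * w"
  shows "degree (U - V) = 0"
proof (rule ccontr)
  assume nz: "degree (U - V) \<noteq> 0"
  obtain n where n: "k = Suc n" using assms(5) by (cases k) auto
  define H where "H = (\<Sum>p<Suc n. U ^ p * V ^ (n - p))"
  have V: "V \<noteq> 0" using assms(3,4) by auto
  have "coeff (U ^ p * V ^ (n - p)) (n * w) = lead_coeff U ^ n" if "p < Suc n" for p
  proof -
    have "degree (U ^ p * V ^ (n - p)) = p * w + (n - p) * w"
      using assms(1,2,4) V by (simp add: degree_mult_eq degree_power_eq)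
    also have "\<dots> = n * w" using that by (simp flip: add_mult_distrib)
    finally have "coeff (U ^ p * V ^ (n - p)) (n * w) = lead_coeff (U ^ p * V ^ (n - p))" by simp
    also have "\<dots> = lead_coeff U ^ n"
      using that assms(3) by (simp add: lead_coeff_mult lead_coeff_power flip: power_add)
    finally show ?thesis .
  qed
  then have "coeff H (n * w) = of_nat (Suc n) * lead_coeff U ^ n"
    by (simp add: H_def coeff_sum del: sum.lessThan_Suc)
  then have "coeff H (n * w) \<noteq> 0" using assms(4) by (simp del: of_nat_Suc)
  then have H: "H \<noteq> 0" "n * w \<le> degree H" by (auto intro: le_degree)
  have "U ^ k - V ^ k = (U - V) * H"
    unfolding n H_def by (rule diff_power_eq_sum)
  moreover have "U - V \<noteq> 0" using nz by auto
  ultimately have "degree (U ^ k - V ^ k) = degree (U - V) + degree H"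
    using H(1) by (simp add: degree_mult_eq)
  then show False using assms(6) nz H(2) n by simp
qed

text \<open>After \<open>W\<close> is rescaled to the leading coefficient of \<open>W'\<close>, the
  two outer polynomials have equal degree \<open>k\<close> and equal leading coefficient. The
  \<open>k\<close>-th powers of the right factors then differ in degree at most
  \<open>(k - 1) * w\<close> only, which forces the factors to differ by a constant.\<close>

lemma right_factor_unique:
  assumes S: "S \<in> comp_alg W" "S \<in> comp_alg W'" and deg: "degree W = degree W'" "degree S > 0"
  shows "comp_alg W' \<subseteq> comp_alg W"
proof -
  obtain A where A: "S = pcompose A W" using S(1) by (rule comp_algE)
  obtain B where B: "S = pcompose B W'" using S(2) by (rule comp_algE)
  have degA: "degree S = degree A * degree W" and degB: "degree S = degree B * degree W'"
    using arg_cong[OF A, of degree] arg_cong[OF B, of degree] by (simp_all add: degree_pcompose)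
  define w where "w = degree W"
  have w: "w > 0" using degA deg(2) by (auto simp: w_def intro: gr0I)
  define k where "k = degree A"
  have k: "k > 0" "degree B = k" using degA degB deg w by (auto simp: k_def w_def intro: gr0I)
  define \<alpha> where "\<alpha> = lead_coeff W' / lead_coeff W"
  have "W \<noteq> 0" "W' \<noteq> 0" using w deg(1) by (auto simp: w_def)
  then have \<alpha>: "\<alpha> \<noteq> 0" by (simp add: \<alpha>_def)
  define U where "U = smult \<alpha> W"
  define A' where "A' = pcompose A [:0, 1 / \<alpha>:]"
  have U: "degree U = w" "lead_coeff U = lead_coeff W'" "U \<noteq> 0"
    using \<alpha> w by (auto simp: U_def w_def \<alpha>_def)
  have "pcompose [:0, 1 / \<alpha>:] U = W" using \<alpha> by (simp add: U_def pcompose_pCons)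
  then have A': "S = pcompose A' U" by (simp add: A'_def A flip: pcompose_assoc)
  have degA': "degree A' = k" using \<alpha> by (simp add: A'_def k_def degree_pcompose)
  have "lead_coeff S = lead_coeff A' * lead_coeff U ^ k" "lead_coeff S = lead_coeff B * lead_coeff W' ^ k"
    using lead_coeff_comp[of U A'] lead_coeff_comp[of W' B] U w deg(1) k(2) degA' A' B
    by (simp_all add: w_def)
  moreover have "lead_coeff W' \<noteq> 0" using U by auto
  ultimately have lc: "lead_coeff A' = lead_coeff B" using U(2) by simp
  have "B \<noteq> 0" using k by auto
  then have lc0: "lead_coeff B \<noteq> 0" by simp
  have "smult (lead_coeff B) (U ^ k - W' ^ k) =
      (pcompose B W' - smult (lead_coeff B) (W' ^ k)) - (pcompose A' U - smult (lead_coeff A') (U ^ k))"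
    using A' B lc by (simp add: smult_diff_right)
  also have "degree \<dots> \<le> (k - 1) * w"
    using degree_pcompose_tail[OF k(2,1), of W'] degree_pcompose_tail[OF degA' k(1), of U] U(1) deg(1)
    by - (rule degree_diff_le, simp_all add: w_def)
  finally have le: "degree (U ^ k - W' ^ k) \<le> (k - 1) * w" using lc0 by simp
  have "degree W' = w" using deg(1) by (simp add: w_def)
  then have "degree (U - W') = 0" by (rule power_diff_degree[OF U(1) _ U(2,3) k(1) le])
  then obtain \<beta> where "U - W' = [:\<beta>:]" by (rule degree_eq_zeroE)
  then have "W' = smult \<alpha> W + [:-\<beta>:]"
    by (simp add: U_def diff_eq_eq eq_diff_eq flip: minus_pCons)
  then show ?thesis by (rule comp_alg_affine)
qed

lemma composition_condition_comp_alg: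
  "composition_condition a b P Q \<longleftrightarrow>
     (\<exists>W. poly W a = poly W b \<and> P \<in> comp_alg W \<and> Q \<in> comp_alg W)"
  unfolding composition_condition_def comp_alg_def by blast

text \<open>The polynomials whose moments against a definite \<open>S\<close> vanish form a vector space covered by
  the finitely many algebras of the right factors of \<open>S\<close>, hence lie in one of them.\<close>

lemma definite_poly_common_factor:
  assumes def: "definite_poly a b S" and S0: "S \<noteq> 0"
  obtains W where "poly W a = poly W b" "S \<in> comp_alg W"
    "\<And>Q. Q \<in> polys_vanishing a b \<Longrightarrow> moments_vanish a b S Q \<Longrightarrow> Q \<in> comp_alg W"
proof -
  define V where "V = {Q \<in> polys_vanishing a b. moments_vanish a b S Q}"
  have S: "poly S a = 0" using def by (simp add: definite_poly_def polys_vanishing_def)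
  have degS: "degree S > 0"
  proof (rule ccontr)
    assume "\<not> degree S > 0"
    then obtain c where "S = [:c:]" using degree_eq_zeroE by auto
    then show False using S S0 by simp
  qed
  have V_lin: "Q + smult c R \<in> V" if "Q \<in> V" "R \<in> V" for Q R c
    using that
    by (simp add: V_def polys_vanishing_def moments_vanish_iff pderiv_add pderiv_smult
        distrib_left pint_add pint_smult)
  have V_comp: "\<exists>W. poly W a = poly W b \<and> S \<in> comp_alg W \<and> Q \<in> comp_alg W" if "Q \<in> V" for Q
    using that def by (simp add: V_def definite_poly_def composition_condition_comp_alg)
  define good where "good w W \<longleftrightarrow> degree W = w \<and> poly W a = poly W b \<and> S \<in> comp_alg W" for w W
  \<comment> \<open>Indexing by degree suffices: right factors of \<open>S\<close> of the same
    degree generate the same algebra, so one representative per degree gives a finite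
    family.\<close>
  define D where "D = {w. w \<le> degree S \<and> (\<exists>W. good w W)}"
  have "\<forall>w\<in>D. \<exists>W. good w W" by (simp add: D_def)
  then obtain F where F: "\<And>w. w \<in> D \<Longrightarrow> good w (F w)" by metis
  have finD: "finite D" by (rule finite_subset[of _ "{..degree S}"]) (auto simp: D_def)
  define \<W> where "\<W> Q = {w \<in> D. Q \<in> comp_alg (F w)}" for Q
  have fin: "finite (\<W> Q)" for Q using finD by (simp add: \<W>_def)
  have nonempty: "\<W> Q \<noteq> {}" if Q: "Q \<in> V" for Q
  proof -
    obtain W where W: "poly W a = poly W b" "S \<in> comp_alg W" "Q \<in> comp_alg W"
      using V_comp[OF Q] by blast
    obtain p where p: "S = pcompose p W" using W(2) by (rule comp_algE)
    then have "degree S = degree p * degree W" by (simp add: degree_pcompose)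
    moreover from this have "degree p \<noteq> 0" using degS by auto
    ultimately have "degree W \<le> degree S" by simp
    then have D: "degree W \<in> D" using W unfolding D_def good_def by blast
    then have "good (degree W) (F (degree W))" by (rule F)
    then have "comp_alg W \<subseteq> comp_alg (F (degree W))"
      using right_factor_unique[of S "F (degree W)" W] W(2) degS by (simp add: good_def)
    then show ?thesis using D W(3) unfolding \<W>_def by blast
  qed
  have "0 \<in> V" by (simp add: V_def polys_vanishing_def moments_vanish_iff)
  \<comment> \<open>\<open>R\<close> lies in as few of the algebras as possible. For all but
    finitely many \<open>c\<close>, \<open>Q + smult c R\<close> enters no algebra that misses
    \<open>R\<close>; by minimality it lies in all those containing \<open>R\<close>, and then so
    does \<open>Q\<close>.\<close>
  then obtain R where R: "R \<in> V" "\<And>Q. Q \<in> V \<Longrightarrow> card (\<W> R) \<le> card (\<W> Q)"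
    using ex_has_least_nat[of "\<lambda>Q. Q \<in> V" 0 "\<lambda>Q. card (\<W> Q)"] by blast
  obtain w where w: "w \<in> \<W> R" using nonempty[OF R(1)] by blast
  have "Q \<in> comp_alg (F w)" if Q: "Q \<in> V" for Q
  proof -
    define bad where "bad u = {c. Q + smult c R \<in> comp_alg (F u)}" for u
    have "finite (bad u)" if "u \<in> D - \<W> R" for u
    proof -
      have "c = c'" if "c \<in> bad u" "c' \<in> bad u" for c c'
      proof (rule ccontr)
        assume "c \<noteq> c'"
        have "(Q + smult c R) - (Q + smult c' R) \<in> comp_alg (F u)"
          using that unfolding bad_def by (intro comp_alg_diff) auto
        then have "smult (c - c') R \<in> comp_alg (F u)" by (simp add: smult_diff_left)
        from comp_alg_smult[OF this, of "1 / (c - c')"] have "R \<in> comp_alg (F u)"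
          using \<open>c \<noteq> c'\<close> by simp
        then show False using \<open>u \<in> D - \<W> R\<close> by (simp add: \<W>_def)
      qed
      then have "\<exists>c. bad u \<subseteq> {c}" by (cases "bad u = {}") (auto, blast)
      then show ?thesis using finite_subset by blast
    qed
    then have "finite (\<Union>u\<in>D - \<W> R. bad u)" using finD by blast
    then obtain c where c: "c \<notin> (\<Union>u\<in>D - \<W> R. bad u)"
      using ex_new_if_finite[OF infinite_UNIV_char_0] by blast
    then have "\<W> (Q + smult c R) \<subseteq> \<W> R" unfolding \<W>_def bad_def by blast
    then have "\<W> (Q + smult c R) = \<W> R"
      using R(2)[OF V_lin[OF Q R(1)]] fin by (intro card_seteq) auto
    then have "Q + smult c R \<in> comp_alg (F w)" "R \<in> comp_alg (F w)"
      using w unfolding \<W>_def by auto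
    then have "Q + smult c R - smult c R \<in> comp_alg (F w)"
      by (intro comp_alg_diff comp_alg_smult)
    then show ?thesis by simp
  qed
  moreover have "good w (F w)" using w F unfolding \<W>_def by blast
  ultimately show ?thesis
    using that[of "F w"] unfolding good_def V_def by blast
qed

text \<open>Divide \<open>t\<close> by \<open>q\<close>: composed with \<open>W\<close>, the
  remainder is a multiple of \<open>q(W)\<close> of smaller degree, hence 0, and \<open>R\<close> is
  the composed quotient.\<close>

lemma comp_alg_quotient:
  assumes "R * pcompose q W = pcompose t W" "q \<noteq> 0" "degree W > 0"
  shows "R \<in> comp_alg W"
proof -
  have "t = (t div q) * q + t mod q" by simp
  then have "pcompose (t mod q) W = pcompose t W - pcompose (t div q) W * pcompose q W"
    by (metis add_diff_cancel_left' pcompose_add pcompose_mult)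
  also have "\<dots> = (R - pcompose (t div q) W) * pcompose q W"
    by (simp add: assms(1)[symmetric] algebra_simps)
  finally have eq: "pcompose (t mod q) W = (R - pcompose (t div q) W) * pcompose q W" .
  have q: "pcompose q W \<noteq> 0" using assms(2,3) by (simp add: pcompose_eq_0_iff)
  have "R - pcompose (t div q) W = 0"
  proof (rule ccontr)
    assume nz: "R - pcompose (t div q) W \<noteq> 0"
    then have "t mod q \<noteq> 0" using eq q by auto
    then have "degree (t mod q) < degree q" using degree_mod_less[OF assms(2), of t] by simp
    then have "degree (pcompose (t mod q) W) < degree (pcompose q W)"
      using assms(3) by (simp add: degree_pcompose)
    also have "\<dots> \<le> degree (pcompose (t mod q) W)"
      unfolding eq using nz q by (simp add: degree_mult_eq)
    finally show False by simp
  qed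
  then show ?thesis by (intro comp_algI[of _ "t div q"]) simp
qed

text \<open>Apply the hypothesis on \<open>S\<close> to a primitive \<open>T\<close> of \<open>R Q'\<close>: then \<open>R = T' / Q'\<close>.\<close>

lemma tangent_direction_in_comp_alg:
  assumes "Q \<in> comp_alg W" "degree Q > 0"
    and definite: "\<And>T. T \<in> polys_vanishing a b \<Longrightarrow> moments_vanish a b S T \<Longrightarrow> T \<in> comp_alg W"
    and moments: "\<And>k. pint a b (S ^ k * (R * pderiv Q)) = 0"
  shows "R \<in> comp_alg W"
proof -
  define T where "T = prim a (R * pderiv Q)"
  have "poly T b = 0" using moments[of 0] by (simp add: T_def pint_def)
  then have "T \<in> comp_alg W"
    using moments by (intro definite) (simp_all add: T_def polys_vanishing_def moments_vanish_iff)
  then obtain t q where t: "T = pcompose t W" and q: "Q = pcompose q W"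
    using assms(1) by (auto elim!: comp_algE)
  have "degree W > 0" "degree q > 0" using assms(2) by (auto simp: q degree_pcompose intro: gr0I)
  then have "pderiv q \<noteq> 0" "pderiv W \<noteq> 0" by (auto simp: pderiv_eq_0_iff)
  have "pderiv T = R * pderiv Q" by (simp add: T_def)
  then have "R * pcompose (pderiv q) W * pderiv W = pcompose (pderiv t) W * pderiv W"
    unfolding t q pderiv_pcompose by (simp only: mult.assoc)
  then have "R * pcompose (pderiv q) W = pcompose (pderiv t) W"
    using \<open>pderiv W \<noteq> 0\<close> by simp
  then show ?thesis
    using \<open>pderiv q \<noteq> 0\<close> \<open>degree W > 0\<close> by (rule comp_alg_quotient)
qed

section \<open>Solutions of the Abel equation with small initial value\<close>

lemma poly_bounded_on_compact:
  fixes f :: "complex poly"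
  assumes "compact S" shows "\<exists>B\<ge>0. \<forall>x\<in>S. cmod (poly f x) \<le> B"
proof -
  have "bounded (poly f ` S)"
    using assms by (intro compact_imp_bounded compact_continuous_image) (auto intro: continuous_intros)
  then obtain B where "\<forall>x\<in>S. cmod (poly f x) \<le> B" by (auto simp: bounded_iff)
  then show ?thesis by (intro exI[of _ "max B 0"]) auto
qed

lemma prim_bound:
  assumes "x \<in> ball a \<rho>" "\<And>z. z \<in> ball a \<rho> \<Longrightarrow> cmod (poly f z) \<le> B"
  shows "cmod (poly (prim a f) x) \<le> B * \<rho>"
proof -
  have "0 < \<rho>" using assms(1) by (metis mem_ball zero_le_dist le_less_trans)
  then have "a \<in> ball a \<rho>" by simp
  then have B: "0 \<le> B" by (rule order_trans[OF norm_ge_zero assms(2)])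
  have "cmod (poly (prim a f) x - poly (prim a f) a) \<le> B * cmod (x - a)"
  proof (rule field_differentiable_bound[of "ball a \<rho>" _ "poly f"])
    fix z
    show "(poly (prim a f) has_field_derivative poly f z) (at z within ball a \<rho>)"
      using poly_DERIV[of "prim a f" z] by (auto intro: has_field_derivative_at_within)
  qed (use assms \<open>0 < \<rho>\<close> in auto)
  also have "\<dots> \<le> B * \<rho>"
    using assms(1) B by (intro mult_left_mono) (auto simp: dist_norm norm_minus_commute)
  finally show ?thesis by simp
qed

text \<open>Picard iteration for the initial value \<open>c\<close> at \<open>a\<close>; polynomial
  data keep every iterate a polynomial, so its integrals are given by \<open>prim\<close>.\<close>

fun picard :: "complex \<Rightarrow> complex poly \<Rightarrow> complex poly \<Rightarrow> complex \<Rightarrow> nat \<Rightarrow> complex poly" where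
  "picard a p q c 0 = [:c:]"
| "picard a p q c (Suc n) =
     [:c:] + prim a (p * picard a p q c n ^ 3 + q * picard a p q c n ^ 2)"

text \<open>\<open>has_center\<close> speaks only about solutions that are given; here they are
  produced around the whole segment. For nonzero \<open>c\<close>, the bound by half of
  \<open>cmod c\<close> keeps them away from 0 and comparable to \<open>c\<close>, as an expansion
  starting with \<open>y^-2\<close> requires.\<close>

lemma abel_solution_exists:
  "\<exists>\<delta>>0. \<forall>c. cmod c < \<delta> \<longrightarrow> (\<exists>U y. open U \<and> closed_segment a b \<subseteq> U \<and> abel_solution_on p q U y \<and>
     y a = c \<and> (\<forall>x\<in>U. cmod (y x - c) \<le> cmod c / 2))"
proof -
  define \<rho> where "\<rho> = dist a b + 1"
  have \<rho>: "\<rho> > 0" unfolding \<rho>_def by (smt (verit) zero_le_dist)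
  let ?U = "ball a \<rho>"
  have seg: "closed_segment a b \<subseteq> ?U"
    by (rule closed_segment_subset) (use \<rho> in \<open>auto simp: \<rho>_def\<close>)
  obtain Kp Kq where "\<forall>x\<in>cball a \<rho>. cmod (poly p x) \<le> Kp" "\<forall>x\<in>cball a \<rho>. cmod (poly q x) \<le> Kq"
    using poly_bounded_on_compact[OF compact_cball] by metis
  then obtain K where K: "K > 0" "\<And>x. x \<in> ?U \<Longrightarrow> cmod (poly p x) \<le> K"
    "\<And>x. x \<in> ?U \<Longrightarrow> cmod (poly q x) \<le> K"
    by (atomize_elim, intro exI[of _ "max 1 (max Kp Kq)"]) (auto simp: le_max_iff_disj)
  \<comment> \<open>With \<open>e = cmod c\<close> and iterates bounded by
    \<open>2 * e \<le> 2\<close>, the right-hand side is at most \<open>12 * K * e^2\<close>, where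
    12 = 8 + 4, and has Lipschitz constant \<open>16 * K * e\<close>, where 16 = 12 + 4. This radius
    makes \<open>12 * K * \<rho> * e\<close> and \<open>16 * K * \<rho> * e\<close> at most
    1/2.\<close>
  define \<delta> where "\<delta> = min 1 (1 / (48 * K * \<rho>))"
  have "\<delta> > 0" using K(1) \<rho> by (simp add: \<delta>_def)
  moreover have "\<exists>U y. open U \<and> closed_segment a b \<subseteq> U \<and> abel_solution_on p q U y \<and>
      y a = c \<and> (\<forall>x\<in>U. cmod (y x - c) \<le> cmod c / 2)" if "cmod c < \<delta>" for c
  proof -
    define e where "e = cmod c"
    have e: "0 \<le> e" "e \<le> 1" "48 * K * \<rho> * e \<le> 1"
    proof -
      have "e < 1" "e < 1 / (48 * K * \<rho>)" using that by (simp_all add: e_def \<delta>_def)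
      then show "0 \<le> e" "e \<le> 1" "48 * K * \<rho> * e \<le> 1"
        using K(1) \<rho> by (simp_all add: e_def field_simps)
    qed
    define Y where "Y = picard a p q c"
    have Y_Suc: "Y (Suc n) = [:c:] + prim a (p * Y n ^ 3 + q * Y n ^ 2)" for n by (simp add: Y_def)
    have rhs: "cmod (u * y ^ 3 + v * y ^ 2) \<le> 12 * K * e\<^sup>2"
      if "cmod u \<le> K" "cmod v \<le> K" "cmod y \<le> 2 * e" for u v y
    proof -
      have y3: "cmod y ^ 3 \<le> 8 * e\<^sup>2"
      proof -
        have "cmod y ^ 3 \<le> (2 * e) ^ 3" using that(3) by (intro power_mono) auto
        also have "\<dots> = 8 * e\<^sup>2 * e" by (simp add: power3_eq_cube power2_eq_square)
        also have "\<dots> \<le> 8 * e\<^sup>2 * 1" using e by (intro mult_left_mono) auto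
        finally show ?thesis by simp
      qed
      have y2: "cmod y ^ 2 \<le> 4 * e\<^sup>2"
        using power_mono[OF that(3), of 2] by (simp add: power_mult_distrib)
      have "cmod (u * y ^ 3 + v * y ^ 2) \<le> cmod u * cmod y ^ 3 + cmod v * cmod y ^ 2"
        by (metis norm_mult norm_power norm_triangle_ineq)
      also have "\<dots> \<le> K * (8 * e\<^sup>2) + K * (4 * e\<^sup>2)"
        using that y3 y2 K(1) by (intro add_mono mult_mono) auto
      finally show ?thesis by simp
    qed
    have le_2e: "cmod z \<le> 2 * e" if "cmod (z - c) \<le> e / 2" for z
    proof -
      have "cmod z \<le> cmod (z - c) + e"
        using norm_triangle_ineq[of "z - c" c] by (simp add: e_def)
      then show ?thesis using that e(1) by linarith
    qed
    have near: "x \<in> ?U \<Longrightarrow> cmod (poly (Y n) x - c) \<le> e / 2" for n x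
    proof (induction n arbitrary: x)
      case 0
      then show ?case using e by (simp add: Y_def)
    next
      case (Suc n)
      have small: "cmod (poly (Y n) z) \<le> 2 * e" if "z \<in> ?U" for z
        using le_2e[OF Suc.IH[OF that]] .
      have "cmod (poly (prim a (p * Y n ^ 3 + q * Y n ^ 2)) x) \<le> 12 * K * e\<^sup>2 * \<rho>"
        using Suc.prems by (rule prim_bound) (use rhs K small in \<open>auto simp: poly_power\<close>)
      also have "\<dots> = e * (12 * K * \<rho> * e)" by (simp add: power2_eq_square)
      also have "\<dots> \<le> e * (1 / 2)" using e K(1) \<rho> by (intro mult_left_mono) auto
      finally show ?case by (simp add: Y_Suc)
    qed
    have small: "cmod (poly (Y n) z) \<le> 2 * e" if "z \<in> ?U" for z n
      using le_2e[OF near[OF that]] .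
    have lip: "cmod ((u * y ^ 3 + v * y ^ 2) - (u * z ^ 3 + v * z ^ 2)) \<le> 16 * K * e * cmod (y - z)"
      if "cmod u \<le> K" "cmod v \<le> K" "cmod y \<le> 2 * e" "cmod z \<le> 2 * e" for u v y z
    proof -
      have eq: "(u * y ^ 3 + v * y ^ 2) - (u * z ^ 3 + v * z ^ 2) =
          (u * (y * y + y * z + z * z) + v * (y + z)) * (y - z)"
        by (simp add: power3_eq_cube power2_eq_square algebra_simps)
      have prod: "cmod (r * s) \<le> 4 * e" if "cmod r \<le> 2 * e" "cmod s \<le> 2 * e" for r s
      proof -
        have "cmod (r * s) \<le> (2 * e) * (2 * e)"
          unfolding norm_mult using that e by (intro mult_mono) auto
        also have "\<dots> \<le> (2 * e) * (2 * 1)" using e by (intro mult_left_mono) auto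
        finally show ?thesis by simp
      qed
      have "cmod (y * y + y * z + z * z) \<le> 4 * e + 4 * e + 4 * e"
        by (intro norm_triangle_le add_mono prod that)
      moreover have "cmod (y + z) \<le> 2 * e + 2 * e" by (intro norm_triangle_le add_mono that)
      ultimately have "cmod (u * (y * y + y * z + z * z) + v * (y + z)) \<le> K * (12 * e) + K * (4 * e)"
        using that K(1)
        by (intro norm_triangle_le add_mono) (auto simp: norm_mult intro!: mult_mono)
      then show ?thesis unfolding eq norm_mult by (intro mult_right_mono) auto
    qed
    have step: "x \<in> ?U \<Longrightarrow> cmod (poly (Y (Suc n)) x - poly (Y n) x) \<le> (1 / 2) ^ n" for n x
    proof (induction n arbitrary: x)
      case 0
      then show ?case using near[OF 0, of "Suc 0"] e by (simp add: Y_def)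
    next
      case (Suc n)
      let ?f = "\<lambda>n. p * Y n ^ 3 + q * Y n ^ 2"
      have "prim a (?f (Suc n)) = prim a (?f (Suc n) - ?f n) + prim a (?f n)"
        by (simp flip: prim_add)
      then have "poly (Y (Suc (Suc n))) x - poly (Y (Suc n)) x = poly (prim a (?f (Suc n) - ?f n)) x"
        by (simp add: Y_Suc[of n] Y_Suc[of "Suc n"])
      also have "cmod \<dots> \<le> 16 * K * e * (1 / 2) ^ n * \<rho>"
      proof (rule prim_bound[OF Suc.prems])
        fix z assume z: "z \<in> ?U"
        have "cmod (poly (?f (Suc n) - ?f n) z) \<le> 16 * K * e * cmod (poly (Y (Suc n)) z - poly (Y n) z)"
          using lip[OF K(2,3)[OF z] small[OF z, of "Suc n"] small[OF z, of n]] by (simp add: poly_power)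
        also have "\<dots> \<le> 16 * K * e * (1 / 2) ^ n"
          using Suc.IH[OF z] K(1) e by (intro mult_left_mono) auto
        finally show "cmod (poly (?f (Suc n) - ?f n) z) \<le> 16 * K * e * (1 / 2) ^ n" .
      qed
      also have "\<dots> = (16 * K * \<rho> * e) * (1 / 2) ^ n" by simp
      also have "\<dots> \<le> (1 / 2) * (1 / 2) ^ n" using e by (intro mult_right_mono) auto
      finally show ?case by simp
    qed
    define h where "h x = (\<Sum>n. poly (Y (Suc n)) x - poly (Y n) x)" for x
    have "uniform_limit ?U (\<lambda>n x. \<Sum>i<n. poly (Y (Suc i)) x - poly (Y i) x) h sequentially"
      unfolding h_def by (rule Weierstrass_m_test[where M = "\<lambda>n. (1 / 2) ^ n"])
        (use step in \<open>auto intro: summable_geometric\<close>)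
    moreover have "(\<Sum>i<n. poly (Y (Suc i)) x - poly (Y i) x) = poly (Y n - [:c:]) x" for n x
      by (subst sum_lessThan_telescope) (simp add: Y_def)
    ultimately have lim: "uniform_limit ?U (\<lambda>n x. poly (Y n - [:c:]) x) h sequentially" by simp
    define y where "y x = h x + c" for x
    have lim_y: "(\<lambda>n. poly (Y n) x) \<longlonglongrightarrow> y x" if "x \<in> ?U" for x
      using tendsto_add[OF tendsto_uniform_limitI[OF lim that] tendsto_const[of c]]
      by (simp add: y_def)
    have "\<exists>g'. \<forall>x\<in>?U. (h has_field_derivative g' x) (at x) \<and>
        (\<lambda>n. poly (pderiv (Y n - [:c:])) x) \<longlonglongrightarrow> g' x"
    proof (rule has_complex_derivative_uniform_sequence[OF open_ball])
      fix x assume "x \<in> ?U"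
      then obtain r where "r > 0" "cball x r \<subseteq> ?U"
        using open_contains_cball_eq[OF open_ball] by blast
      then show "\<exists>d>0. cball x d \<subseteq> ?U \<and> uniform_limit (cball x d) (\<lambda>n. poly (Y n - [:c:])) h sequentially"
        using uniform_limit_on_subset[OF lim, of "cball x r"] by blast
    qed (rule poly_DERIV)
    then obtain g' where g': "\<And>x. x \<in> ?U \<Longrightarrow> (h has_field_derivative g' x) (at x)"
      "\<And>x. x \<in> ?U \<Longrightarrow> (\<lambda>n. poly (pderiv (Y n - [:c:])) x) \<longlonglongrightarrow> g' x" by blast
    have "abel_solution_on p q ?U y"
      unfolding abel_solution_on_def
    proof
      fix x assume x: "x \<in> ?U"
      have "(\<lambda>n. poly (pderiv (Y (Suc n) - [:c:])) x) \<longlonglongrightarrow> g' x"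
        using g'(2)[OF x] by (rule LIMSEQ_Suc)
      moreover have "poly (pderiv (Y (Suc n) - [:c:])) x =
          poly p x * poly (Y n) x ^ 3 + poly q x * poly (Y n) x ^ 2" for n
        by (simp add: Y_Suc poly_power)
      moreover have "(\<lambda>n. poly p x * poly (Y n) x ^ 3 + poly q x * poly (Y n) x ^ 2)
          \<longlonglongrightarrow> poly p x * y x ^ 3 + poly q x * y x ^ 2"
        by (intro tendsto_intros lim_y x)
      ultimately have "g' x = poly p x * y x ^ 3 + poly q x * y x ^ 2"
        using LIMSEQ_unique by simp
      moreover have "(y has_field_derivative g' x) (at x)"
        unfolding y_def using DERIV_add[OF g'(1)[OF x] DERIV_const[of c]] by simp
      ultimately show "(y has_field_derivative poly p x * y x ^ 3 + poly q x * y x ^ 2) (at x)"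
        by simp
    qed
    moreover have "cmod (y x - c) \<le> cmod c / 2" if "x \<in> ?U" for x
    proof (rule LIMSEQ_le_const2)
      show "(\<lambda>n. cmod (poly (Y n) x - c)) \<longlonglongrightarrow> cmod (y x - c)"
        by (intro tendsto_intros lim_y that)
    qed (use near[OF that] in \<open>auto simp: e_def\<close>)
    moreover have "y a = c"
    proof -
      have "poly (Y n) a = c" for n by (cases n) (simp_all add: Y_def)
      then show ?thesis using lim_y[of a] \<rho> LIMSEQ_unique[OF _ tendsto_const] by fastforce
    qed
    ultimately show ?thesis using seg by (intro exI[of _ ?U] exI[of _ y]) auto
  qed
  ultimately show ?thesis by blast
qed

section \<open>Coefficients of a first integral\<close>

text \<open>For \<open>\<nu> = 1\<close> the series \<open>\<Sum>n. lam n * y^(n-2)\<close> is a formal first integral of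
  \<open>y' = p y^3 + q y^2\<close> equal to \<open>y^-2\<close> at \<open>a\<close>. Starting the expansion with \<open>y^-2\<close> makes the
  leading terms in \<open>p\<close> collapse to the moments. The parameter \<open>\<nu>\<close>, inserted at the even indices,
  makes \<open>lam n\<close> homogeneous in \<open>(p, \<nu>)\<close> of degree \<open>n div 2\<close>.\<close>

fun lam :: "complex \<Rightarrow> complex poly \<Rightarrow> complex poly \<Rightarrow> complex \<Rightarrow> nat \<Rightarrow> complex poly" where
  "lam a p q \<nu> 0 = 1"
| "lam a p q \<nu> (Suc 0) = prim a (smult 2 q)"
| "lam a p q \<nu> (Suc (Suc n)) = prim a (smult (2 - of_nat n) (lam a p q \<nu> n * p) +
     smult ((1 - of_nat n) * (if even n then \<nu> else 1)) (lam a p q \<nu> (Suc n) * q))"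

lemma lam_base: "n > 0 \<Longrightarrow> poly (lam a p q \<nu> n) a = 0"
  by (cases "(a, p, q, \<nu>, n)" rule: lam.cases) auto

text \<open>The left side is \<open>y^2\<close> times the derivative, along a solution, of the
  series in \<open>y^(j-2)\<close> truncated after \<open>j = n + 1\<close>. The recursion cancels
  all powers up to \<open>y^(n+1)\<close>; the right side is the truncation error.\<close>

lemma lam_identity:
  fixes a x y :: complex and p q :: "complex poly"
  defines "L n \<equiv> poly (lam a p q 1 n) x" and "u \<equiv> poly p x" and "v \<equiv> poly q x"
  shows "(\<Sum>j\<le>Suc n. poly (pderiv (lam a p q 1 j)) x * y ^ j +
      (of_nat j - 2) * L j * (u * y ^ (j + 2) + v * y ^ (j + 1))) =
    ((of_nat n - 1) * L (Suc n) * v + (of_nat n - 2) * L n * u) * y ^ (n + 2) +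
    (of_nat n - 1) * L (Suc n) * u * y ^ (n + 3)"
proof (induction n)
  case 0
  show ?case by (simp add: L_def u_def v_def power2_eq_square power3_eq_cube algebra_simps)
next
  case (Suc n)
  have D: "poly (pderiv (lam a p q 1 (Suc (Suc n)))) x = (2 - of_nat n) * (L n * u) + (1 - of_nat n) * (L (Suc n) * v)"
    by (simp add: L_def u_def v_def)
  show ?case
    unfolding sum.atMost_Suc[of _ "Suc n"] Suc.IH D
    by (simp add: algebra_simps power_add power2_eq_square power3_eq_cube power4_eq_xxxx)
qed

lemma lam_derivative:
  assumes y: "(y has_field_derivative poly p x * y x ^ 3 + poly q x * y x ^ 2) (at x)" "y x \<noteq> 0"
  shows "((\<lambda>x. (\<Sum>j\<le>Suc n. poly (lam a p q 1 j) x * y x ^ j) / y x ^ 2) has_field_derivative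
    (((of_nat n - 1) * poly (lam a p q 1 (Suc n)) x * poly q x +
      (of_nat n - 2) * poly (lam a p q 1 n) x * poly p x) * y x ^ (n + 2) +
     (of_nat n - 1) * poly (lam a p q 1 (Suc n)) x * poly p x * y x ^ (n + 3)) / y x ^ 2) (at x)"
proof -
  let ?L = "\<lambda>j. lam a p q 1 j" and ?d = "poly p x * y x ^ 3 + poly q x * y x ^ 2"
  let ?S = "\<lambda>x. \<Sum>j\<le>Suc n. poly (?L j) x * y x ^ j"
  have "(?S has_field_derivative (\<Sum>j\<le>Suc n. poly (pderiv (?L j)) x * y x ^ j +
      poly (?L j) x * (of_nat j * y x ^ (j - 1) * ?d))) (at x)"
    by (rule DERIV_sum) (auto intro!: derivative_eq_intros y(1) simp: mult_ac)
  moreover have "((\<lambda>x. y x ^ 2) has_field_derivative 2 * y x * ?d) (at x)"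
    by (auto intro!: derivative_eq_intros y(1))
  ultimately have "((\<lambda>x. ?S x / y x ^ 2) has_field_derivative
      ((\<Sum>j\<le>Suc n. poly (pderiv (?L j)) x * y x ^ j + poly (?L j) x * (of_nat j * y x ^ (j - 1) * ?d)) *
        y x ^ 2 - ?S x * (2 * y x * ?d)) / (y x ^ 2 * y x ^ 2)) (at x)"
    using y(2) by (intro DERIV_divide) auto
  moreover have "(\<Sum>j\<le>Suc n. poly (pderiv (?L j)) x * y x ^ j + poly (?L j) x * (of_nat j * y x ^ (j - 1) * ?d)) *
        y x ^ 2 - ?S x * (2 * y x * ?d) =
      (\<Sum>j\<le>Suc n. poly (pderiv (?L j)) x * y x ^ j + (of_nat j - 2) * poly (?L j) x *
        (poly p x * y x ^ (j + 2) + poly q x * y x ^ (j + 1))) * y x ^ 2"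
    unfolding sum_distrib_right sum_subtractf[symmetric]
  proof (rule sum.cong[OF refl])
    fix j
    show "(poly (pderiv (?L j)) x * y x ^ j + poly (?L j) x * (of_nat j * y x ^ (j - 1) * ?d)) * y x ^ 2 -
        poly (?L j) x * y x ^ j * (2 * y x * ?d) =
      (poly (pderiv (?L j)) x * y x ^ j + (of_nat j - 2) * poly (?L j) x *
        (poly p x * y x ^ (j + 2) + poly q x * y x ^ (j + 1))) * y x ^ 2"
      by (cases j) (simp_all add: power2_eq_square power3_eq_cube algebra_simps)
  qed
  ultimately show ?thesis
    unfolding lam_identity using y(2) by (simp add: power2_eq_square)
qed

text \<open>Along a solution starting at \<open>c\<close>, the series truncated after index
  \<open>n + 1\<close> changes by \<open>O(c^n)\<close>. For a center the lower coefficients vanish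
  at \<open>b\<close> by induction, so the change is the new coefficient times
  \<open>c^(n-1)\<close>. Hence that coefficient is \<open>O(c)\<close> and, being independent of
  \<open>c\<close>, zero.\<close>

theorem has_center_lam:
  assumes "has_center a b p q" "n > 0"
  shows "poly (lam a p q 1 n) b = 0"
  using assms(2)
proof (induction n rule: less_induct)
  case (less n')
  then obtain n where n': "n' = Suc n" by (cases n') auto
  let ?L = "\<lambda>j. lam a p q 1 j"
  obtain \<epsilon> where \<epsilon>: "\<epsilon> > 0" "\<And>U y. open U \<Longrightarrow> closed_segment a b \<subseteq> U \<Longrightarrow>
      abel_solution_on p q U y \<Longrightarrow> cmod (y a) < \<epsilon> \<Longrightarrow> y a = y b"
    using assms(1) unfolding has_center_def by blast
  obtain \<delta> where \<delta>: "\<delta> > 0" "\<And>c. cmod c < \<delta> \<Longrightarrow> \<exists>U y. open U \<and> closed_segment a b \<subseteq> U \<and>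
      abel_solution_on p q U y \<and> y a = c \<and> (\<forall>x\<in>U. cmod (y x - c) \<le> cmod c / 2)"
    using abel_solution_exists[of a b p q] by blast
  define r where "r = smult (of_nat n - 1) (?L (Suc n) * q) + smult (of_nat n - 2) (?L n * p)"
  define s where "s = smult (of_nat n - 1) (?L (Suc n) * p)"
  obtain Br where Br: "Br \<ge> 0" "\<forall>x\<in>closed_segment a b. cmod (poly r x) \<le> Br"
    using poly_bounded_on_compact[OF compact_segment] by blast
  obtain Bs where Bs: "Bs \<ge> 0" "\<forall>x\<in>closed_segment a b. cmod (poly s x) \<le> Bs"
    using poly_bounded_on_compact[OF compact_segment] by blast
  define C where "C = 2 ^ (n + 4) * (Br + 2 * Bs) * cmod (b - a)"
  have key: "cmod (poly (?L (Suc n)) b) \<le> C * cmod c"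
    if c: "c \<noteq> 0" "cmod c < min 1 (min \<epsilon> \<delta>)" for c
  proof -
    obtain U y where U: "open U" "closed_segment a b \<subseteq> U" "abel_solution_on p q U y" "y a = c"
      "\<forall>x\<in>U. cmod (y x - c) \<le> cmod c / 2" using \<delta>(2)[of c] c(2) by auto
    define e where "e = cmod c"
    have e: "e > 0" "e < 1" using c by (auto simp: e_def)
    have yb: "y b = c" using \<epsilon>(2)[OF U(1-3)] U(4) c(2) by auto
    have size: "e / 2 \<le> cmod (y x)" "cmod (y x) \<le> 2 * e" if "x \<in> closed_segment a b" for x
    proof -
      have d: "cmod (y x - c) \<le> e / 2" using U(2,5) that by (auto simp: e_def)
      have "cmod c \<le> cmod (y x - c) + cmod (y x)"
        using norm_triangle_ineq[of "c - y x" "y x"] by (simp add: norm_minus_commute)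
      then show "e / 2 \<le> cmod (y x)" using d by (simp add: e_def)
      show "cmod (y x) \<le> 2 * e"
      proof -
        have "cmod (y x) \<le> cmod (y x - c) + e"
          using norm_triangle_ineq[of "y x - c" c] by (simp add: e_def)
        then show ?thesis using d e(1) by linarith
      qed
    qed
    define \<Phi> where "\<Phi> x = (\<Sum>j\<le>Suc n. poly (?L j) x * y x ^ j) / y x ^ 2" for x
    define \<phi> where "\<phi> x = (poly r x * y x ^ (n + 2) + poly s x * y x ^ (n + 3)) / y x ^ 2" for x
    have der: "(\<Phi> has_field_derivative \<phi> x) (at x)" if x: "x \<in> closed_segment a b" for x
    proof -
      have "y x \<noteq> 0" using size(1)[OF x] e by auto
      moreover have "(y has_field_derivative poly p x * y x ^ 3 + poly q x * y x ^ 2) (at x)"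
        using U(2,3) x unfolding abel_solution_on_def by blast
      ultimately show ?thesis
        using lam_derivative[of y p x q a n] unfolding \<Phi>_def \<phi>_def r_def s_def by (simp add: algebra_simps)
    qed
    have bound: "cmod (\<phi> x) \<le> 2 ^ (n + 4) * (Br + 2 * Bs) * e ^ n" if x: "x \<in> closed_segment a b" for x
    proof -
      have y0: "y x \<noteq> 0" using size(1)[OF x] e by auto
      have "\<phi> x = (poly r x + poly s x * y x) * y x ^ n"
        using y0 by (simp add: \<phi>_def field_simps power_add power2_eq_square power3_eq_cube)
      then have "cmod (\<phi> x) = cmod (poly r x + poly s x * y x) * cmod (y x) ^ n"
        by (simp add: norm_mult norm_power)
      also have "\<dots> \<le> (Br + Bs * 2) * (2 * e) ^ n"
      proof (intro mult_mono power_mono size(2) x)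
        have "cmod (y x) \<le> 2" using size(2)[OF x] e by simp
        then show "cmod (poly r x + poly s x * y x) \<le> Br + Bs * 2"
          using Br Bs x by (intro norm_triangle_le add_mono) (auto simp: norm_mult intro!: mult_mono)
      qed (use Br Bs in auto)
      also have "\<dots> = 2 ^ n * (Br + 2 * Bs) * e ^ n" by (simp add: power_mult_distrib algebra_simps)
      also have "\<dots> \<le> 2 ^ (n + 4) * (Br + 2 * Bs) * e ^ n"
        using Br(1) Bs(1) e by (intro mult_right_mono power_increasing) auto
      finally show ?thesis .
    qed
    have "cmod (\<Phi> b - \<Phi> a) \<le> 2 ^ (n + 4) * (Br + 2 * Bs) * e ^ n * cmod (b - a)"
    proof (rule field_differentiable_bound[of "closed_segment a b" \<Phi> \<phi>])
      fix z assume "z \<in> closed_segment a b"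
      then show "(\<Phi> has_field_derivative \<phi> z) (at z within closed_segment a b)"
        using der by (blast intro: has_field_derivative_at_within)
    qed (use bound in auto)
    moreover have "\<Phi> a = 1 / c ^ 2"
    proof -
      have "(\<Sum>j\<le>Suc n. poly (?L j) a * y a ^ j) = (\<Sum>j\<le>Suc n. if j = 0 then 1 else 0)"
        by (intro sum.cong) (auto simp: lam_base)
      then show ?thesis by (simp add: \<Phi>_def U(4))
    qed
    moreover have "\<Phi> b = (1 + poly (?L (Suc n)) b * c ^ Suc n) / c ^ 2"
    proof -
      have "(\<Sum>j\<le>n. poly (?L j) b * c ^ j) = (\<Sum>j\<le>n. if j = 0 then 1 else 0)"
        by (intro sum.cong) (use less.IH n' in auto)
      then show ?thesis by (simp add: \<Phi>_def yb)
    qed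
    ultimately have "cmod (poly (?L (Suc n)) b * c ^ Suc n / c ^ 2) \<le> C * e ^ n"
      by (simp add: diff_divide_distrib[symmetric] C_def mult_ac)
    then have "cmod (poly (?L (Suc n)) b) * e ^ Suc n \<le> C * e ^ n * e ^ 2"
      using e by (simp add: norm_mult norm_divide norm_power e_def field_simps)
    also have "\<dots> = C * e * e ^ Suc n" by (simp add: power2_eq_square)
    finally show ?thesis using e by (simp add: e_def del: power_Suc)
  qed
  have "poly (?L (Suc n)) b = 0"
  proof (rule ccontr)
    assume "poly (?L (Suc n)) b \<noteq> 0"
    then have m: "cmod (poly (?L (Suc n)) b) > 0" (is "?m > 0") by simp
    have C: "C \<ge> 0" using Br(1) Bs(1) by (simp add: C_def)
    \<comment> \<open>A positive real initial value within all radii, so small that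
      \<open>C * t\<close> stays below the supposed nonzero value; \<open>C + 1\<close> avoids a
      division by zero.\<close>
    define t where "t = min (?m / (2 * (C + 1))) (min 1 (min \<epsilon> \<delta>) / 2)"
    have t: "t > 0" using m C \<epsilon>(1) \<delta>(1) by (simp add: t_def)
    have "t \<le> min 1 (min \<epsilon> \<delta>) / 2" unfolding t_def by (rule min.cobounded2)
    also have "\<dots> < min 1 (min \<epsilon> \<delta>)" using \<epsilon>(1) \<delta>(1) by linarith
    finally have "t < min 1 (min \<epsilon> \<delta>)" .
    then have "?m \<le> C * t" using key[of "of_real t"] t by simp
    also have "\<dots> \<le> C * (?m / (2 * (C + 1)))" using C by (intro mult_left_mono) (simp_all add: t_def)
    also have "\<dots> < ?m"
    proof -
      have "0 < C * ?m + 2 * ?m" using m C by (intro add_nonneg_pos mult_nonneg_nonneg) auto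
      then show ?thesis using C by (simp add: field_simps)
    qed
    finally show False by simp
  qed
  then show ?case using n' by simp
qed

text \<open>Both \<open>P'\<close> and \<open>Q'\<close> are elements of the algebra times
  \<open>W'\<close>, so every integrand in the recursion has this shape and its primitive returns to
  the algebra.\<close>

lemma lam_comp_alg:
  assumes "P \<in> comp_alg W" "Q \<in> comp_alg W"
  shows "lam a (pderiv P) (pderiv Q) \<nu> n \<in> comp_alg W"
proof -
  obtain f where f: "f \<in> comp_alg W" "pderiv P = f * pderiv W"
    using comp_alg_pderivE[OF assms(1)] .
  obtain g where g: "g \<in> comp_alg W" "pderiv Q = g * pderiv W"
    using comp_alg_pderivE[OF assms(2)] .
  show ?thesis
  proof (induction a "pderiv P" "pderiv Q" \<nu> n rule: lam.induct)
    case (1 a \<nu>)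
    then show ?case using comp_alg_const[of 1 W] by (simp add: one_pCons)
  next
    case (2 a \<nu>)
    have "smult 2 (pderiv Q) = smult 2 g * pderiv W" by (simp add: g(2))
    then show ?case using comp_alg_prim[OF comp_alg_smult[OF g(1)]] by simp
  next
    case (3 a \<nu> n)
    let ?l = "lam a (pderiv P) (pderiv Q) \<nu>"
    let ?h = "smult (2 - of_nat n) (?l n * f) + smult ((1 - of_nat n) * (if even n then \<nu> else 1)) (?l (Suc n) * g)"
    have "?h \<in> comp_alg W"
      by (intro comp_alg_add comp_alg_smult comp_alg_mult f g 3)
    then have "prim a (?h * pderiv W) \<in> comp_alg W" by (rule comp_alg_prim)
    moreover have "smult (2 - of_nat n) (?l n * pderiv P) +
        smult ((1 - of_nat n) * (if even n then \<nu> else 1)) (?l (Suc n) * pderiv Q) = ?h * pderiv W"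
      unfolding f(2) g(2) by (simp add: algebra_simps)
    ultimately show ?case by (simp only: lam.simps)
  qed
qed

text \<open>Holding for every \<open>\<nu>\<close>, this makes the homogenized equations vanish on
  \<open>comp_alg W\<close> at infinity as well as at finite points.\<close>

lemma lam_end_comp_alg:
  assumes "P \<in> comp_alg W" "Q \<in> comp_alg W" "poly W a = poly W b" "n > 0"
  shows "poly (lam a (pderiv P) (pderiv Q) \<nu> n) b = 0"
  using comp_alg_poly_eq[OF lam_comp_alg[OF assms(1,2)] assms(3)] lam_base[OF assms(4)] by metis

section \<open>The equations at \<nu> = 0 and their reduction to moments\<close>

lemma lam_zero_even:
  assumes "n \<ge> 2" shows "lam a p q 0 (2 * n) = 0"
  using assms
proof (induction n rule: dec_induct)
  case base
  \<comment> \<open>Here the start with \<open>y^-2\<close> pays off: the factor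
    \<open>2 - n\<close> in front of the \<open>p\<close>-term is zero at \<open>n = 2\<close>, and
    \<open>\<nu> = 0\<close> removes the \<open>q\<close>-term.\<close>
  have "lam a p q 0 (Suc (Suc 2)) = prim a 0" by (subst lam.simps) simp
  moreover have "prim a 0 = 0" by (rule prim_eqI) auto
  ultimately show ?case by (simp add: eval_nat_numeral)
next
  case (step n)
  have "prim a 0 = 0" by (rule prim_eqI) auto
  then show ?case using step.IH by simp
qed

text \<open>The \<open>q\<close>-term drops out: its scalar factor is zero for \<open>n = 0\<close>,
  and for \<open>n > 0\<close> it contains an even-index polynomial that vanishes.\<close>

lemma lam_zero_odd_pderiv:
  "pderiv (lam a p q 0 (2 * n + 3)) = smult (1 - 2 * of_nat n) (lam a p q 0 (2 * n + 1) * p)"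
proof -
  have "2 * n + 3 = Suc (Suc (2 * n + 1))" by simp
  moreover have "smult ((1 - of_nat (2 * n + 1)) * (if even (2 * n + 1) then 0 else 1))
      (lam a p q 0 (Suc (2 * n + 1)) * q) = 0"
    using lam_zero_even[of "Suc n" a p q] by (cases "n = 0") auto
  moreover have "(2 :: complex) - of_nat (2 * n + 1) = 1 - 2 * of_nat n" by simp
  ultimately show ?thesis by (simp only: lam.simps pderiv_prim add_0_right)
qed

lemma pint_by_parts:
  assumes "poly P a = 0" "poly P b = 0"
  shows "pint a b (P ^ j * (f * pderiv P)) = - pint a b (P ^ Suc j * pderiv f) / of_nat (Suc j)"
proof -
  have "pderiv (P ^ Suc j * f) = smult (of_nat (Suc j)) (P ^ j * (f * pderiv P)) + P ^ Suc j * pderiv f"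
    by (simp add: pderiv_mult pderiv_power_Suc algebra_simps del: of_nat_Suc power_Suc)
  then have "of_nat (Suc j) * pint a b (P ^ j * (f * pderiv P)) + pint a b (P ^ Suc j * pderiv f) =
      poly (P ^ Suc j * f) b - poly (P ^ Suc j * f) a"
    by (metis pint_pderiv pint_add pint_smult)
  also have "\<dots> = 0" using assms by simp
  finally have "of_nat (Suc j) * pint a b (P ^ j * (f * pderiv P)) = - pint a b (P ^ Suc j * pderiv f)"
    by (simp add: eq_neg_iff_add_eq_0)
  moreover have "(of_nat (Suc j) :: complex) \<noteq> 0" by (rule of_nat_neq_0)
  ultimately show ?thesis by (metis nonzero_mult_div_cancel_left)
qed

text \<open>Each integration by parts undoes one step of the recursion and raises the power of
  \<open>P\<close> by one; the factor \<open>1 - 2 * n\<close> picked up is nonzero by parity.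
  \<open>\<kappa>\<close> is chosen before \<open>P\<close>, so that moments can later be expanded
  along a line of polynomials.\<close>

lemma lam_zero_moment:
  "\<exists>\<kappa>. \<kappa> \<noteq> 0 \<and> (\<forall>P. poly P a = 0 \<longrightarrow> poly P b = 0 \<longrightarrow>
     pint a b (P ^ j * pderiv (lam a (pderiv P) q 0 (2 * n + 1))) = \<kappa> * pint a b (P ^ (j + n) * q))"
proof (induction n arbitrary: j)
  case 0
  then show ?case by (intro exI[of _ 2]) (simp add: pint_smult)
next
  case (Suc n)
  from Suc.IH[of "Suc j"] obtain \<kappa> where \<kappa>: "\<kappa> \<noteq> 0"
    "\<And>P. poly P a = 0 \<Longrightarrow> poly P b = 0 \<Longrightarrow>
      pint a b (P ^ Suc j * pderiv (lam a (pderiv P) q 0 (2 * n + 1))) = \<kappa> * pint a b (P ^ (Suc j + n) * q)"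
    by blast
  define \<mu> where "\<mu> = - (1 - 2 * of_nat n) * \<kappa> / of_nat (Suc j)"
  have "(1 :: complex) \<noteq> 2 * of_nat n"
  proof
    assume "(1 :: complex) = 2 * of_nat n"
    then have "(of_nat 1 :: complex) = of_nat (2 * n)" by simp
    then show False unfolding of_nat_eq_iff by presburger
  qed
  then have "\<mu> \<noteq> 0" using \<kappa>(1) by (simp add: \<mu>_def del: of_nat_Suc)
  moreover have "pint a b (P ^ j * pderiv (lam a (pderiv P) q 0 (2 * Suc n + 1))) =
      \<mu> * pint a b (P ^ (j + Suc n) * q)" if P: "poly P a = 0" "poly P b = 0" for P
  proof -
    let ?l = "lam a (pderiv P) q 0 (2 * n + 1)"
    have alg: "X * (- (k * I) / N) = - X * k / N * I" for X k I N :: complex by simp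
    have idx: "2 * Suc n + 1 = 2 * n + 3" by simp
    have "pint a b (P ^ j * pderiv (lam a (pderiv P) q 0 (2 * Suc n + 1))) =
        (1 - 2 * of_nat n) * pint a b (P ^ j * (?l * pderiv P))"
      unfolding idx lam_zero_odd_pderiv by (simp only: mult_smult_right pint_smult)
    also have "\<dots> = \<mu> * pint a b (P ^ (Suc j + n) * q)"
      unfolding pint_by_parts[OF P] \<kappa>(2)[OF P] \<mu>_def
      by (rule alg)
    finally show ?thesis by simp
  qed
  ultimately show ?case by blast
qed

theorem lam_zero_end_moment:
  obtains \<kappa> where "\<kappa> \<noteq> 0" "\<And>P. poly P a = 0 \<Longrightarrow> poly P b = 0 \<Longrightarrow>
     poly (lam a (pderiv P) q 0 (2 * n + 1)) b = \<kappa> * pint a b (P ^ n * q)"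
proof -
  from lam_zero_moment[of a b 0 q n] obtain \<kappa> where \<kappa>: "\<kappa> \<noteq> 0"
    "\<And>P. poly P a = 0 \<Longrightarrow> poly P b = 0 \<Longrightarrow>
      pint a b (pderiv (lam a (pderiv P) q 0 (2 * n + 1))) = \<kappa> * pint a b (P ^ n * q)" by auto
  have "poly (lam a (pderiv P) q 0 (2 * n + 1)) b = pint a b (pderiv (lam a (pderiv P) q 0 (2 * n + 1)))" for P
    using lam_base[of "2 * n + 1" a "pderiv P" q 0] by (simp add: pint_pderiv)
  with \<kappa> show ?thesis using that by metis
qed

section \<open>The center equations as forms\<close>

text \<open>Polynomial-valued forms as finite sums of a form times a fixed polynomial
  \<open>R\<close>; linear operators such as \<open>pderiv\<close> and \<open>prim\<close> then act
  on the fixed factors only.\<close>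

inductive form_poly :: "nat \<Rightarrow> nat \<Rightarrow> (complex poly \<times> complex \<Rightarrow> complex poly) \<Rightarrow> bool" for d m where
  zero: "form_poly d m (\<lambda>_. 0)"
| add: "form d m g \<Longrightarrow> form_poly d m T \<Longrightarrow> form_poly d m (\<lambda>v. smult (g v) R + T v)"

lemma form_poly_single: "form d m g \<Longrightarrow> form_poly d m (\<lambda>v. smult (g v) R)"
  using form_poly.add[OF _ form_poly.zero] by simp

lemma form_poly_add:
  "form_poly d m S \<Longrightarrow> form_poly d m T \<Longrightarrow> form_poly d m (\<lambda>v. S v + T v)"
  by (induction rule: form_poly.induct) (auto simp: add.assoc intro: form_poly.add)

lemma form_poly_sum:
  "(\<And>i. i \<in> I \<Longrightarrow> form_poly d m (T i)) \<Longrightarrow> form_poly d m (\<lambda>v. \<Sum>i\<in>I. T i v)"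
  by (induction I rule: infinite_finite_induct) (auto intro: form_poly.zero form_poly_add)

lemma form_poly_linear:
  assumes "form_poly d m T" "\<And>f g. L (f + g) = L f + L g" "\<And>c f. L (smult c f) = smult c (L f)"
  shows "form_poly d m (\<lambda>v. L (T v))"
  using assms(1)
proof (induction rule: form_poly.induct)
  case zero
  have "L 0 = 0" using assms(3)[of 0 0] by simp
  then show ?case by (simp add: form_poly.zero)
next
  case (add g T R)
  then show ?case by (simp add: assms(2,3) form_poly.add)
qed

lemma form_poly_smult:
  assumes "form_poly d n T" "form d m f" shows "form_poly d (m + n) (\<lambda>v. smult (f v) (T v))"
  using assms(1)
proof (induction rule: form_poly.induct)
  case zero
  then show ?case by (simp add: form_poly.zero)
next
  case (add g T R)
  then show ?case
    using form_poly.add[OF form.mult[OF assms(2) add.hyps(1)] add.IH] by (simp add: smult_add_right)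
qed

lemma form_poly_mult_const: "form_poly d m T \<Longrightarrow> form_poly d m (\<lambda>v. T v * R)"
  by (rule form_poly_linear[of d m T "\<lambda>f. f * R"]) (simp_all add: algebra_simps)

lemma form_poly_mult:
  assumes "form_poly d m S" "form_poly d n T" shows "form_poly d (m + n) (\<lambda>v. S v * T v)"
  using assms(1)
proof (induction rule: form_poly.induct)
  case zero
  then show ?case by (simp add: form_poly.zero)
next
  case (add g S R)
  have "form_poly d n (\<lambda>v. R * T v)"
    using form_poly_mult_const[OF assms(2), of R] by (simp add: mult.commute)
  from form_poly_add[OF form_poly_smult[OF this add.hyps(1)] add.IH]
  show ?case by (simp add: distrib_right)
qed

lemma form_poly_eval: "form_poly d m T \<Longrightarrow> form d m (\<lambda>v. poly (T v) b)"
proof (induction rule: form_poly.induct)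
  case (add g T R)
  then show ?case
    using form.add[OF form_smult[OF add.hyps(1), of "poly R b"] add.IH] by (simp add: mult.commute)
qed (simp add: form.zero)

lemma form_poly_cut: "form_poly d 1 (\<lambda>v. fst (cut d v))"
proof -
  have "form_poly d 1 (\<lambda>v. \<Sum>i\<le>d. smult (coeff (fst v) i) (monom 1 i))"
    by (intro form_poly_sum form_poly_single form.gen coeff_in_gens) simp
  moreover have "(\<Sum>i\<le>d. smult (coeff (fst v) i) (monom 1 i)) = fst (cut d v)" for v
    by (auto simp: cut_def poly_eq_iff coeff_sum coeff_poly_cutoff smult_monom)
  ultimately show ?thesis by simp
qed

text \<open>In the step from \<open>n\<close> to \<open>n + 2\<close> the \<open>p\<close>-term
  raises \<open>n div 2\<close> by one. The \<open>q\<close>-term comes from index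
  \<open>n + 1\<close>, whose degree is already right for odd \<open>n\<close> and one too small for
  even \<open>n\<close>, where \<open>\<nu>\<close> makes up for it.\<close>

lemma form_poly_lam:
  "form_poly d (n div 2) (\<lambda>v. lam a (pderiv (fst (cut d v))) q (snd v) n)"
proof (induction n rule: induct_nat_012)
  case 0
  show ?case using form_poly_single[OF form.const[of d 1], of 1] by (simp add: one_pCons)
next
  case 1
  show ?case using form_poly_single[OF form.const[of d 1], of "prim a (smult 2 q)"] by simp
next
  case (ge2 n)
  let ?p = "\<lambda>v. pderiv (fst (cut d v))"
  let ?l = "\<lambda>n v. lam a (?p v) q (snd v) n"
  have p: "form_poly d 1 ?p"
    by (rule form_poly_linear[OF form_poly_cut]) (simp_all add: pderiv_add pderiv_smult)
  have "form_poly d (0 + (n div 2 + 1)) (\<lambda>v. smult (2 - of_nat n) (?l n v * ?p v))"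
    by (intro form_poly_smult[OF _ form.const] form_poly_mult[OF ge2(1) p])
  then have 1: "form_poly d (Suc n div 2 + (if even n then 1 else 0)) (\<lambda>v. smult (2 - of_nat n) (?l n v * ?p v))"
    by (cases "even n") (auto elim!: oddE)
  have "form d (0 + (if even n then 1 else 0)) (\<lambda>v. (1 - of_nat n) * (if even n then snd v else 1))"
    by (intro form.mult form.const) (use form.gen[OF snd_in_gens, of d] form.const[of d 1] in auto)
  from form_poly_smult[OF form_poly_mult_const[OF ge2(2), of q] this]
  have 2: "form_poly d (Suc n div 2 + (if even n then 1 else 0))
      (\<lambda>v. smult ((1 - of_nat n) * (if even n then snd v else 1)) (?l (Suc n) v * q))"
    by (simp add: add.commute)
  have deg: "Suc n div 2 + (if even n then 1 else 0) = Suc (Suc n) div 2"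
    by (cases "even n") (auto elim!: oddE)
  show ?case
    using form_poly_linear[OF form_poly_add[OF 1 2], of "prim a"]
    unfolding deg lam.simps by (simp add: prim_add prim_smult)
qed

definition center_form ::
  "complex \<Rightarrow> complex \<Rightarrow> nat \<Rightarrow> complex poly \<Rightarrow> nat \<Rightarrow> complex poly \<times> complex \<Rightarrow> complex" where
  "center_form a b d Q n v = poly (lam a (pderiv (fst (cut d v))) (pderiv Q) (snd v) (2 * n + 1)) b"

lemma form_center_form: "form d n (center_form a b d Q n)"
  using form_poly_eval[OF form_poly_lam[of d "2 * n + 1" a "pderiv Q"], of b]
  by (simp add: center_form_def[abs_def])

lemma center_form_center_set: "P \<in> center_set a b d Q \<Longrightarrow> center_form a b d Q n (P, 1) = 0"
  using has_center_lam[of a b "pderiv P" "pderiv Q" "2 * n + 1"]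
  by (simp add: center_set_def center_form_def polys_vanishing_deg_def cut_id)

lemma center_form_comp_alg:
  assumes "fst v \<in> comp_alg W" "Q \<in> comp_alg W" "poly W a = poly W b" "degree (fst v) \<le> d"
  shows "center_form a b d Q n v = 0"
  using lam_end_comp_alg[OF assms(1-3)] by (simp add: center_form_def cut_id[OF assms(4)])

text \<open>The form depends on \<open>P\<close> only through its derivative, so \<open>P(a)\<close>
  may be subtracted. Equal end values are what the kernel directions in the complement of
  \<open>comp_alg W\<close> offer.\<close>

lemma center_form_at_infinity:
  obtains \<kappa> where "\<kappa> \<noteq> 0" "\<And>P. degree P \<le> d \<Longrightarrow> poly P a = poly P b \<Longrightarrow>
    center_form a b d Q n (P, 0) = \<kappa> * pint a b ((P - [:poly P a:]) ^ n * pderiv Q)"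
proof -
  from lam_zero_end_moment[of a b "pderiv Q" n] obtain \<kappa> where \<kappa>: "\<kappa> \<noteq> 0"
    "\<And>P. poly P a = 0 \<Longrightarrow> poly P b = 0 \<Longrightarrow>
      poly (lam a (pderiv P) (pderiv Q) 0 (2 * n + 1)) b = \<kappa> * pint a b (P ^ n * pderiv Q)" by blast
  have "center_form a b d Q n (P, 0) = \<kappa> * pint a b ((P - [:poly P a:]) ^ n * pderiv Q)"
    if P: "degree P \<le> d" "poly P a = poly P b" for P
    using \<kappa>(2)[of "P - [:poly P a:]"] P by (simp add: center_form_def cut_id pderiv_diff)
  with \<kappa>(1) show ?thesis using that by blast
qed

section \<open>Points at infinity of the center set\<close>

lemma at_infinity_partE:
  assumes "X \<in> at_infinity_part a b d Y"
  obtains S where "X = proj_point (S, 0)" "(S, 0) \<in> proj_cone a b d"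
  using assms unfolding at_infinity_part_def infinite_hyperplane_def by blast

lemma at_infinity_part_iff:
  assumes "Y \<subseteq> polys_vanishing_deg a b d" "(S, 0) \<in> proj_cone a b d"
  shows "proj_point (S, 0) \<in> at_infinity_part a b d Y \<longleftrightarrow>
    (\<forall>f\<in>homogeneous_functions. (\<forall>P\<in>Y. f (P, 1) = 0) \<longrightarrow> f (S, 0) = 0)"
  unfolding at_infinity_part_def
  using closure_affine_iff[OF assms] in_infinite_hyperplane_iff[OF assms(2)] by simp

lemma at_infinity_part_mono: "Y \<subseteq> Y' \<Longrightarrow> at_infinity_part a b d Y \<subseteq> at_infinity_part a b d Y'"
  unfolding at_infinity_part_def by (intro Int_mono closure_of_mono image_mono) auto

lemma proj_cone_infinity_iff:
  "(S, 0) \<in> proj_cone a b d \<longleftrightarrow> S \<in> polys_vanishing_deg a b d \<and> S \<noteq> 0"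
  by (auto simp: proj_cone_def)

lemma polys_vanishing_degD:
  assumes "P \<in> polys_vanishing_deg a b d"
  shows "poly P a = 0" "poly P b = 0" "degree P \<le> d" "P \<in> polys_vanishing a b"
  using assms by (auto simp: polys_vanishing_deg_def polys_vanishing_def)

lemma center_set_at_infinity_moments:
  assumes S: "(S, 0) \<in> proj_cone a b d" "proj_point (S, 0) \<in> at_infinity_part a b d (center_set a b d Q)"
  shows "moments_vanish a b S Q"
  unfolding moments_vanish_iff
proof
  fix n
  have Sd: "S \<in> polys_vanishing_deg a b d" using S(1) by (simp add: proj_cone_infinity_iff)
  note Sv = polys_vanishing_degD[OF Sd]
  have "center_set a b d Q \<subseteq> polys_vanishing_deg a b d" by (auto simp: center_set_def)
  from at_infinity_part_iff[OF this S(1)] S(2)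
  have "center_form a b d Q n (S, 0) = 0"
    using form_homogeneous[OF form_center_form] center_form_center_set by blast
  moreover obtain \<kappa> where "\<kappa> \<noteq> 0" "center_form a b d Q n (S, 0) = \<kappa> * pint a b (S ^ n * pderiv Q)"
    using center_form_at_infinity[of d a b Q n] Sv by (metis (no_types, lifting) diff_zero pCons_0_0)
  ultimately show "pint a b (S ^ n * pderiv Q) = 0" by simp
qed

lemma moments_vanish_smult: "moments_vanish a b S Q \<Longrightarrow> moments_vanish a b (smult c S) Q"
  by (simp add: moments_vanish_iff smult_power pint_smult)

text \<open>The moment set is stable under scaling, so a homogeneous function vanishing on it
  vanishes at \<open>(S, t)\<close> for every \<open>t \<noteq> 0\<close>; being polynomial in
  \<open>t\<close>, it also vanishes at \<open>t = 0\<close>.\<close>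

lemma moments_at_infinity:
  assumes S: "(S, 0) \<in> proj_cone a b d" "moments_vanish a b S Q"
  shows "proj_point (S, 0) \<in> at_infinity_part a b d (moment_set a b d Q)"
proof -
  have Sd: "S \<in> polys_vanishing_deg a b d" using S(1) by (simp add: proj_cone_infinity_iff)
  note Sv = polys_vanishing_degD[OF Sd]
  have "f (S, 0) = 0" if f: "f \<in> homogeneous_functions" "\<forall>P\<in>moment_set a b d Q. f (P, 1) = 0" for f
  proof -
    obtain m where m: "\<And>t v. f (scale t v) = t ^ m * f v" using homogeneous_scale[OF f(1)] by blast
    obtain h where "\<forall>t. f (cut d (fst (S, 0::complex) + smult t (fst (0, 1::complex)),
        snd (S, 0::complex) + t * snd (0 :: complex poly, 1))) = poly h t"
      using PF_line[OF PF_homogeneous_cut[OF f(1)], where v = "(S, 0)" and w = "(0, 1)"] by blast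
    then have h: "f (S, t) = poly h t" for t using Sv by (simp add: cut_id)
    have "poly h t = 0" if "t \<noteq> 0" for t
    proof -
      have "smult (1 / t) S \<in> moment_set a b d Q"
        using Sv moments_vanish_smult[OF S(2)] degree_smult_le[of "1 / t" S]
        by (auto simp: moment_set_def polys_vanishing_deg_def polys_vanishing_def)
      then have "f (scale t (smult (1 / t) S, 1)) = 0" using f(2) m by simp
      then show ?thesis using that h by (simp add: scale_def)
    qed
    then have "UNIV - {0} \<subseteq> {t. poly h t = 0}" by auto
    then have "infinite {t. poly h t = 0}"
      using infinite_UNIV_char_0[where 'a = complex] by (meson finite_Diff2 finite.intros finite_subset)
    then have "h = 0" using poly_roots_finite by blast
    then show ?thesis using h[of 0] by simp
  qed
  moreover have "moment_set a b d Q \<subseteq> polys_vanishing_deg a b d" by (auto simp: moment_set_def)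
  ultimately show ?thesis using at_infinity_part_iff[OF _ S(1)] by blast
qed

section \<open>A complement of the composition algebra\<close>

lemma smult_sum_right: "smult c (\<Sum>i\<in>I. f i) = (\<Sum>i\<in>I. smult c (f i))"
  by (induction I rule: infinite_finite_induct) (simp_all add: smult_add_right)

text \<open>Linear algebra modulo \<open>A\<close>, with the coordinates along the complement given
  explicitly as combinations of coefficients: this is what makes them linear forms later. Degrees
  are added one at a time.\<close>

lemma exists_complement:
  fixes A :: "complex poly set"
  assumes A: "0 \<in> A" "\<And>f g. f \<in> A \<Longrightarrow> g \<in> A \<Longrightarrow> f + g \<in> A" "\<And>c f. f \<in> A \<Longrightarrow> smult c f \<in> A"
  shows "\<exists>E c. finite E \<and> (\<forall>e\<in>E. \<forall>i\<ge>n. coeff e i = 0) \<and>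
    (\<forall>P. (\<forall>i\<ge>n. coeff P i = 0) \<longrightarrow> P - (\<Sum>e\<in>E. smult (\<Sum>i<n. coeff P i * c i e) e) \<in> A) \<and>
    (\<forall>x. (\<Sum>e\<in>E. smult (x e) e) \<in> A \<longrightarrow> (\<forall>e\<in>E. x e = 0))"
proof (induction n)
  case 0
  have "P = 0" if "\<forall>i\<ge>0. coeff P i = (0::complex)" for P using that by (simp add: poly_eq_iff)
  then show ?case using A(1) by (intro exI[of _ "{}"]) auto
next
  case (Suc n)
  then obtain E c where raw: "finite E" "\<forall>e\<in>E. \<forall>i\<ge>n. coeff e i = 0"
    "\<forall>P. (\<forall>i\<ge>n. coeff P i = 0) \<longrightarrow> P - (\<Sum>e\<in>E. smult (\<Sum>i<n. coeff P i * c i e) e) \<in> A"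
    "\<forall>x. (\<Sum>e\<in>E. smult (x e) e) \<in> A \<longrightarrow> (\<forall>e\<in>E. x e = 0)"
    by (elim exE conjE)
  have E: "finite E" "\<And>e i. e \<in> E \<Longrightarrow> i \<ge> n \<Longrightarrow> coeff e i = 0"
    "\<And>P. (\<And>i. i \<ge> n \<Longrightarrow> coeff P i = 0) \<Longrightarrow> P - (\<Sum>e\<in>E. smult (\<Sum>i<n. coeff P i * c i e) e) \<in> A"
    "\<And>x e. (\<Sum>e\<in>E. smult (x e) e) \<in> A \<Longrightarrow> e \<in> E \<Longrightarrow> x e = 0"
    using raw(1) raw(2) raw(3)[rule_format] raw(4)[rule_format] by blast+
  let ?X = "monom 1 n :: complex poly"
  have split: "P - smult (coeff P n) ?X - (\<Sum>e\<in>E. smult (\<Sum>i<n. coeff P i * c i e) e) \<in> A"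
    if "\<forall>i\<ge>Suc n. coeff P i = 0" for P
  proof -
    let ?P = "P - smult (coeff P n) ?X"
    have high: "coeff ?P i = 0" if "i \<ge> n" for i
      using \<open>\<forall>i\<ge>Suc n. coeff P i = 0\<close> that by (cases "i = n") auto
    have low: "(\<Sum>i<n. coeff ?P i * c i e) = (\<Sum>i<n. coeff P i * c i e)" for e
      by (intro sum.cong) auto
    from E(3)[OF high] show ?thesis unfolding low .
  qed
  show ?case
  proof (cases "\<exists>y. ?X - (\<Sum>e\<in>E. smult (y e) e) \<in> A")
    case True
    then obtain y where y: "?X - (\<Sum>e\<in>E. smult (y e) e) \<in> A" by blast
    define c' where "c' i e = (if i = n then y e else c i e)" for i e
    have "P - (\<Sum>e\<in>E. smult (\<Sum>i<Suc n. coeff P i * c' i e) e) \<in> A"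
      if P: "\<forall>i\<ge>Suc n. coeff P i = 0" for P
    proof -
      have low: "(\<Sum>i<n. coeff P i * c' i e) = (\<Sum>i<n. coeff P i * c i e)" for e
        by (rule sum.cong) (auto simp: c'_def)
      have top: "c' n e = y e" for e by (simp add: c'_def)
      have "P - (\<Sum>e\<in>E. smult (\<Sum>i<Suc n. coeff P i * c' i e) e) =
          (P - smult (coeff P n) ?X - (\<Sum>e\<in>E. smult (\<Sum>i<n. coeff P i * c i e) e)) +
          smult (coeff P n) (?X - (\<Sum>e\<in>E. smult (y e) e))"
        by (simp add: low top smult_add_left sum.distrib smult_diff_right smult_sum_right)
      then show ?thesis using A(2)[OF split[OF P] A(3)[OF y]] by (simp only:)
    qed
    then show ?thesis using E(1,2,4) by (intro exI[of _ E] exI[of _ c']) auto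
  next
    case False
    have XE: "?X \<notin> E" using E(2)[of ?X n] by auto
    define c' where "c' i e = (if i = n then (if e = ?X then 1 else 0) else if e = ?X then 0 else c i e)" for i e
    have "P - (\<Sum>e\<in>insert ?X E. smult (\<Sum>i<Suc n. coeff P i * c' i e) e) \<in> A"
      if P: "\<forall>i\<ge>Suc n. coeff P i = 0" for P
    proof -
      have "(\<Sum>i<Suc n. coeff P i * c' i e) = (\<Sum>i<n. coeff P i * c i e)" if "e \<in> E" for e
      proof -
        have "e \<noteq> ?X" using XE that by auto
        moreover from this have "(\<Sum>i<n. coeff P i * c' i e) = (\<Sum>i<n. coeff P i * c i e)"
          by (intro sum.cong) (auto simp: c'_def)
        ultimately show ?thesis by (simp add: c'_def)
      qed
      then have "(\<Sum>e\<in>E. smult (\<Sum>i<Suc n. coeff P i * c' i e) e) = (\<Sum>e\<in>E. smult (\<Sum>i<n. coeff P i * c i e) e)"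
        by (intro sum.cong refl) (simp only:)
      moreover have "(\<Sum>i<Suc n. coeff P i * c' i ?X) = coeff P n" by (simp add: c'_def)
      ultimately show ?thesis
        using split[OF P] E(1) XE by (simp add: algebra_simps del: sum.lessThan_Suc)
    qed
    moreover have "\<forall>e\<in>insert ?X E. x e = 0" if x: "(\<Sum>e\<in>insert ?X E. smult (x e) e) \<in> A" for x
    proof -
      have sum: "smult (x ?X) ?X + (\<Sum>e\<in>E. smult (x e) e) \<in> A" using x E(1) XE by simp
      have "x ?X = 0"
      proof (rule ccontr)
        assume nz: "x ?X \<noteq> 0"
        have eq: "smult (1 / x ?X) (smult (x ?X) ?X + (\<Sum>e\<in>E. smult (x e) e)) =
            ?X - (\<Sum>e\<in>E. smult (- x e / x ?X) e)"
          using nz by (simp add: smult_add_right smult_sum_right sum_negf)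
        have "?X - (\<Sum>e\<in>E. smult (- x e / x ?X) e) \<in> A"
          using A(3)[OF sum, of "1 / x ?X"] unfolding eq .
        then have "\<exists>y. ?X - (\<Sum>e\<in>E. smult (y e) e) \<in> A"
          by (rule exI[where x = "\<lambda>e. - x e / x ?X"])
        with False show False by (rule notE)
      qed
      then show ?thesis using sum E(4)[of x] by simp
    qed
    ultimately show ?thesis
      using E(1,2) by (intro exI[of _ "insert ?X E"] exI[of _ c']) auto
  qed
qed

text \<open>Gaussian elimination; \<open>D\<close> is the product of the pivots.\<close>

lemma injective_off_hypersurface:
  assumes "finite I" "\<And>M. M \<in> \<M> \<Longrightarrow> \<exists>m. \<forall>i\<in>I. form d m (M i)"
    and "\<And>x. (\<And>M. M \<in> \<M> \<Longrightarrow> (\<Sum>i\<in>I. M i s * x i) = 0) \<Longrightarrow> \<forall>i\<in>I. x i = 0"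
  shows "\<exists>D k. form d k D \<and> D s \<noteq> 0 \<and>
    (\<forall>v x. D v \<noteq> 0 \<longrightarrow> (\<forall>M\<in>\<M>. (\<Sum>i\<in>I. M i v * x i) = 0) \<longrightarrow> (\<forall>i\<in>I. x i = 0))"
  using assms
proof (induction I arbitrary: \<M> rule: finite_induct)
  case empty
  show ?case by (intro exI[of _ "\<lambda>_. 1"] exI[of _ 0]) (auto intro: form.const)
next
  case (insert j I)
  have sum_insert: "(\<Sum>i\<in>insert j I. f i) = f j + (\<Sum>i\<in>I. f i)" for f :: "_ \<Rightarrow> complex"
    using insert.hyps by simp
  have "\<exists>M\<in>\<M>. M j s \<noteq> 0"
  proof (rule ccontr)
    assume no: "\<not> ?thesis"
    have "\<forall>i\<in>insert j I. (if i = j then 1 else 0) = (0 :: complex)"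
    proof (rule insert.prems(2))
      fix M assume "M \<in> \<M>"
      then show "(\<Sum>i\<in>insert j I. M i s * (if i = j then 1 else 0)) = 0"
        using no insert.hyps by (intro sum.neutral) auto
    qed
    then show False by auto
  qed
  then obtain M where M: "M \<in> \<M>" "M j s \<noteq> 0" by blast
  obtain m where m: "\<forall>i\<in>insert j I. form d m (M i)" using insert.prems(1)[OF M(1)] by blast
  \<comment> \<open>Row reduction by cross multiplication: without division the entries remain
    forms.\<close>
  define red where "red N i v = M j v * N i v + (-1) * (N j v * M i v)"
    for N :: "'a \<Rightarrow> complex poly \<times> complex \<Rightarrow> complex" and i v
  have red_sum: "(\<Sum>i\<in>I. red N i v * x i) =
      M j v * (\<Sum>i\<in>I. N i v * x i) - N j v * (\<Sum>i\<in>I. M i v * x i)" for N v x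
    by (simp add: red_def sum_distrib_left sum_subtractf[symmetric] algebra_simps)
  have "\<exists>D k. form d k D \<and> D s \<noteq> 0 \<and>
    (\<forall>v x. D v \<noteq> 0 \<longrightarrow> (\<forall>N\<in>red ` \<M>. (\<Sum>i\<in>I. N i v * x i) = 0) \<longrightarrow> (\<forall>i\<in>I. x i = 0))"
  proof (rule insert.IH)
    fix N' assume "N' \<in> red ` \<M>"
    then obtain N where N: "N \<in> \<M>" "N' = red N" by blast
    obtain n where n: "\<forall>i\<in>insert j I. form d n (N i)" using insert.prems(1)[OF N(1)] by blast
    have "form d (m + n) (N' i)" if "i \<in> I" for i
    proof -
      have "form d (m + n) (\<lambda>v. M j v * N i v)" using m n that by (intro form.mult) auto
      moreover have "form d (n + m) (\<lambda>v. N j v * M i v)" using m n that by (intro form.mult) auto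
      ultimately show ?thesis
        unfolding N(2) red_def[abs_def] by (intro form.add form_smult) (simp_all add: add.commute)
    qed
    then show "\<exists>m. \<forall>i\<in>I. form d m (N' i)" by blast
  next
    fix x assume x: "\<And>N. N \<in> red ` \<M> \<Longrightarrow> (\<Sum>i\<in>I. N i s * x i) = 0"
    \<comment> \<open>A kernel vector of the reduced system at \<open>s\<close> extends to one of
      the full system; the pivot row determines the entry at \<open>j\<close>.\<close>
    define y where "y i = (if i = j then - (\<Sum>i\<in>I. M i s * x i) / M j s else x i)" for i
    have y: "(\<Sum>i\<in>I. N i s * y i) = (\<Sum>i\<in>I. N i s * x i)" for N :: "_ \<Rightarrow> _ \<Rightarrow> complex"
      using insert.hyps(2) by (intro sum.cong) (auto simp: y_def)
    have "(\<Sum>i\<in>insert j I. N i s * y i) = 0" if "N \<in> \<M>" for N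
    proof -
      have "M j s * (\<Sum>i\<in>I. N i s * x i) = N j s * (\<Sum>i\<in>I. M i s * x i)"
        using x[of "red N"] that red_sum[of N s x] by simp
      then show ?thesis unfolding sum_insert y using M(2) by (simp add: y_def field_simps)
    qed
    then have "\<forall>i\<in>insert j I. y i = 0" by (rule insert.prems(2))
    then show "\<forall>i\<in>I. x i = 0"
      using insert.hyps(2) unfolding y_def by (metis insertI2)
  qed
  then obtain D k where D: "form d k D" "D s \<noteq> 0"
    "\<And>v x. D v \<noteq> 0 \<Longrightarrow> \<forall>N\<in>red ` \<M>. (\<Sum>i\<in>I. N i v * x i) = 0 \<Longrightarrow> \<forall>i\<in>I. x i = 0" by blast
  show ?case
  proof (intro exI conjI allI impI)
    show "form d (m + k) (\<lambda>v. M j v * D v)" using m D(1) by (intro form.mult) auto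
    show "M j s * D s \<noteq> 0" using M(2) D(2) by simp
    fix v x assume v: "M j v * D v \<noteq> 0" and x: "\<forall>N\<in>\<M>. (\<Sum>i\<in>insert j I. N i v * x i) = 0"
    have row: "(\<Sum>i\<in>I. N i v * x i) = - (N j v * x j)" if "N \<in> \<M>" for N
    proof -
      have "(\<Sum>i\<in>insert j I. N i v * x i) = 0" using x that ..
      then show ?thesis unfolding sum_insert by (simp add: eq_neg_iff_add_eq_0 add.commute)
    qed
    have "\<forall>N\<in>red ` \<M>. (\<Sum>i\<in>I. N i v * x i) = 0"
      using row M(1) by (auto simp: red_sum)
    moreover have "D v \<noteq> 0" using v by simp
    ultimately have I: "\<forall>i\<in>I. x i = 0" using D(3) by blast
    then have "M j v * x j = 0" using row[OF M(1)] by simp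
    then show "\<forall>i\<in>insert j I. x i = 0" using I v by auto
  qed
qed

text \<open>Since \<open>\<pi>\<close> subtracts the combination with coefficients
  \<open>l e\<close>, the difference lies in the ideal of the \<open>l e\<close>; products are
  handled by writing \<open>f g - f' g'\<close> as \<open>(f - f') g + f' (g - g')\<close>. The
  clause for \<open>m = 0\<close> guards against truncated subtraction: there \<open>m - 1\<close>
  is 0, and a nonzero constant cofactor would have the wrong degree in a product.\<close>

lemma form_difference:
  assumes l: "\<And>e. e \<in> E \<Longrightarrow> form d 1 (l e)"
    and "form d m f"
  defines "\<pi> \<equiv> \<lambda>v. (fst v - (\<Sum>e\<in>E. smult (l e v) e), snd v)"
  shows "form d m (\<lambda>v. f (\<pi> v)) \<and> (\<exists>M. (\<forall>e\<in>E. form d (m - 1) (M e) \<and> (m = 0 \<longrightarrow> M e = (\<lambda>_. 0))) \<and>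
    (\<forall>v. f v - f (\<pi> v) = (\<Sum>e\<in>E. M e v * l e v)))"
  using assms(2)
proof (induction rule: form.induct)
  case (const c)
  show ?case by (intro conjI form.const exI[of _ "\<lambda>_ _. 0"]) (auto intro: form.zero)
next
  case (gen g)
  have "\<exists>\<gamma>. \<forall>v. g v - g (\<pi> v) = (\<Sum>e\<in>E. \<gamma> e * l e v)"
  proof (cases "g = snd")
    case True
    then show ?thesis by (intro exI[of _ "\<lambda>_. 0"]) (simp add: \<pi>_def)
  next
    case False
    then obtain i where "g = (\<lambda>v. coeff (fst v) i)" using gen by (auto simp: gens_def)
    then show ?thesis
      by (intro exI[of _ "\<lambda>e. coeff e i"]) (simp add: \<pi>_def coeff_sum mult.commute)
  qed
  then obtain \<gamma> where \<gamma>: "\<And>v. g v - g (\<pi> v) = (\<Sum>e\<in>E. \<gamma> e * l e v)" by blast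
  have "form d 1 (\<lambda>v. g v + (-1) * (\<Sum>e\<in>E. \<gamma> e * l e v))"
    by (intro form.add form.gen gen form_smult form_sum l)
  moreover have "g v + (-1) * (\<Sum>e\<in>E. \<gamma> e * l e v) = g (\<pi> v)" for v
    using \<gamma>[of v] by (simp add: algebra_simps)
  ultimately show ?case
    using \<gamma> form.const[of d] by (intro conjI exI[of _ "\<lambda>e _. \<gamma> e"]) auto
next
  case (zero m)
  show ?case by (intro conjI form.zero exI[of _ "\<lambda>_ _. 0"]) (auto intro: form.zero)
next
  case (add m f g)
  then obtain M N where
    "\<forall>e\<in>E. form d (m - 1) (M e) \<and> (m = 0 \<longrightarrow> M e = (\<lambda>_. 0))" "\<forall>v. f v - f (\<pi> v) = (\<Sum>e\<in>E. M e v * l e v)"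
    "\<forall>e\<in>E. form d (m - 1) (N e) \<and> (m = 0 \<longrightarrow> N e = (\<lambda>_. 0))" "\<forall>v. g v - g (\<pi> v) = (\<Sum>e\<in>E. N e v * l e v)"
    by blast
  then have "\<exists>M. (\<forall>e\<in>E. form d (m - 1) (M e) \<and> (m = 0 \<longrightarrow> M e = (\<lambda>_. 0))) \<and>
      (\<forall>v. f v + g v - (f (\<pi> v) + g (\<pi> v)) = (\<Sum>e\<in>E. M e v * l e v))"
    by (intro exI[of _ "\<lambda>e v. M e v + N e v"])
      (auto intro: form.add simp: distrib_right sum.distrib algebra_simps)
  then show ?case using add.IH form.add by blast
next
  case (mult m f n g)
  then obtain M N where
    M: "\<forall>e\<in>E. form d (m - 1) (M e) \<and> (m = 0 \<longrightarrow> M e = (\<lambda>_. 0))" "\<forall>v. f v - f (\<pi> v) = (\<Sum>e\<in>E. M e v * l e v)" and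
    N: "\<forall>e\<in>E. form d (n - 1) (N e) \<and> (n = 0 \<longrightarrow> N e = (\<lambda>_. 0))" "\<forall>v. g v - g (\<pi> v) = (\<Sum>e\<in>E. N e v * l e v)"
    by blast
  have f\<pi>: "form d m (\<lambda>v. f (\<pi> v))" using mult.IH(1) by blast
  define K where "K e v = M e v * g v + f (\<pi> v) * N e v" for e v
  have K: "form d (m + n - 1) (K e) \<and> (m + n = 0 \<longrightarrow> K e = (\<lambda>_. 0))" if e: "e \<in> E" for e
  proof -
    have 1: "form d (m + n - 1) (\<lambda>v. M e v * g v)"
    proof (cases "m = 0")
      case True
      then show ?thesis using M(1) e by (simp add: form.zero)
    next
      case False
      then show ?thesis using form.mult[of d "m - 1" "M e" n g] M(1) e mult.hyps(2) by simp
    qed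
    have 2: "form d (m + n - 1) (\<lambda>v. f (\<pi> v) * N e v)"
    proof (cases "n = 0")
      case True
      then show ?thesis using N(1) e by (simp add: form.zero)
    next
      case False
      then show ?thesis using form.mult[OF f\<pi>, of "n - 1" "N e"] N(1) e by simp
    qed
    show ?thesis
      using form.add[OF 1 2] M(1) N(1) e unfolding K_def[abs_def] by auto
  qed
  have "f v * g v - f (\<pi> v) * g (\<pi> v) = (\<Sum>e\<in>E. K e v * l e v)" for v
  proof -
    have "f v * g v - f (\<pi> v) * g (\<pi> v) = (f v - f (\<pi> v)) * g v + f (\<pi> v) * (g v - g (\<pi> v))"
      by (simp add: algebra_simps)
    then show ?thesis
      unfolding M(2)[rule_format] N(2)[rule_format] K_def
      by (simp add: sum_distrib_left sum_distrib_right sum.distrib[symmetric] algebra_simps)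
  qed
  then show ?case using K form.mult[OF f\<pi>] mult.IH(2) by blast
qed

lemma form_affine_regular: "form d m f \<Longrightarrow> (\<lambda>P. f (P, 1)) \<in> affine_regular"
proof (induction rule: form.induct)
  case (gen g)
  then show ?case
    by (auto simp: gens_def affine_regular_def intro: polynomial_functions.intros)
qed (auto simp: affine_regular_def intro: polynomial_functions.intros)

text \<open>Compare the coefficients of \<open>t\<close> in the moment \<open>\<integral> (S + t R)^(k+1) Q'\<close>.\<close>

lemma center_form_derivative:
  assumes S: "poly S a = 0" "poly S b = 0" "degree S \<le> d" "\<And>k. pint a b (S ^ k * pderiv Q) = 0"
    and R: "poly R a = poly R b" "degree R \<le> d"
    and h: "\<And>t. center_form a b d Q (Suc k) (S + smult t R, 0) = t * poly h t" "poly h 0 = 0"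
  shows "pint a b (S ^ k * (R * pderiv Q)) = 0"
proof -
  obtain \<kappa> where \<kappa>: "\<kappa> \<noteq> 0" "\<And>P. degree P \<le> d \<Longrightarrow> poly P a = poly P b \<Longrightarrow>
      center_form a b d Q (Suc k) (P, 0) = \<kappa> * pint a b ((P - [:poly P a:]) ^ Suc k * pderiv Q)"
    using center_form_at_infinity by blast
  define R0 where "R0 = R - [:poly R a:]"
  define g where "g = (\<Sum>i\<le>Suc k. monom (\<kappa> * (of_nat (Suc k choose i) * pint a b (R0 ^ i * S ^ (Suc k - i) * pderiv Q))) i)"
  have "poly (pCons 0 h) t = poly g t" for t
  proof -
    have deg: "degree (S + smult t R) \<le> d"
      using S(3) R(2) by (intro degree_add_le order_trans[OF degree_smult_le]) auto
    have shift: "S + smult t R - [:poly (S + smult t R) a:] = smult t R0 + S"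
      using S(1) by (simp add: R0_def smult_diff_right)
    have ends: "poly (S + smult t R) a = poly (S + smult t R) b" using S(1,2) R(1) by simp
    have "t * poly h t = \<kappa> * pint a b ((smult t R0 + S) ^ Suc k * pderiv Q)"
      using \<kappa>(2)[OF deg ends] unfolding shift h(1) .
    also have "(smult t R0 + S) ^ Suc k * pderiv Q =
        (\<Sum>i\<le>Suc k. smult (of_nat (Suc k choose i) * t ^ i) (R0 ^ i * S ^ (Suc k - i) * pderiv Q))"
      unfolding binomial_ring sum_distrib_right
      by (intro sum.cong) (simp_all add: smult_power of_nat_poly mult_ac del: binomial_Suc_Suc)
    finally show ?thesis
      by (simp add: g_def poly_sum poly_monom pint_sum pint_smult sum_distrib_left mult_ac
          del: sum.atMost_Suc binomial_Suc_Suc)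
  qed
  then have "pCons 0 h = g" by (simp add: poly_eq_poly_eq_iff[symmetric] fun_eq_iff)
  then have "coeff g 1 = coeff h 0" by (metis One_nat_def coeff_pCons_Suc)
  also have "\<dots> = 0" using h(2) by (simp add: poly_0_coeff_0)
  finally have "coeff g 1 = 0" .
  moreover have "coeff g 1 = \<kappa> * (of_nat (Suc k) * pint a b (R0 * S ^ k * pderiv Q))"
    by (simp add: g_def coeff_sum del: sum.atMost_Suc binomial_Suc_Suc of_nat_Suc)
  ultimately have "pint a b (R0 * S ^ k * pderiv Q) = 0" using \<kappa>(1) by (simp del: of_nat_Suc)
  \<comment> \<open>\<open>R\<close> and \<open>R0\<close> differ by a constant, which contributes a
    multiple of a moment of \<open>S\<close>, that is, zero.\<close>
  moreover have "S ^ k * (R * pderiv Q) = R0 * S ^ k * pderiv Q + smult (poly R a) (S ^ k * pderiv Q)"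
    by (simp add: R0_def algebra_simps)
  ultimately show ?thesis using S(4)[of k] by (simp add: pint_add pint_smult)
qed

section \<open>Non-definiteness of the points at infinity\<close>

lemma non_composition_component_non_definite:
  assumes A: "A \<in> non_composition_components a b d Q" and Qv: "Q \<in> polys_vanishing a b"
    and S: "(S, 0) \<in> proj_cone a b d" "proj_point (S, 0) \<in> at_infinity_part a b d A"
  shows "\<not> definite_poly a b S"
proof
  assume def: "definite_poly a b S"
  have irr: "irreducible_in (subtopology (zariski_affine a b d) (center_set a b d Q)) A"
    and notcomp: "\<not> A \<subseteq> composition_set a b d Q"
    using A by (auto simp: non_composition_components_def irreducible_components_def)
  have CS: "center_set a b d Q \<subseteq> polys_vanishing_deg a b d" by (auto simp: center_set_def)
  note prime = irreducible_prime_on[OF irr CS]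
  have AP: "A \<subseteq> polys_vanishing_deg a b d" using prime(2) CS by blast
  have Sd: "S \<in> polys_vanishing_deg a b d" and S0: "S \<noteq> 0"
    using S(1) by (simp_all add: proj_cone_infinity_iff)
  note Sv = polys_vanishing_degD[OF Sd]
  have "proj_point (S, 0) \<in> at_infinity_part a b d (center_set a b d Q)"
    using S(2) at_infinity_part_mono[OF prime(2)] by blast
  then have moments: "moments_vanish a b S Q" by (rule center_set_at_infinity_moments[OF S(1)])
  obtain W where W: "poly W a = poly W b" "S \<in> comp_alg W"
    "\<And>T. T \<in> polys_vanishing a b \<Longrightarrow> moments_vanish a b S T \<Longrightarrow> T \<in> comp_alg W"
    using definite_poly_common_factor[OF def S0] by blast
  have QW: "Q \<in> comp_alg W" using W(3) Qv moments by blast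
  \<comment> \<open>For constant \<open>Q\<close> every \<open>P\<close> with equal end values
    satisfies the composition condition with \<open>W = P\<close>, so no non-composition component
    exists.\<close>
  have degQ: "degree Q > 0"
  proof (rule ccontr)
    assume "\<not> degree Q > 0"
    then obtain c where "Q = [:c:]" using degree_eq_zeroE by auto
    have "P \<in> composition_set a b d Q" if "P \<in> A" for P
    proof -
      note Pv = polys_vanishing_degD[of P a b d]
      have "poly P a = poly P b" "P \<in> comp_alg P" "Q \<in> comp_alg P"
        using that AP Pv comp_algI[of P "[:0, 1:]" P] comp_alg_const[of c P] \<open>Q = [:c:]\<close>
        by (auto simp: pcompose_pCons)
      then have "composition_condition a b P Q"
        unfolding composition_condition_comp_alg by blast
      then show ?thesis using that AP by (auto simp: composition_set_def)
    qed
    then show False using notcomp by blast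
  qed
  have "\<exists>E c. finite E \<and> (\<forall>e\<in>E. \<forall>i\<ge>Suc d. coeff e i = 0) \<and>
    (\<forall>P. (\<forall>i\<ge>Suc d. coeff P i = 0) \<longrightarrow> P - (\<Sum>e\<in>E. smult (\<Sum>i<Suc d. coeff P i * c i e) e) \<in> comp_alg W) \<and>
    (\<forall>x. (\<Sum>e\<in>E. smult (x e) e) \<in> comp_alg W \<longrightarrow> (\<forall>e\<in>E. x e = 0))"
    by (rule exists_complement) (fact comp_alg_0 comp_alg_add comp_alg_smult)+
  then obtain E c where E: "finite E" "\<forall>e\<in>E. \<forall>i\<ge>Suc d. coeff e i = 0"
    "\<forall>P. (\<forall>i\<ge>Suc d. coeff P i = 0) \<longrightarrow> P - (\<Sum>e\<in>E. smult (\<Sum>i<Suc d. coeff P i * c i e) e) \<in> comp_alg W"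
    "\<forall>x. (\<Sum>e\<in>E. smult (x e) e) \<in> comp_alg W \<longrightarrow> (\<forall>e\<in>E. x e = 0)"
    by (elim exE conjE)
  define l where "l e v = (\<Sum>i<Suc d. coeff (fst v) i * c i e)" for e and v :: "complex poly \<times> complex"
  \<comment> \<open>Projection onto \<open>comp_alg W\<close> along the span of \<open>E\<close>, on
    polynomials of degree at most \<open>d\<close>; the second component is kept.\<close>
  define \<pi> where "\<pi> v = (fst v - (\<Sum>e\<in>E. smult (l e v) e), snd v)" for v
  have l_form: "form d 1 (l e)" for e
  proof -
    have "form d 1 (\<lambda>v. \<Sum>i<Suc d. c i e * coeff (fst v) i)"
      by (intro form_sum form_smult form.gen coeff_in_gens) auto
    then show ?thesis by (simp add: l_def[abs_def] mult.commute)
  qed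
  have degE: "degree e \<le> d" if "e \<in> E" for e using E(2) that by (intro degree_le) auto
  have \<pi>_comp: "fst (\<pi> v) \<in> comp_alg W" if "degree (fst v) \<le> d" for v
  proof -
    have "\<forall>i\<ge>Suc d. coeff (fst v) i = 0" using that by (auto intro: coeff_eq_0)
    then show ?thesis using E(3) by (simp add: \<pi>_def l_def del: sum.lessThan_Suc)
  qed
  have deg_comb: "degree (\<Sum>e\<in>E. smult (x e) e) \<le> d" for x
    using degE E(1) by (intro degree_sum_le) (auto intro: order_trans[OF degree_smult_le])
  have \<pi>_deg: "degree (fst (\<pi> v)) \<le> d" if "degree (fst v) \<le> d" for v
    using degree_diff_le[OF that deg_comb] by (simp add: \<pi>_def)
  have indep: "x e = 0" if "(\<Sum>e\<in>E. smult (x e) e) \<in> comp_alg W" "e \<in> E" for x e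
    using E(4) that by blast
  have l_comp: "l e v = 0" if "degree (fst v) \<le> d" "fst v \<in> comp_alg W" "e \<in> E" for e v
  proof (rule indep[OF _ that(3), of "\<lambda>e. l e v"])
    have "fst v - fst (\<pi> v) \<in> comp_alg W" by (intro comp_alg_diff that \<pi>_comp)
    then show "(\<Sum>e\<in>E. smult (l e v) e) \<in> comp_alg W" by (simp add: \<pi>_def)
  qed
  have l_comb: "l e (\<Sum>e\<in>E. smult (x e) e, \<nu>) = x e" if "e \<in> E" for e x \<nu>
  proof -
    let ?v = "(\<Sum>e\<in>E. smult (x e) e, \<nu>)"
    have "fst (\<pi> ?v) = (\<Sum>e\<in>E. smult (x e - l e ?v) e)"
      by (simp add: \<pi>_def smult_diff_left sum_subtractf)
    then have "x e - l e ?v = 0"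
      using indep[OF _ that, of "\<lambda>e. x e - l e ?v"] \<pi>_comp[of ?v] deg_comb by simp
    then show ?thesis by simp
  qed
  have l_lin: "l e (P + smult t R, \<nu>) = l e (P, \<nu>') + t * l e (R, \<nu>'')" for e P R t \<nu> \<nu>' \<nu>''
    by (simp add: l_def algebra_simps sum.distrib sum_distrib_left del: sum.lessThan_Suc)
  let ?F = "center_form a b d Q"
  have "\<exists>M. (\<forall>e\<in>E. form d (n - 1) (M e)) \<and> (\<forall>v. ?F n v - ?F n (\<pi> v) = (\<Sum>e\<in>E. M e v * l e v))" for n
  proof -
    from form_difference[where E = E and l = l and d = d, OF l_form form_center_form[of d n a b Q], THEN conjunct2]
    obtain M where "\<forall>e\<in>E. form d (n - 1) (M e) \<and> (n = 0 \<longrightarrow> M e = (\<lambda>_. 0))"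
      "\<forall>v. ?F n v - ?F n (fst v - (\<Sum>e\<in>E. smult (l e v) e), snd v) = (\<Sum>e\<in>E. M e v * l e v)"
      by (elim exE conjE)
    then show ?thesis unfolding \<pi>_def by (intro exI[of _ M]) simp
  qed
  then obtain M where "\<forall>n. (\<forall>e\<in>E. form d (n - 1) (M n e)) \<and>
      (\<forall>v. ?F n v - ?F n (\<pi> v) = (\<Sum>e\<in>E. M n e v * l e v))"
    using choice[of "\<lambda>n M. (\<forall>e\<in>E. form d (n - 1) (M e)) \<and> (\<forall>v. ?F n v - ?F n (\<pi> v) = (\<Sum>e\<in>E. M e v * l e v))"]
    by auto
  then have M: "\<And>n e. e \<in> E \<Longrightarrow> form d (n - 1) (M n e)"
    "\<And>n v. ?F n v - ?F n (\<pi> v) = (\<Sum>e\<in>E. M n e v * l e v)" by blast+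
  have M_F: "(\<Sum>e\<in>E. M n e v * l e v) = ?F n v" if "degree (fst v) \<le> d" for n v
  proof -
    have "?F n (\<pi> v) = 0"
      using \<pi>_comp[OF that] QW W(1) \<pi>_deg[OF that] by (rule center_form_comp_alg)
    then show ?thesis using M(2)[of n v] by simp
  qed
  \<comment> \<open>The row of equal end values, with constant entries. It forces
    \<open>R(a) = R(b)\<close> for a kernel direction \<open>R\<close>, so that the moment formula
    applies to \<open>S + smult t R\<close>.\<close>
  define M0 where "M0 e v = poly e b - poly e a" for e and v :: "complex poly \<times> complex"
  define rows where "rows = insert M0 (range M)"
  have "\<exists>D k. form d k D \<and> D (S, 0) \<noteq> 0 \<and>
    (\<forall>v x. D v \<noteq> 0 \<longrightarrow> (\<forall>N\<in>rows. (\<Sum>e\<in>E. N e v * x e) = 0) \<longrightarrow> (\<forall>e\<in>E. x e = 0))"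
  proof (rule injective_off_hypersurface[OF E(1)])
    fix N assume "N \<in> rows"
    then show "\<exists>m. \<forall>e\<in>E. form d m (N e)"
      unfolding rows_def using M(1) form.const[of d] by (auto simp: M0_def[abs_def])
  next
    fix x assume x: "\<And>N. N \<in> rows \<Longrightarrow> (\<Sum>e\<in>E. N e (S, 0) * x e) = 0"
    define R where "R = (\<Sum>e\<in>E. smult (x e) e)"
    have Rd: "degree R \<le> d" unfolding R_def by (rule deg_comb)
    have "(\<Sum>e\<in>E. M0 e (S, 0) * x e) = poly R b - poly R a"
      by (simp add: M0_def R_def poly_sum sum_subtractf algebra_simps)
    then have Rab: "poly R a = poly R b" using x[of M0] by (simp add: rows_def)
    \<comment> \<open>Along \<open>S + smult t R\<close> the coordinates are \<open>t * x e\<close>,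
      because those of \<open>S\<close> vanish. The kernel condition for the row
      \<open>M (Suc k)\<close> therefore says that the form of index \<open>k + 1\<close> vanishes
      to second order at \<open>t = 0\<close>, which is the condition on \<open>R\<close> with
      exponent \<open>k\<close>.\<close>
    have "R \<in> comp_alg W"
    proof (rule tangent_direction_in_comp_alg[OF QW degQ W(3)])
      fix k
      have "\<forall>e. \<exists>h. e \<in> E \<longrightarrow> (\<forall>t. M (Suc k) e (S + smult t R, 0) = poly h t)"
        using PF_line[OF form_PF[OF M(1)], where v = "(S, 0)" and w = "(R, 0)"] by fastforce
      then obtain h where h: "\<And>e t. e \<in> E \<Longrightarrow> M (Suc k) e (S + smult t R, 0) = poly (h e) t" by metis
      let ?h = "\<Sum>e\<in>E. smult (x e) (h e)"
      show "pint a b (S ^ k * (R * pderiv Q)) = 0"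
      proof (rule center_form_derivative[OF Sv(1-3) _ Rab Rd])
        show "pint a b (S ^ k * pderiv Q) = 0" for k using moments by (simp add: moments_vanish_iff)
        show "?F (Suc k) (S + smult t R, 0) = t * poly ?h t" for t
        proof -
          have "degree (S + smult t R) \<le> d"
            using Sv(3) Rd by (intro degree_add_le order_trans[OF degree_smult_le]) auto
          then have "?F (Suc k) (S + smult t R, 0) =
              (\<Sum>e\<in>E. M (Suc k) e (S + smult t R, 0) * l e (S + smult t R, 0))" by (simp add: M_F)
          also have "\<dots> = (\<Sum>e\<in>E. poly (h e) t * (t * x e))"
          proof (rule sum.cong[OF refl])
            fix e assume e: "e \<in> E"
            have "l e (S + smult t R, 0) = l e (S, 0) + t * l e (R, 0)" by (rule l_lin)
            also have "\<dots> = t * x e"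
              using l_comp[of "(S, 0)" e] l_comb[OF e, of x 0] Sv(3) W(2) e by (simp add: R_def)
            finally show "M (Suc k) e (S + smult t R, 0) * l e (S + smult t R, 0) = poly (h e) t * (t * x e)"
              using h[OF e] by simp
          qed
          finally show ?thesis by (simp add: poly_sum sum_distrib_left algebra_simps)
        qed
        have "poly ?h 0 = (\<Sum>e\<in>E. M (Suc k) e (S, 0) * x e)"
          using h[of _ 0] by (simp add: poly_sum mult.commute)
        then show "poly ?h 0 = 0" using x[of "M (Suc k)"] by (simp add: rows_def)
      qed
    qed
    then show "\<forall>e\<in>E. x e = 0" unfolding R_def using indep by blast
  qed
  then obtain D k where D: "form d k D" "D (S, 0) \<noteq> 0"
    "\<And>v x. D v \<noteq> 0 \<Longrightarrow> \<forall>N\<in>rows. (\<Sum>e\<in>E. N e v * x e) = 0 \<Longrightarrow> \<forall>e\<in>E. x e = 0" by blast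
  \<comment> \<open>The coordinates of \<open>P\<close> themselves form a kernel vector at
    \<open>(P, 1)\<close>: the center equations hold at \<open>P\<close> and vanish at its
    projection, and both polynomials have equal end values.\<close>
  have off: "D (P, 1) = 0 \<or> (\<forall>e\<in>E. l e (P, 1) = 0)" if P: "P \<in> A" for P
  proof -
    have Pd: "P \<in> polys_vanishing_deg a b d" and PC: "P \<in> center_set a b d Q"
      using P AP prime(2) by blast+
    note Pv = polys_vanishing_degD[OF Pd]
    have "(\<Sum>e\<in>E. M n e (P, 1) * l e (P, 1)) = 0" for n
      using M_F[of "(P, 1)" n] Pv(3) center_form_center_set[OF PC] by simp
    moreover have "(\<Sum>e\<in>E. M0 e (P, 1) * l e (P, 1)) = 0"
    proof -
      have "poly (fst (\<pi> (P, 1))) a = poly (fst (\<pi> (P, 1))) b"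
        by (rule comp_alg_poly_eq[OF \<pi>_comp W(1)]) (simp add: Pv(3))
      then show ?thesis
        using Pv(1,2) by (simp add: \<pi>_def M0_def poly_sum sum_subtractf algebra_simps)
    qed
    ultimately have "\<forall>N\<in>rows. (\<Sum>e\<in>E. N e (P, 1) * l e (P, 1)) = 0" by (auto simp: rows_def)
    then show ?thesis using D(3)[of "(P, 1)" "\<lambda>e. l e (P, 1)"] by blast
  qed
  obtain P0 where P0: "P0 \<in> A" "P0 \<notin> composition_set a b d Q" using notcomp by blast
  have "\<exists>e\<in>E. l e (P0, 1) \<noteq> 0"
  proof (rule ccontr)
    assume "\<not> ?thesis"
    moreover have P0d: "P0 \<in> polys_vanishing_deg a b d" using P0(1) AP by blast
    ultimately have "P0 \<in> comp_alg W"
      using \<pi>_comp[of "(P0, 1)"] polys_vanishing_degD(3)[OF P0d] by (simp add: \<pi>_def)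
    then have "P0 \<in> composition_set a b d Q"
      using W(1) QW P0d by (auto simp: composition_set_def composition_condition_comp_alg)
    then show False using P0(2) by blast
  qed
  then obtain e where e: "e \<in> E" "l e (P0, 1) \<noteq> 0" by blast
  have "(\<forall>P\<in>A. D (P, 1) = 0) \<or> (\<forall>P\<in>A. l e (P, 1) = 0)"
    using prime(1)[unfolded prime_on_def, rule_format, OF form_affine_regular[OF D(1)]
        form_affine_regular[OF l_form[of e]]] off e(1) by auto
  then have "\<forall>P\<in>A. D (P, 1) = 0" using P0(1) e(2) by blast
  then have "D (S, 0) = 0"
    using at_infinity_part_iff[OF AP S(1)] S(2) form_homogeneous[OF D(1)] by blast
  then show False using D(2) by blast
qed

theorem theorem1p3:
  fixes a b :: complex and Q :: "complex poly" and d :: nat and A :: "complex poly set"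
  assumes "a \<noteq> b"
    and "Q \<in> polys_vanishing a b"
    and "A \<in> non_composition_components a b d Q"
  shows "at_infinity_part a b d A
           \<subseteq> at_infinity_part a b d (center_set a b d Q) \<inter> non_definite_at_infinity a b d
       \<and> at_infinity_part a b d (center_set a b d Q) \<inter> non_definite_at_infinity a b d
           \<subseteq> at_infinity_part a b d (moment_set a b d Q) \<inter> non_definite_at_infinity a b d
       \<and> krull_dim (subtopology (zariski_affine a b d) A)
           \<le> krull_dim (subtopology (zariski_proj a b d)
               (at_infinity_part a b d (moment_set a b d Q) \<inter> non_definite_at_infinity a b d)) + 1"
proof -
  let ?CS = "center_set a b d Q" and ?MS = "moment_set a b d Q"
  have "A \<subseteq> topspace (subtopology (zariski_affine a b d) ?CS)"
    using assms(3) unfolding non_composition_components_def irreducible_components_def irreducible_in_def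
    by blast
  then have A: "A \<subseteq> ?CS" "A \<subseteq> polys_vanishing_deg a b d" by auto
  have first: "at_infinity_part a b d A \<subseteq> at_infinity_part a b d ?CS \<inter> non_definite_at_infinity a b d"
  proof
    fix X assume X: "X \<in> at_infinity_part a b d A"
    then obtain S where S: "X = proj_point (S, 0)" "(S, 0) \<in> proj_cone a b d"
      by (rule at_infinity_partE)
    then have "\<not> definite_poly a b S"
      using non_composition_component_non_definite[OF assms(3,2) S(2)] X by blast
    moreover have "S \<in> polys_vanishing a b"
      using S(2) polys_vanishing_degD(4) by (auto simp: proj_cone_infinity_iff)
    ultimately have "X \<in> non_definite_at_infinity a b d"
      using S unfolding non_definite_at_infinity_def non_definite_set_def by blast
    then show "X \<in> at_infinity_part a b d ?CS \<inter> non_definite_at_infinity a b d"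
      using at_infinity_part_mono[OF A(1)] X by blast
  qed
  have second: "at_infinity_part a b d ?CS \<subseteq> at_infinity_part a b d ?MS"
  proof
    fix X assume X: "X \<in> at_infinity_part a b d ?CS"
    then obtain S where S: "X = proj_point (S, 0)" "(S, 0) \<in> proj_cone a b d"
      by (rule at_infinity_partE)
    have "moments_vanish a b S Q"
      using X S(1) by (intro center_set_at_infinity_moments[OF S(2)]) simp
    then show "X \<in> at_infinity_part a b d ?MS"
      unfolding S(1) by (rule moments_at_infinity[OF S(2)])
  qed
  have "at_infinity_part a b d A \<subseteq> at_infinity_part a b d ?MS \<inter> non_definite_at_infinity a b d"
    using first second by blast
  from krull_dim_le_at_infinity[OF A(2) this] show ?thesis
    using first second by blast
qed

end
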